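(* Suppose that assumptions (H1)-(H4) of the context hold and let $\xi_0\in\mathcal{L}^2_{\mathscr{F}_0}$. If the conditional distribution dependent FBSDE $$\left\{\begin{aligned} dX_t&=b(t,X_t,\hat u_t,\mathcal{L}(X_t|\tilde{\mathscr F}_t))\,dt+\sigma(t,X_t,\hat u_t,\mathcal{L}(X_t|\tilde{\mathscr F}_t))\,dW_t+\tilde\sigma(t,X_t,\hat u_t,\mathcal{L}(X_t|\tilde{\mathscr F}_t))\,d\tilde W_t,\quad t\in(0,T];\\ dp_t&=-\partial_xH(t,X_t,p_t,q_t,\tilde q_t,\hat u_t,\mathcal{L}(X_t|\tilde{\mathscr F}_t))\,dt+q_t\,dW_t+\tilde q_t\,d\tilde W_t,\quad t\in[0,T);\\ X_0&=\xi_0,\quad p_T=g_x(X_T,\mathcal{L}(X_T|\tilde{\mathscr F}_T)), \end{aligned}\right.$$ with $\hat u_t:=\hat u(t,X_t,p_t,q_t,\tilde q_t)$, has an ($\mathscr F$-)adapted solution $\{(\hat X_t,\hat p_t,\hat q_t,\hat{\tilde q}_t),0\le t\le T\}$ such that $$\mathbb{E}\Big[\sup_{0\le t\le T}|(\hat X_t,\hat p_t)|^2+\int_0^T|(\hat q_t,\hat{\tilde q}_t)|^2dt\Big]<\infty,$$ then $\hat u_t=\hat u(t,\hat X_t,\hat p_t,\hat q_t,\hat{\tilde q}_t)$, $0\le t\le T$, is an optimal control of the mean field game problem with common noise, that is: $\hat u\in\mathcal{L}^2_{\mathscr F}(0,T)$ and, with $X^{u}$ denoting the solution of $$X^u_t=\xi_0+\int_0^tb(s,X^u_s,u_s,m_s)ds+\int_0^t\sigma(s,X^u_s,u_s,m_s)dW_s+\int_0^t\tilde\sigma(s,X^u_s,u_s,m_s)d\tilde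 W_s,\quad t\in[0,T],$$ where $m_t=\mathcal{L}(X^{\hat u}_t|\tilde{\mathscr F}_t)$, one has $$\hat u\in\operatorname{argmin}_{u\in\mathcal{L}^2_{\mathscr F}(0,T)}J(u|m),\qquad J(u|m):=\mathbb{E}\Big[\int_0^Tf(t,X^u_t,u_t,m_t)dt+g(X^u_T,m_T)\Big].$$
   Context: Setting. $T>0$ is fixed; $W$ and $\tilde W$ are independent one-dimensional Brownian motions on a complete probability space $(\Omega,\mathbb{P})$; $\xi_0$ is a square-integrable random variable independent of $(W,\tilde W)$. $\mathscr F=\{\mathscr F_t\}_{0\le t\le T}$ is the natural filtration of $(\xi_0,W,\tilde W)$ and $\tilde{\mathscr F}=\{\tilde{\mathscr F}_t\}_{0\le t\le T}$ the natural filtration of $\tilde W$ (the common noise), both augmented by all $\mathbb{P}$-null sets. $\mathcal{L}(\cdot|\tilde{\mathscr F}_t)$ is the conditional law given $\tilde{\mathscr F}_t$. $\mathcal{L}^2_{\mathscr F_t}$ is the set of $\mathscr F_t$-measurable square-integrable real random variables; $\mathcal{L}^2_{\mathscr F}(s,t)$ is the set of real $\mathscr F$-progressively measurable processes $\alpha$ on $[s,t]$ with $\mathbb{E}\int_s^t|\alpha_r|^2dr<\infty$. $\mathcal{P}_2(\mathbb{R})$ is the set of Borel probability measures on $\mathbb{R}$ with finite second moment. Data: measurable functions $b,\sigma,\tilde\sigma,f:[0,T]\times\mathbb{R}\times\mathbb{R}\times\mathcal{P}_2(\mathbb{R})\to\mathbb{R}$ (arguments $(t,x,u,m)$) and $g:\mathbb{R}\times\mathcal{P}_2(\mathbb{R})\to\mathbb{R}$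 (arguments $(x,m)$). Subscripts $x,u$ on $f,g$ and on $f_0,f_1$ below denote partial derivatives. $L>0$ is a constant. (H1) For $\phi=b,\sigma,\tilde\sigma$: $\phi(t,x,u,m)=\phi_0(t,m)+\phi_1(t)x+\phi_2(t)u$ with measurable deterministic $\phi_0,\phi_1,\phi_2$, $|\phi_0(t,m)|\le L(1+(\int|x|^2dm(x))^{1/2})$, and $\phi_1,\phi_2$ bounded by $L$. Further, $(\sigma_2,\tilde\sigma_2)$ is bounded by a positive constant $B_u\le L$. (H2) $f(t,\cdot,\cdot,m)$ and $g(\cdot,m)$ are differentiable, and $\max\{|f(t,0,0,m)|,|g(0,m)|\}\le L(1+\int|x|^2dm(x))$, $\max\{|f_x(t,x,u,m)|,|f_u(t,x,u,m)|,|g_x(x,m)|\}\le L(1+|x|+|u|+(\int|y|^2dm(y))^{1/2})$ for all $(t,x,u,m)$. (H3) $f(t,x,u,m)=f_0(t,x,u)+f_1(t,x,m)$, with $f_0$ differentiable in $(x,u)$ and $f_1$ differentiable in $x$; $(f_{0x},f_{0u})(t,\cdot,\cdot)$ is $L$-Lipschitz uniformly in $t$; $f_{1x}(t,\cdot,m)$ is $L$-Lipschitz uniformly in $(t,m)$; $g_x(\cdot,m)$ is $L$-Lipschitz uniformly in $m$. (H4) $(f_{1x}(t,x',m)-f_{1x}(t,x,m))(x'-x)\ge0$ and $(g_x(x',m)-g_x(x,m))(x'-x)\ge0$ for all $t,x,x',m$; and for some $C_f>0$, $f_0(t,x',u')-f_0(t,x,u)-(f_{0x},f_{0u})(t,x,u)\cdot(x'-x,u'-u)\ge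 C_f|u'-u|^2$ for all $t,x,x',u,u'$. Hamiltonian: $H(t,x,p,q,\tilde q,u,m):=b(t,x,u,m)p+\sigma(t,x,u,m)q+\tilde\sigma(t,x,u,m)\tilde q+f(t,x,u,m)$. Under (H1)-(H4), $\hat u(t,x,p,q,\tilde q)$ denotes its unique minimizer in $u$, which does not depend on $m$; it is characterized by $b_2(t)p+\sigma_2(t)q+\tilde\sigma_2(t)\tilde q+f_{0u}(t,x,\hat u(t,x,p,q,\tilde q))=0$. *)

theory Defs
  imports "HOL-Probability.Probability"
begin

section \<open>Noise and filtrations\<close>

text \<open>
  Processes are curried functions of time and scenario; only times in \<open>{0..T}\<close> matter.
\<close>

definition path_upto :: "real \<Rightarrow> (real \<Rightarrow> 'a \<Rightarrow> real) \<Rightarrow> 'a \<Rightarrow> (real \<Rightarrow> real)" where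
  "path_upto t W = (\<lambda>\<omega>. \<lambda>s\<in>{0..t}. W s \<omega>)"

abbreviation path_space :: "real \<Rightarrow> (real \<Rightarrow> real) measure" where
  "path_space t \<equiv> PiM {0..t} (\<lambda>_. borel)"

definition events_of :: "'a measure \<Rightarrow> 'b measure \<Rightarrow> ('a \<Rightarrow> 'b) \<Rightarrow> 'a set set" where
  "events_of M N X = sets (vimage_algebra (space M) X N)"

text \<open>
  The library's \<open>indep_var\<close> needs both random variables to have the same value type, hence
  independence is stated for the generated sigma-algebras.
\<close>

definition indep_rv :: "'a measure \<Rightarrow> 'b measure \<Rightarrow> ('a \<Rightarrow> 'b) \<Rightarrow> 'c measure \<Rightarrow> ('a \<Rightarrow> 'c) \<Rightarrow> bool" where
  "indep_rv M N X K Y \<longleftrightarrow> prob_space.indep_set M (events_of M N X) (events_of M K Y)"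

definition brownian_motion :: "'a measure \<Rightarrow> real \<Rightarrow> (real \<Rightarrow> 'a \<Rightarrow> real) \<Rightarrow> bool" where
  "brownian_motion M T W \<longleftrightarrow>
     (\<forall>t\<in>{0..T}. W t \<in> borel_measurable M) \<and>
     (AE \<omega> in M. W 0 \<omega> = 0) \<and>
     (AE \<omega> in M. continuous_on {0..T} (\<lambda>t. W t \<omega>)) \<and>
     (\<forall>s t. 0 \<le> s \<and> s < t \<and> t \<le> T \<longrightarrow>
        distributed M lborel (\<lambda>\<omega>. W t \<omega> - W s \<omega>) (normal_density 0 (sqrt (t - s))) \<and>
        indep_rv M (path_space s) (path_upto s W) borel (\<lambda>\<omega>. W t \<omega> - W s \<omega>))"

definition common_noise_setup ::
    "'a measure \<Rightarrow> real \<Rightarrow> (real \<Rightarrow> 'a \<Rightarrow> real) \<Rightarrow> (real \<Rightarrow> 'a \<Rightarrow> real) \<Rightarrow> ('a \<Rightarrow> real) \<Rightarrow> bool" where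
  "common_noise_setup M T W tW \<xi> \<longleftrightarrow>
     prob_space M \<and> complete_measure M \<and> 0 < T \<and>
     brownian_motion M T W \<and> brownian_motion M T tW \<and>
     indep_rv M (path_space T) (path_upto T W) (path_space T) (path_upto T tW) \<and>
     \<xi> \<in> borel_measurable M \<and> integrable M (\<lambda>\<omega>. (\<xi> \<omega>)\<^sup>2) \<and>
     indep_rv M borel \<xi>
       (path_space T \<Otimes>\<^sub>M path_space T) (\<lambda>\<omega>. (path_upto T W \<omega>, path_upto T tW \<omega>))"

definition full_filtration ::
    "'a measure \<Rightarrow> (real \<Rightarrow> 'a \<Rightarrow> real) \<Rightarrow> (real \<Rightarrow> 'a \<Rightarrow> real) \<Rightarrow> ('a \<Rightarrow> real) \<Rightarrow> real \<Rightarrow> 'a measure" where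
  "full_filtration M W tW \<xi> t =
     sigma (space M)
       (events_of M borel \<xi> \<union> (\<Union>s\<in>{0..t}. events_of M borel (W s) \<union> events_of M borel (tW s)) \<union> null_sets M)"

definition noise_filtration :: "'a measure \<Rightarrow> (real \<Rightarrow> 'a \<Rightarrow> real) \<Rightarrow> real \<Rightarrow> 'a measure" where
  "noise_filtration M tW t =
     sigma (space M) ((\<Union>s\<in>{0..t}. events_of M borel (tW s)) \<union> null_sets M)"

definition progressive ::
    "real \<Rightarrow> (real \<Rightarrow> 'a measure) \<Rightarrow> 'b measure \<Rightarrow> (real \<Rightarrow> 'a \<Rightarrow> 'b) \<Rightarrow> bool" where
  "progressive T F N \<alpha> \<longleftrightarrow>
     (\<forall>t\<in>{0..T}. (\<lambda>(s, \<omega>). \<alpha> s \<omega>) \<in> restrict_space borel {0..t} \<Otimes>\<^sub>M F t \<rightarrow>\<^sub>M N)"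

definition L2_prog :: "'a measure \<Rightarrow> real \<Rightarrow> (real \<Rightarrow> 'a measure) \<Rightarrow> (real \<Rightarrow> 'a \<Rightarrow> real) set" where
  "L2_prog M T F =
     {\<alpha>. progressive T F borel \<alpha> \<and>
         (\<integral>\<^sup>+\<omega>. (\<integral>\<^sup>+t\<in>{0..T}. ennreal ((\<alpha> t \<omega>)\<^sup>2) \<partial>lborel) \<partial>M) < \<infinity>}"


section \<open>The Ito integral\<close>

text \<open>
  A simple process \<open>\<Sum>i<n. h\<^sub>i 1\<^bsub>(\<tau>\<^sub>i,\<tau>\<^sub>i\<^sub>+\<^sub>1]\<^esub>\<close> is given by \<open>n\<close>, the partition \<open>\<tau>\<close> and the
  bounded coefficients \<open>h\<close>.  The Ito integral over \<open>{0..t}\<close> of a square-integrable progressive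
  process is the \<open>L\<^sup>2\<close>-limit of the integrals of simple processes that converge to it in
  \<open>L\<^sup>2(dt \<otimes> P)\<close>.  It is determined up to null sets, so, like \<open>has_integral\<close>, it is a relation.
\<close>

definition simple_integrand ::
    "real \<Rightarrow> (real \<Rightarrow> 'a measure) \<Rightarrow> nat \<Rightarrow> (nat \<Rightarrow> real) \<Rightarrow> (nat \<Rightarrow> 'a \<Rightarrow> real) \<Rightarrow> bool" where
  "simple_integrand T F n \<tau> h \<longleftrightarrow>
     (\<forall>i\<le>n. \<tau> i \<in> {0..T}) \<and> (\<forall>i<n. \<tau> i \<le> \<tau> (Suc i)) \<and>
     (\<forall>i<n. h i \<in> borel_measurable (F (\<tau> i)) \<and> (\<exists>C. \<forall>\<omega>\<in>space (F (\<tau> i)). \<bar>h i \<omega>\<bar> \<le> C))"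

definition simple_process ::
    "nat \<Rightarrow> (nat \<Rightarrow> real) \<Rightarrow> (nat \<Rightarrow> 'a \<Rightarrow> real) \<Rightarrow> real \<Rightarrow> 'a \<Rightarrow> real" where
  "simple_process n \<tau> h s \<omega> = (\<Sum>i<n. h i \<omega> * indicator {\<tau> i<..\<tau> (Suc i)} s)"

definition simple_ito ::
    "(real \<Rightarrow> 'a \<Rightarrow> real) \<Rightarrow> nat \<Rightarrow> (nat \<Rightarrow> real) \<Rightarrow> (nat \<Rightarrow> 'a \<Rightarrow> real) \<Rightarrow> real \<Rightarrow> 'a \<Rightarrow> real" where
  "simple_ito W n \<tau> h t \<omega> = (\<Sum>i<n. h i \<omega> * (W (min (\<tau> (Suc i)) t) \<omega> - W (min (\<tau> i) t) \<omega>))"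

definition has_ito_integral ::
    "'a measure \<Rightarrow> real \<Rightarrow> (real \<Rightarrow> 'a measure) \<Rightarrow> (real \<Rightarrow> 'a \<Rightarrow> real) \<Rightarrow>
     (real \<Rightarrow> 'a \<Rightarrow> real) \<Rightarrow> real \<Rightarrow> ('a \<Rightarrow> real) \<Rightarrow> bool" where
  "has_ito_integral M T F W \<gamma> t I \<longleftrightarrow>
     \<gamma> \<in> L2_prog M T F \<and> I \<in> borel_measurable M \<and>
     (\<exists>n \<tau> h.
        (\<forall>k. simple_integrand T F (n k) (\<tau> k) (h k)) \<and>
        (\<lambda>k. \<integral>\<^sup>+\<omega>. (\<integral>\<^sup>+s\<in>{0..t}.
            ennreal ((simple_process (n k) (\<tau> k) (h k) s \<omega> - \<gamma> s \<omega>)\<^sup>2) \<partial>lborel) \<partial>M) \<longlonglongrightarrow> 0 \<and>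
        (\<lambda>k. \<integral>\<^sup>+\<omega>. ennreal ((simple_ito W (n k) (\<tau> k) (h k) t \<omega> - I \<omega>)\<^sup>2) \<partial>M) \<longlonglongrightarrow> 0)"

text \<open>\<open>dZ\<^sub>t = \<beta>\<^sub>t dt + \<gamma>\<^sub>t dW\<^sub>t + t\<gamma>\<^sub>t dtW\<^sub>t\<close> on \<open>{0..T}\<close>\<close>

definition has_ito_differential ::
    "'a measure \<Rightarrow> real \<Rightarrow> (real \<Rightarrow> 'a measure) \<Rightarrow> (real \<Rightarrow> 'a \<Rightarrow> real) \<Rightarrow> (real \<Rightarrow> 'a \<Rightarrow> real) \<Rightarrow>
     (real \<Rightarrow> 'a \<Rightarrow> real) \<Rightarrow> (real \<Rightarrow> 'a \<Rightarrow> real) \<Rightarrow> (real \<Rightarrow> 'a \<Rightarrow> real) \<Rightarrow> (real \<Rightarrow> 'a \<Rightarrow> real) \<Rightarrow> bool" where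
  "has_ito_differential M T F W tW Z \<beta> \<gamma> t\<gamma> \<longleftrightarrow>
     progressive T F borel Z \<and> (AE \<omega> in M. continuous_on {0..T} (\<lambda>t. Z t \<omega>)) \<and>
     (AE \<omega> in M. set_integrable lborel {0..T} (\<lambda>s. \<beta> s \<omega>)) \<and>
     (\<forall>t\<in>{0..T}. \<exists>I tI.
        has_ito_integral M T F W \<gamma> t I \<and> has_ito_integral M T F tW t\<gamma> t tI \<and>
        (AE \<omega> in M. Z t \<omega> = Z 0 \<omega> + (LINT s:{0..t}|lborel. \<beta> s \<omega>) + I \<omega> + tI \<omega>))"


section \<open>Square-integrable laws and conditional laws\<close>

definition P2 :: "real measure set" where
  "P2 = {m \<in> space (prob_algebra borel). integrable m (\<lambda>x. x\<^sup>2)}"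

text \<open>
  The sigma-algebra generated by the evaluations \<open>m \<mapsto> m(A)\<close>; it is the Borel sigma-algebra
  of the weak topology and, on \<open>P2\<close>, also that of the quadratic Wasserstein distance.
\<close>

definition P2_algebra :: "real measure measure" where
  "P2_algebra = restrict_space (prob_algebra borel) P2"

definition second_moment :: "real measure \<Rightarrow> real" where
  "second_moment m = (\<integral>x. x\<^sup>2 \<partial>m)"

definition cond_law :: "'a measure \<Rightarrow> 'a measure \<Rightarrow> ('a \<Rightarrow> real) \<Rightarrow> ('a \<Rightarrow> real measure) \<Rightarrow> bool" where
  "cond_law M G X \<mu> \<longleftrightarrow>
     \<mu> \<in> G \<rightarrow>\<^sub>M prob_algebra borel \<and>
     (\<forall>A\<in>sets borel. AE \<omega> in M.
        measure (\<mu> \<omega>) A = real_cond_exp M G (\<lambda>\<omega>'. indicator A (X \<omega>')) \<omega>)"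

text \<open>
  For each single \<open>t\<close> the conditional law is unique only up to a null set.  The time integrals
  require a version that is jointly measurable and takes its values in \<open>P2\<close>.
\<close>

definition cond_law_flow ::
    "'a measure \<Rightarrow> real \<Rightarrow> (real \<Rightarrow> 'a measure) \<Rightarrow> (real \<Rightarrow> 'a \<Rightarrow> real) \<Rightarrow> (real \<Rightarrow> 'a \<Rightarrow> real measure) \<Rightarrow> bool" where
  "cond_law_flow M T tF X m \<longleftrightarrow>
     progressive T tF P2_algebra m \<and> (\<forall>t\<in>{0..T}. cond_law M (tF t) (X t) (m t))"


section \<open>Coefficients\<close>

type_synonym coeff = "real \<Rightarrow> real \<Rightarrow> real \<Rightarrow> real measure \<Rightarrow> real"

abbreviation time_space :: "real \<Rightarrow> real measure" where
  "time_space T \<equiv> restrict_space borel {0..T}"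

definition measurable_coeff :: "real \<Rightarrow> coeff \<Rightarrow> bool" where
  "measurable_coeff T \<phi> \<longleftrightarrow>
     (\<lambda>(t, x, u, m). \<phi> t x u m) \<in> borel_measurable (time_space T \<Otimes>\<^sub>M borel \<Otimes>\<^sub>M borel \<Otimes>\<^sub>M P2_algebra)"

definition affine_coeff ::
    "real \<Rightarrow> real \<Rightarrow> coeff \<Rightarrow> (real \<Rightarrow> real measure \<Rightarrow> real) \<Rightarrow> (real \<Rightarrow> real) \<Rightarrow> (real \<Rightarrow> real) \<Rightarrow> bool" where
  "affine_coeff T L \<phi> \<phi>0 \<phi>1 \<phi>2 \<longleftrightarrow>
     (\<forall>t\<in>{0..T}. \<forall>x u. \<forall>m\<in>P2. \<phi> t x u m = \<phi>0 t m + \<phi>1 t * x + \<phi>2 t * u) \<and>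
     (\<lambda>(t, m). \<phi>0 t m) \<in> borel_measurable (time_space T \<Otimes>\<^sub>M P2_algebra) \<and>
     \<phi>1 \<in> borel_measurable (time_space T) \<and> \<phi>2 \<in> borel_measurable (time_space T) \<and>
     (\<forall>t\<in>{0..T}. \<forall>m\<in>P2. \<bar>\<phi>0 t m\<bar> \<le> L * (1 + sqrt (second_moment m))) \<and>
     (\<forall>t\<in>{0..T}. \<bar>\<phi>1 t\<bar> \<le> L \<and> \<bar>\<phi>2 t\<bar> \<le> L)"

definition H1 :: "real \<Rightarrow> real \<Rightarrow> real \<Rightarrow> coeff \<Rightarrow> coeff \<Rightarrow> coeff \<Rightarrow> bool" where
  "H1 T L Bu b \<sigma> t\<sigma> \<longleftrightarrow>
     0 < Bu \<and> Bu \<le> L \<and>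
     (\<exists>b0 b1 b2 \<sigma>0 \<sigma>1 \<sigma>2 t\<sigma>0 t\<sigma>1 t\<sigma>2.
        affine_coeff T L b b0 b1 b2 \<and> affine_coeff T L \<sigma> \<sigma>0 \<sigma>1 \<sigma>2 \<and>
        affine_coeff T L t\<sigma> t\<sigma>0 t\<sigma>1 t\<sigma>2 \<and>
        (\<forall>t\<in>{0..T}. norm (\<sigma>2 t, t\<sigma>2 t) \<le> Bu))"

definition H2 :: "real \<Rightarrow> real \<Rightarrow> coeff \<Rightarrow> (real \<Rightarrow> real measure \<Rightarrow> real) \<Rightarrow> bool" where
  "H2 T L f g \<longleftrightarrow>
     (\<forall>t\<in>{0..T}. \<forall>x u. \<forall>m\<in>P2. (\<lambda>(x, u). f t x u m) differentiable (at (x, u))) \<and>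
     (\<forall>x. \<forall>m\<in>P2. (\<lambda>x. g x m) differentiable (at x)) \<and>
     (\<forall>t\<in>{0..T}. \<forall>m\<in>P2. max \<bar>f t 0 0 m\<bar> \<bar>g 0 m\<bar> \<le> L * (1 + second_moment m)) \<and>
     (\<forall>t\<in>{0..T}. \<forall>x u. \<forall>m\<in>P2.
        Max {\<bar>deriv (\<lambda>x. f t x u m) x\<bar>, \<bar>deriv (\<lambda>u. f t x u m) u\<bar>, \<bar>deriv (\<lambda>x. g x m) x\<bar>}
          \<le> L * (1 + \<bar>x\<bar> + \<bar>u\<bar> + sqrt (second_moment m)))"

definition H3 ::
    "real \<Rightarrow> real \<Rightarrow> coeff \<Rightarrow> (real \<Rightarrow> real \<Rightarrow> real \<Rightarrow> real) \<Rightarrow> (real \<Rightarrow> real \<Rightarrow> real measure \<Rightarrow> real) \<Rightarrow>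
     (real \<Rightarrow> real measure \<Rightarrow> real) \<Rightarrow> bool" where
  "H3 T L f f0 f1 g \<longleftrightarrow>
     (\<forall>t\<in>{0..T}. \<forall>x u. \<forall>m\<in>P2. f t x u m = f0 t x u + f1 t x m) \<and>
     (\<forall>t\<in>{0..T}. \<forall>x u. (\<lambda>(x, u). f0 t x u) differentiable (at (x, u))) \<and>
     (\<forall>t\<in>{0..T}. \<forall>x. \<forall>m\<in>P2. (\<lambda>x. f1 t x m) differentiable (at x)) \<and>
     (\<forall>t\<in>{0..T}. lipschitz_on L UNIV
        (\<lambda>(x, u). (deriv (\<lambda>x. f0 t x u) x, deriv (\<lambda>u. f0 t x u) u))) \<and>
     (\<forall>t\<in>{0..T}. \<forall>m\<in>P2. lipschitz_on L UNIV (deriv (\<lambda>x. f1 t x m))) \<and>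
     (\<forall>m\<in>P2. lipschitz_on L UNIV (deriv (\<lambda>x. g x m)))"

definition H4 ::
    "real \<Rightarrow> (real \<Rightarrow> real \<Rightarrow> real \<Rightarrow> real) \<Rightarrow> (real \<Rightarrow> real \<Rightarrow> real measure \<Rightarrow> real) \<Rightarrow>
     (real \<Rightarrow> real measure \<Rightarrow> real) \<Rightarrow> bool" where
  "H4 T f0 f1 g \<longleftrightarrow>
     (\<forall>t\<in>{0..T}. \<forall>x x'. \<forall>m\<in>P2.
        (deriv (\<lambda>x. f1 t x m) x' - deriv (\<lambda>x. f1 t x m) x) * (x' - x) \<ge> 0) \<and>
     (\<forall>x x'. \<forall>m\<in>P2. (deriv (\<lambda>x. g x m) x' - deriv (\<lambda>x. g x m) x) * (x' - x) \<ge> 0) \<and>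
     (\<exists>Cf>0. \<forall>t\<in>{0..T}. \<forall>x x' u u'.
        f0 t x' u' - f0 t x u
          - (deriv (\<lambda>x. f0 t x u) x * (x' - x) + deriv (\<lambda>u. f0 t x u) u * (u' - u))
        \<ge> Cf * \<bar>u' - u\<bar>\<^sup>2)"

definition hamiltonian ::
    "coeff \<Rightarrow> coeff \<Rightarrow> coeff \<Rightarrow> coeff \<Rightarrow>
     real \<Rightarrow> real \<Rightarrow> real \<Rightarrow> real \<Rightarrow> real \<Rightarrow> real \<Rightarrow> real measure \<Rightarrow> real" where
  "hamiltonian b \<sigma> t\<sigma> f t x p q tq u m =
     b t x u m * p + \<sigma> t x u m * q + t\<sigma> t x u m * tq + f t x u m"

definition u_hat ::
    "coeff \<Rightarrow> coeff \<Rightarrow> coeff \<Rightarrow> coeff \<Rightarrow> real \<Rightarrow> real \<Rightarrow> real \<Rightarrow> real \<Rightarrow> real \<Rightarrow> real" where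
  "u_hat b \<sigma> t\<sigma> f t x p q tq =
     (THE u. \<forall>m\<in>P2. is_arg_min (\<lambda>v. hamiltonian b \<sigma> t\<sigma> f t x p q tq v m) (\<lambda>_. True) u)"


definition u_hat_process ::
    "coeff \<Rightarrow> coeff \<Rightarrow> coeff \<Rightarrow> coeff \<Rightarrow> (real \<Rightarrow> 'a \<Rightarrow> real) \<Rightarrow> (real \<Rightarrow> 'a \<Rightarrow> real) \<Rightarrow>
     (real \<Rightarrow> 'a \<Rightarrow> real) \<Rightarrow> (real \<Rightarrow> 'a \<Rightarrow> real) \<Rightarrow> real \<Rightarrow> 'a \<Rightarrow> real" where
  "u_hat_process b \<sigma> t\<sigma> f X p q tq =
     (\<lambda>t \<omega>. u_hat b \<sigma> t\<sigma> f t (X t \<omega>) (p t \<omega>) (q t \<omega>) (tq t \<omega>))"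


section \<open>The FBSDE and the mean field game\<close>

definition fbsde_solution ::
    "'a measure \<Rightarrow> real \<Rightarrow> (real \<Rightarrow> 'a \<Rightarrow> real) \<Rightarrow> (real \<Rightarrow> 'a \<Rightarrow> real) \<Rightarrow> ('a \<Rightarrow> real) \<Rightarrow>
     coeff \<Rightarrow> coeff \<Rightarrow> coeff \<Rightarrow> coeff \<Rightarrow> (real \<Rightarrow> real measure \<Rightarrow> real) \<Rightarrow>
     (real \<Rightarrow> 'a \<Rightarrow> real) \<Rightarrow> (real \<Rightarrow> 'a \<Rightarrow> real) \<Rightarrow> (real \<Rightarrow> 'a \<Rightarrow> real) \<Rightarrow> (real \<Rightarrow> 'a \<Rightarrow> real) \<Rightarrow>
     (real \<Rightarrow> 'a \<Rightarrow> real measure) \<Rightarrow> bool" where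
  "fbsde_solution M T W tW \<xi> b \<sigma> t\<sigma> f g X p q tq m \<longleftrightarrow>
     (let F = full_filtration M W tW \<xi>;
          u = u_hat_process b \<sigma> t\<sigma> f X p q tq
      in cond_law_flow M T (noise_filtration M tW) X m \<and>
         has_ito_differential M T F W tW X
           (\<lambda>t \<omega>. b t (X t \<omega>) (u t \<omega>) (m t \<omega>))
           (\<lambda>t \<omega>. \<sigma> t (X t \<omega>) (u t \<omega>) (m t \<omega>))
           (\<lambda>t \<omega>. t\<sigma> t (X t \<omega>) (u t \<omega>) (m t \<omega>)) \<and>
         has_ito_differential M T F W tW p
           (\<lambda>t \<omega>. - deriv (\<lambda>x. hamiltonian b \<sigma> t\<sigma> f t x (p t \<omega>) (q t \<omega>) (tq t \<omega>) (u t \<omega>) (m t \<omega>))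
                      (X t \<omega>))
           q tq \<and>
         (AE \<omega> in M. X 0 \<omega> = \<xi> \<omega>) \<and>
         (AE \<omega> in M. p T \<omega> = deriv (\<lambda>x. g x (m T \<omega>)) (X T \<omega>)))"

definition state_solution ::
    "'a measure \<Rightarrow> real \<Rightarrow> (real \<Rightarrow> 'a \<Rightarrow> real) \<Rightarrow> (real \<Rightarrow> 'a \<Rightarrow> real) \<Rightarrow> ('a \<Rightarrow> real) \<Rightarrow>
     coeff \<Rightarrow> coeff \<Rightarrow> coeff \<Rightarrow> (real \<Rightarrow> 'a \<Rightarrow> real measure) \<Rightarrow>
     (real \<Rightarrow> 'a \<Rightarrow> real) \<Rightarrow> (real \<Rightarrow> 'a \<Rightarrow> real) \<Rightarrow> bool" where
  "state_solution M T W tW \<xi> b \<sigma> t\<sigma> m u X \<longleftrightarrow>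
     X \<in> L2_prog M T (full_filtration M W tW \<xi>) \<and>
     has_ito_differential M T (full_filtration M W tW \<xi>) W tW X
       (\<lambda>t \<omega>. b t (X t \<omega>) (u t \<omega>) (m t \<omega>))
       (\<lambda>t \<omega>. \<sigma> t (X t \<omega>) (u t \<omega>) (m t \<omega>))
       (\<lambda>t \<omega>. t\<sigma> t (X t \<omega>) (u t \<omega>) (m t \<omega>)) \<and>
     (AE \<omega> in M. X 0 \<omega> = \<xi> \<omega>)"

definition cost ::
    "'a measure \<Rightarrow> real \<Rightarrow> coeff \<Rightarrow> (real \<Rightarrow> real measure \<Rightarrow> real) \<Rightarrow> (real \<Rightarrow> 'a \<Rightarrow> real measure) \<Rightarrow>
     (real \<Rightarrow> 'a \<Rightarrow> real) \<Rightarrow> (real \<Rightarrow> 'a \<Rightarrow> real) \<Rightarrow> real" where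
  "cost M T f g m u X =
     (\<integral>\<omega>. (LINT t:{0..T}|lborel. f t (X t \<omega>) (u t \<omega>) (m t \<omega>)) + g (X T \<omega>) (m T \<omega>) \<partial>M)"

text \<open>
  The control \<open>u\<close> minimises \<open>J(\<cdot>|m)\<close> over all square-integrable progressive controls.  The
  solution \<open>X\<^sup>u\<close> of the linear state equation is unique up to indistinguishability only, so
  \<open>J(u|m)\<close> is the cost of every version of \<open>X\<^sup>u\<close>, and the comparison is for all versions.
\<close>

definition optimal_control ::
    "'a measure \<Rightarrow> real \<Rightarrow> (real \<Rightarrow> 'a \<Rightarrow> real) \<Rightarrow> (real \<Rightarrow> 'a \<Rightarrow> real) \<Rightarrow> ('a \<Rightarrow> real) \<Rightarrow>
     coeff \<Rightarrow> coeff \<Rightarrow> coeff \<Rightarrow> coeff \<Rightarrow> (real \<Rightarrow> real measure \<Rightarrow> real) \<Rightarrow>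
     (real \<Rightarrow> 'a \<Rightarrow> real measure) \<Rightarrow> (real \<Rightarrow> 'a \<Rightarrow> real) \<Rightarrow> bool" where
  "optimal_control M T W tW \<xi> b \<sigma> t\<sigma> f g m u \<longleftrightarrow>
     u \<in> L2_prog M T (full_filtration M W tW \<xi>) \<and>
     (\<exists>X. state_solution M T W tW \<xi> b \<sigma> t\<sigma> m u X) \<and>
     (\<forall>v\<in>L2_prog M T (full_filtration M W tW \<xi>). \<forall>X Y.
        state_solution M T W tW \<xi> b \<sigma> t\<sigma> m u X \<longrightarrow> state_solution M T W tW \<xi> b \<sigma> t\<sigma> m v Y \<longrightarrow>
        cost M T f g m u X \<le> cost M T f g m v Y)"

end

theory Submission
  imports Defs
begin

text \<open>
  The statement is the sufficiency half of the stochastic maximum principle, with the law flow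
  \<open>m\<close> of the forward component kept fixed.  Let \<open>u = u_hat(X, p, q, tq)\<close> be the candidate control,
  \<open>X'\<close> any state with control \<open>u\<close> and \<open>Y\<close> a state with another control \<open>v\<close>.  Running and terminal cost
  are convex, so they lie above their tangents at \<open>(X', u)\<close>:
  \<open>J(v) - J(u) \<ge> E \<integral> f\<^sub>x (Y - X') + f\<^sub>u (v - u) dt + E g\<^sub>x(X'\<^sub>T, m\<^sub>T) (Y\<^sub>T - X'\<^sub>T)\<close>.
  The terminal condition of the adjoint equation turns the last term into \<open>E[p\<^sub>T (Y\<^sub>T - X'\<^sub>T)]\<close>, and the
  product formula for Ito processes expresses it by the coefficients of both equations.  Since the
  coefficients are affine, the drift \<open>- \<partial>\<^sub>x H\<close> of \<open>p\<close> cancels everything that multiplies \<open>Y - X'\<close> up to \<open>- f\<^sub>x\<close>,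
  so that \<open>E[p\<^sub>T (Y\<^sub>T - X'\<^sub>T)] = E \<integral> - f\<^sub>x (Y - X') + (b\<^sub>2 p + \<sigma>\<^sub>2 q + t\<sigma>\<^sub>2 tq) (v - u) dt\<close>.  By the first order
  condition for the minimiser \<open>u_hat\<close> of the Hamiltonian, the factor of \<open>v - u\<close> is \<open>- f\<^sub>u\<close>; hence the lower bound
  for \<open>J(v) - J(u)\<close> is zero (\<open>maximum_principle\<close>).

  The product formula is needed only in expectation (\<open>ito_product_expectation\<close>), and in this form it is
  pure \<open>L\<^sup>2\<close> theory: the drifts are treated by Fubini, products of a drift and a martingale part by the
  martingale property, products of two martingale parts by the isometry.  Isometry and martingale
  property hold for simple integrands because the increments of the two noises are independent of the
  augmented filtration (\<open>increments_independent\<close>), and they survive \<open>L\<^sup>2\<close>-limits.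

  The cost is compared for arbitrary versions of the two states, whereas the adjoint equation is driven by
  the given \<open>X\<close>.  The linear state equation has at most one solution up to null sets
  (\<open>state_solution_unique\<close>, again by the product formula, and Gronwall), so the derivatives of the cost
  along \<open>X'\<close> may be taken along \<open>X\<close>.

  Three facts make these computations legitimate: the minimiser \<open>u_hat\<close> depends measurably on its
  arguments and grows at most linearly, because it is the zero of a strongly monotone function; the
  second moment of \<open>m\<^sub>t\<close> has the expectation \<open>E X\<^sub>t\<^sup>2\<close>, because averaging a conditional law gives the law;
  and the cost has at most quadratic growth.
\<close>

section \<open>Square-integrable functions\<close>

definition square_integrable :: "'b measure \<Rightarrow> ('b \<Rightarrow> real) \<Rightarrow> bool" where
  "square_integrable N f \<longleftrightarrow> f \<in> borel_measurable N \<and> integrable N (\<lambda>x. (f x)\<^sup>2)"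

lemma square_integrable_measurable [measurable_dest]:
  "square_integrable N f \<Longrightarrow> f \<in> borel_measurable N"
  by (simp add: square_integrable_def)

lemma square_integrable_power2: "square_integrable N f \<Longrightarrow> integrable N (\<lambda>x. (f x)\<^sup>2)"
  by (simp add: square_integrable_def)

lemma square_integrable_iff_nn_integral:
  assumes "f \<in> borel_measurable N"
  shows "square_integrable N f \<longleftrightarrow> (\<integral>\<^sup>+x. ennreal ((f x)\<^sup>2) \<partial>N) < \<infinity>"
  using assms by (simp add: square_integrable_def integrable_iff_bounded)

lemma square_integrable_mult:
  assumes "square_integrable N f" "square_integrable N g"
  shows "integrable N (\<lambda>x. f x * g x)"
proof (rule Bochner_Integration.integrable_bound)
  show "integrable N (\<lambda>x. (f x)\<^sup>2 + (g x)\<^sup>2)"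
    using assms by (simp add: square_integrable_def)
  show "(\<lambda>x. f x * g x) \<in> borel_measurable N"
    using assms by (simp add: square_integrable_def borel_measurable_times)
  have "\<bar>a * b\<bar> \<le> a\<^sup>2 + b\<^sup>2" for a b :: real
    using sum_squares_bound[of a b] sum_squares_bound[of a "-b"] zero_le_power2[of a] zero_le_power2[of b]
    by (simp add: abs_le_iff)
  then show "AE x in N. norm (f x * g x) \<le> norm ((f x)\<^sup>2 + (g x)\<^sup>2)"
    by simp
qed

lemma square_integrable_bound:
  assumes "square_integrable N f" "g \<in> borel_measurable N" "AE x in N. \<bar>g x\<bar> \<le> \<bar>f x\<bar>"
  shows "square_integrable N g"
  unfolding square_integrable_def
proof
  show "integrable N (\<lambda>x. (g x)\<^sup>2)"
    by (rule Bochner_Integration.integrable_bound[OF square_integrable_power2[OF assms(1)]])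
       (use assms in \<open>auto simp: abs_le_square_iff\<close>)
qed fact

lemma square_integrable_add:
  assumes "square_integrable N f" "square_integrable N g"
  shows "square_integrable N (\<lambda>x. f x + g x)"
proof -
  have "(\<lambda>x. (f x + g x)\<^sup>2) = (\<lambda>x. (f x)\<^sup>2 + (g x)\<^sup>2 + 2 * (f x * g x))"
    by (auto simp: power2_sum)
  with square_integrable_mult[OF assms] show ?thesis
    using assms unfolding square_integrable_def by auto
qed

lemma square_integrable_cmult:
  "square_integrable N f \<Longrightarrow> square_integrable N (\<lambda>x. c * f x)"
  by (auto simp: square_integrable_def power_mult_distrib)

lemma square_integrable_minus:
  "square_integrable N f \<Longrightarrow> square_integrable N (\<lambda>x. - f x)"
  by (auto simp: square_integrable_def)

lemma square_integrable_diff: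
  assumes "square_integrable N f" "square_integrable N g"
  shows "square_integrable N (\<lambda>x. f x - g x)"
  using square_integrable_add[OF assms(1) square_integrable_minus[OF assms(2)]] by simp

lemma square_integrable_abs:
  "square_integrable N f \<Longrightarrow> square_integrable N (\<lambda>x. \<bar>f x\<bar>)"
  by (auto simp: square_integrable_def)

lemma square_integrable_bounded_mult:
  assumes "square_integrable N f" "c \<in> borel_measurable N" "\<And>x. x \<in> space N \<Longrightarrow> \<bar>c x\<bar> \<le> C"
  shows "square_integrable N (\<lambda>x. c x * f x)"
proof (rule square_integrable_bound[OF square_integrable_cmult[OF assms(1), of C]])
  show "(\<lambda>x. c x * f x) \<in> borel_measurable N"
    using assms(1,2) by (simp add: square_integrable_def borel_measurable_times)
  have "\<bar>c x\<bar> * \<bar>f x\<bar> \<le> \<bar>C\<bar> * \<bar>f x\<bar>" if "x \<in> space N" for x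
    using assms(3)[OF that] by (intro mult_right_mono) auto
  then show "AE x in N. \<bar>c x * f x\<bar> \<le> \<bar>C * f x\<bar>"
    by (auto simp: abs_mult)
qed

lemma (in finite_measure) square_integrable_const: "square_integrable M (\<lambda>_. c)"
  by (simp add: square_integrable_def)

lemma (in finite_measure) square_integrable_imp_integrable:
  "square_integrable M f \<Longrightarrow> integrable M f"
  using square_integrable_mult[OF _ square_integrable_const[of 1]] by auto

lemma square_integrable_sum:
  assumes "\<And>i. i \<in> I \<Longrightarrow> square_integrable N (f i)"
  shows "square_integrable N (\<lambda>x. \<Sum>i\<in>I. f i x)"
  using assms by (induction I rule: infinite_finite_induct)
    (auto intro!: square_integrable_add simp: square_integrable_def[of N "\<lambda>_. 0"])

lemma square_integrable_AE_cong:
  assumes "square_integrable N f" "g \<in> borel_measurable N" "AE x in N. g x = f x"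
  shows "square_integrable N g"
  by (rule square_integrable_bound[OF assms(1,2)]) (use assms(3) in auto)

lemma square_integrable_of_close:
  assumes "square_integrable N f" "g \<in> borel_measurable N"
    and "(\<integral>\<^sup>+x. ennreal ((f x - g x)\<^sup>2) \<partial>N) < \<infinity>"
  shows "square_integrable N g"
proof -
  have m[measurable]: "f \<in> borel_measurable N" "g \<in> borel_measurable N"
    using assms by (auto simp: square_integrable_def)
  have "square_integrable N (\<lambda>x. f x - g x)"
    using assms(3) by (subst square_integrable_iff_nn_integral) auto
  from square_integrable_diff[OF assms(1) this] show ?thesis by simp
qed

lemma nn_integral_square_eq:
  "square_integrable N f \<Longrightarrow> (\<integral>\<^sup>+x. ennreal ((f x)\<^sup>2) \<partial>N) = ennreal (\<integral>x. (f x)\<^sup>2 \<partial>N)"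
  by (intro nn_integral_eq_integral) (auto simp: square_integrable_def)

lemma integral_square_diff:
  assumes "square_integrable N f" "square_integrable N g"
  shows "(\<integral>x. (f x - g x)\<^sup>2 \<partial>N) = (\<integral>x. f x * f x \<partial>N) - 2 * (\<integral>x. f x * g x \<partial>N) + (\<integral>x. g x * g x \<partial>N)"
proof -
  have "(\<integral>x. (f x - g x)\<^sup>2 \<partial>N) = (\<integral>x. (f x * f x - 2 * (f x * g x)) + g x * g x \<partial>N)"
    by (intro Bochner_Integration.integral_cong) (auto simp: power2_eq_square algebra_simps)
  also have "\<dots> = (\<integral>x. f x * f x \<partial>N) - 2 * (\<integral>x. f x * g x \<partial>N) + (\<integral>x. g x * g x \<partial>N)"
    using square_integrable_mult[OF assms] square_integrable_mult[OF assms(1,1)] square_integrable_mult[OF assms(2,2)]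
    by simp
  finally show ?thesis .
qed

lemma Cauchy_Schwarz_integral:
  assumes f: "square_integrable N f" and g: "square_integrable N g"
  shows "\<bar>\<integral>x. f x * g x \<partial>N\<bar> \<le> sqrt (\<integral>x. (f x)\<^sup>2 \<partial>N) * sqrt (\<integral>x. (g x)\<^sup>2 \<partial>N)"
proof -
  have [measurable]: "f \<in> borel_measurable N" "g \<in> borel_measurable N"
    using f g by (auto simp: square_integrable_def)
  have i: "integrable N (\<lambda>x. \<bar>f x\<bar> * \<bar>g x\<bar>)"
    using square_integrable_mult[OF square_integrable_abs[OF f] square_integrable_abs[OF g]] .
  have "(\<integral>\<^sup>+x. ennreal \<bar>f x\<bar> * ennreal \<bar>g x\<bar> \<partial>N)\<^sup>2
      \<le> (\<integral>\<^sup>+x. (ennreal \<bar>f x\<bar>)\<^sup>2 \<partial>N) * (\<integral>\<^sup>+x. (ennreal \<bar>g x\<bar>)\<^sup>2 \<partial>N)"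
    by (intro Cauchy_Schwarz_nn_integral) auto
  also have "(\<integral>\<^sup>+x. ennreal \<bar>f x\<bar> * ennreal \<bar>g x\<bar> \<partial>N) = ennreal (\<integral>x. \<bar>f x\<bar> * \<bar>g x\<bar> \<partial>N)"
    using i by (subst nn_integral_eq_integral[symmetric]) (auto simp: ennreal_mult')
  also have "(\<integral>\<^sup>+x. (ennreal \<bar>f x\<bar>)\<^sup>2 \<partial>N) = ennreal (\<integral>x. (f x)\<^sup>2 \<partial>N)"
    using square_integrable_power2[OF f]
    by (subst nn_integral_eq_integral[symmetric]) (auto simp: ennreal_power)
  also have "(\<integral>\<^sup>+x. (ennreal \<bar>g x\<bar>)\<^sup>2 \<partial>N) = ennreal (\<integral>x. (g x)\<^sup>2 \<partial>N)"
    using square_integrable_power2[OF g]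
    by (subst nn_integral_eq_integral[symmetric]) (auto simp: ennreal_power)
  finally have "(\<integral>x. \<bar>f x\<bar> * \<bar>g x\<bar> \<partial>N)\<^sup>2 \<le> (\<integral>x. (f x)\<^sup>2 \<partial>N) * (\<integral>x. (g x)\<^sup>2 \<partial>N)"
    by (simp add: ennreal_power ennreal_mult'[symmetric])
  then have "(\<integral>x. \<bar>f x\<bar> * \<bar>g x\<bar> \<partial>N) \<le> sqrt (\<integral>x. (f x)\<^sup>2 \<partial>N) * sqrt (\<integral>x. (g x)\<^sup>2 \<partial>N)"
    by (simp add: real_le_rsqrt real_sqrt_mult[symmetric])
  moreover have "\<bar>\<integral>x. f x * g x \<partial>N\<bar> \<le> (\<integral>x. \<bar>f x * g x\<bar> \<partial>N)"
    by (rule integral_abs_bound)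
  ultimately show ?thesis by (simp add: abs_mult)
qed

text \<open>This is how the isometry passes from simple integrands to their limits, on \<open>M\<close> and on its product with time.\<close>

lemma tendsto_integral_mult:
  assumes f: "square_integrable N f" and g: "square_integrable N g"
    and F: "\<And>k::nat. square_integrable N (F k)" and G: "\<And>k. square_integrable N (G k)"
    and lf: "(\<lambda>k. \<integral>\<^sup>+x. ennreal ((F k x - f x)\<^sup>2) \<partial>N) \<longlonglongrightarrow> 0"
    and lg: "(\<lambda>k. \<integral>\<^sup>+x. ennreal ((G k x - g x)\<^sup>2) \<partial>N) \<longlonglongrightarrow> 0"
  shows "(\<lambda>k. \<integral>x. F k x * G k x \<partial>N) \<longlonglongrightarrow> (\<integral>x. f x * g x \<partial>N)"
proof -
  define a where "a k = sqrt (\<integral>x. (F k x - f x)\<^sup>2 \<partial>N)" for k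
  define b where "b k = sqrt (\<integral>x. (G k x - g x)\<^sup>2 \<partial>N)" for k
  define A where "A = sqrt (\<integral>x. (f x)\<^sup>2 \<partial>N)"
  define B where "B = sqrt (\<integral>x. (g x)\<^sup>2 \<partial>N)"
  have lim: "(\<lambda>k. sqrt (\<integral>x. (H k x - h x)\<^sup>2 \<partial>N)) \<longlonglongrightarrow> 0"
    if "(\<lambda>k. \<integral>\<^sup>+x. ennreal ((H k x - h x)\<^sup>2) \<partial>N) \<longlonglongrightarrow> 0"
      and "\<And>k. square_integrable N (\<lambda>x. H k x - h x)" for H h
  proof -
    have "(\<integral>\<^sup>+x. ennreal ((H k x - h x)\<^sup>2) \<partial>N) = ennreal (\<integral>x. (H k x - h x)\<^sup>2 \<partial>N)" for k
      using square_integrable_power2[OF that(2)[of k]] by (intro nn_integral_eq_integral) auto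
    with that(1) have "(\<lambda>k. ennreal (\<integral>x. (H k x - h x)\<^sup>2 \<partial>N)) \<longlonglongrightarrow> ennreal 0" by simp
    then have "(\<lambda>k. (\<integral>x. (H k x - h x)\<^sup>2 \<partial>N)) \<longlonglongrightarrow> 0"
      by (subst (asm) tendsto_ennreal_iff) auto
    from tendsto_real_sqrt[OF this] show ?thesis by simp
  qed
  note dF = square_integrable_diff[OF F f] and dG = square_integrable_diff[OF G g]
  have a: "a \<longlonglongrightarrow> 0" unfolding a_def by (rule lim[OF lf dF])
  have b: "b \<longlonglongrightarrow> 0" unfolding b_def by (rule lim[OF lg dG])
  have bound: "norm ((\<integral>x. F k x * G k x \<partial>N) - (\<integral>x. f x * g x \<partial>N)) \<le> a k * b k + A * b k + a k * B" for k
  proof -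
    have "(\<integral>x. F k x * G k x \<partial>N) - (\<integral>x. f x * g x \<partial>N)
        = (\<integral>x. F k x * G k x - f x * g x \<partial>N)"
      using square_integrable_mult[OF F G] square_integrable_mult[OF f g] by simp
    also have "\<dots> = (\<integral>x. ((F k x - f x) * (G k x - g x) + f x * (G k x - g x)) + (F k x - f x) * g x \<partial>N)"
      by (intro Bochner_Integration.integral_cong) (auto simp: algebra_simps)
    also have "\<dots> = (\<integral>x. (F k x - f x) * (G k x - g x) \<partial>N) + (\<integral>x. f x * (G k x - g x) \<partial>N)
        + (\<integral>x. (F k x - f x) * g x \<partial>N)"
      using square_integrable_mult[OF dF dG] square_integrable_mult[OF f dG] square_integrable_mult[OF dF g]
      by simp
    finally show ?thesis
      using Cauchy_Schwarz_integral[OF dF dG, of k k] Cauchy_Schwarz_integral[OF f dG, of k]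
        Cauchy_Schwarz_integral[OF dF g, of k]
      unfolding a_def b_def A_def B_def real_norm_def by linarith
  qed
  have "(\<lambda>k. a k * b k + A * b k + a k * B) \<longlonglongrightarrow> 0"
    using tendsto_add[OF tendsto_add[OF tendsto_mult[OF a b] tendsto_mult_left[OF b, of A]] tendsto_mult_right[OF a, of B]]
    by simp
  from Lim_null_comparison[OF always_eventually[OF allI[OF bound]] this] show ?thesis
    by (simp only: LIM_zero_iff)
qed

section \<open>Increments of the noise and the augmented filtration\<close>

lemma generated_events_subset:
  assumes "w \<in> borel_measurable (vimage_algebra (space M) X N)"
  shows "sigma_sets (space M) {w -` A \<inter> space M |A. A \<in> sets borel} \<subseteq> events_of M N X"
proof -
  have "{w -` A \<inter> space M |A. A \<in> sets borel} \<subseteq> sets (vimage_algebra (space M) X N)"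
    using measurable_sets[OF assms] by auto
  from sets.sigma_sets_subset[OF this] show ?thesis by (simp add: events_of_def)
qed

text \<open>Independence of the generated sigma-algebras is independence of all real random variables measurable for them.\<close>

lemma (in prob_space) indep_rv_integral:
  fixes u v :: "'a \<Rightarrow> real"
  assumes ind: "indep_rv M N X K Y"
    and u: "u \<in> borel_measurable (vimage_algebra (space M) X N)" "integrable M u"
    and v: "v \<in> borel_measurable (vimage_algebra (space M) Y K)" "integrable M v"
  shows "integrable M (\<lambda>\<omega>. u \<omega> * v \<omega>)" "(\<integral>\<omega>. u \<omega> * v \<omega> \<partial>M) = (\<integral>\<omega>. u \<omega> \<partial>M) * (\<integral>\<omega>. v \<omega> \<partial>M)"
proof -
  have "indep_var borel u borel v"
    unfolding indep_var_eq
  proof (intro conjI)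
    show "indep_set (sigma_sets (space M) {u -` A \<inter> space M |A. A \<in> sets borel})
        (sigma_sets (space M) {v -` A \<inter> space M |A. A \<in> sets borel})"
      using ind generated_events_subset[OF u(1)] generated_events_subset[OF v(1)] unfolding indep_rv_def indep_sets2_eq by blast
  qed (use u v in auto)
  with u(2) v(2) show "integrable M (\<lambda>\<omega>. u \<omega> * v \<omega>)"
      "(\<integral>\<omega>. u \<omega> * v \<omega> \<partial>M) = (\<integral>\<omega>. u \<omega> \<partial>M) * (\<integral>\<omega>. v \<omega> \<partial>M)"
    by (auto intro: indep_var_integrable indep_var_lebesgue_integral)
qed

text \<open>The sets with this property are closed under complements and disjoint unions, so the Dynkin argument applies.\<close>

lemma (in prob_space) integral_indicator_sigma_sets:
  fixes f :: "'a \<Rightarrow> real"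
  assumes fi: "integrable M f" and fE: "integral\<^sup>L M f = k"
    and stable: "Int_stable R" and RM: "R \<subseteq> sets M"
    and basic: "\<And>A. A \<in> R \<Longrightarrow> (\<integral>\<omega>. indicator A \<omega> * f \<omega> \<partial>M) = k * prob A"
    and G: "G \<in> sigma_sets (space M) R"
  shows "(\<integral>\<omega>. indicator G \<omega> * f \<omega> \<partial>M) = k * prob G"
proof -
  have "R \<subseteq> Pow (space M)" using RM sets.sets_into_space by auto
  from stable this G show ?thesis
  proof (induction rule: sigma_sets_induct_disjoint)
    case (basic A)
    then show ?case by (rule assms(5))
  next
    case empty
    then show ?case by simp
    next
    case (compl A)
    then have A: "A \<in> sets M"
      using sets.sigma_sets_subset[OF RM] by auto
    have "(\<integral>\<omega>. indicator (space M - A) \<omega> * f \<omega> \<partial>M) = (\<integral>\<omega>. f \<omega> - indicator A \<omega> * f \<omega> \<partial>M)"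
      by (intro Bochner_Integration.integral_cong) (auto simp: indicator_def)
    also have "\<dots> = k - k * prob A"
      using fi integrable_mult_indicator[OF A fi] compl by (simp add: fE)
    finally show ?case using A by (simp add: prob_compl algebra_simps)
    next
    case (union A)
    then have A: "range A \<subseteq> sets M"
      using sets.sigma_sets_subset[OF RM] by auto
    have "(LINT \<omega>:(\<Union>i. A i)|M. f \<omega>) = (\<Sum>i. LINT \<omega>:A i|M. f \<omega>)"
      using A union(1) integrable_mult_indicator[OF sets.countable_UN[OF A] fi]
      by (intro lebesgue_integral_countable_add)
         (auto simp: disjoint_family_on_def set_integrable_def)
    also have "\<dots> = (\<Sum>i. k * prob (A i))"
      using union(3) by (simp add: set_lebesgue_integral_def)
    also have "\<dots> = k * prob (\<Union>i. A i)"
      using sums_unique[OF sums_mult[OF finite_measure_UNION[OF A union(1)], of k]] by simp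
    finally show ?case by (simp add: set_lebesgue_integral_def)
  qed
qed

locale common_noise =
  fixes M :: "'a measure" and T :: real and W tW :: "real \<Rightarrow> 'a \<Rightarrow> real" and \<xi> :: "'a \<Rightarrow> real"
  assumes noise_setup: "common_noise_setup M T W tW \<xi>"

sublocale common_noise \<subseteq> prob_space M
  using noise_setup by (simp add: common_noise_setup_def)

context common_noise
begin

abbreviation F :: "real \<Rightarrow> 'a measure" where
  "F \<equiv> full_filtration M W tW \<xi>"

lemma T_pos: "0 < T"
  using noise_setup by (simp add: common_noise_setup_def)

lemma noise_measurable:
  assumes "t \<in> {0..T}"
  shows "W t \<in> borel_measurable M" "tW t \<in> borel_measurable M"
  using noise_setup assms by (auto simp: common_noise_setup_def brownian_motion_def)

lemma xi_measurable: "\<xi> \<in> borel_measurable M"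
  using noise_setup by (simp add: common_noise_setup_def)

lemma events_of_subset: "X \<in> M \<rightarrow>\<^sub>M N \<Longrightarrow> events_of M N X \<subseteq> sets M"
  unfolding events_of_def by (rule sets_image_in_sets) auto

lemma filtration_generator:
  assumes "t \<le> T"
  shows "events_of M borel \<xi> \<union> (\<Union>s\<in>{0..t}. events_of M borel (W s) \<union> events_of M borel (tW s)) \<union> null_sets M
    \<subseteq> sets M" (is "?G \<subseteq> _")
proof -
  have "events_of M borel (W s) \<union> events_of M borel (tW s) \<subseteq> sets M" if "s \<in> {0..t}" for s
    using noise_measurable[of s] that assms events_of_subset by auto
  moreover have "null_sets M \<subseteq> sets M" by auto
  ultimately show ?thesis using events_of_subset[OF xi_measurable] by blast
qed

lemma space_F [simp]: "space (F t) = space M"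
  by (simp add: full_filtration_def space_measure_of_conv)

lemma sets_F:
  assumes "t \<le> T"
  shows "sets (F t) = sigma_sets (space M)
    (events_of M borel \<xi> \<union> (\<Union>s\<in>{0..t}. events_of M borel (W s) \<union> events_of M borel (tW s)) \<union> null_sets M)"
  unfolding full_filtration_def using filtration_generator[OF assms] sets.sets_into_space
  by (intro sets_measure_of) blast

lemma sets_F_subset: "t \<le> T \<Longrightarrow> sets (F t) \<subseteq> sets M"
  unfolding sets_F by (intro sets.sigma_sets_subset filtration_generator)

lemma sets_F_mono: "s \<le> t \<Longrightarrow> t \<le> T \<Longrightarrow> sets (F s) \<subseteq> sets (F t)"
  by (simp add: sets_F) (intro sigma_sets_mono', force)

lemma subalgebra_F: "t \<le> T \<Longrightarrow> subalgebra M (F t)"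
  by (simp add: subalgebra_def sets_F_subset)

lemma measurable_F_M: "f \<in> F t \<rightarrow>\<^sub>M N \<Longrightarrow> t \<le> T \<Longrightarrow> f \<in> M \<rightarrow>\<^sub>M N"
  by (rule measurable_from_subalg[OF subalgebra_F])

lemma measurable_F_mono: "f \<in> F s \<rightarrow>\<^sub>M N \<Longrightarrow> s \<le> t \<Longrightarrow> t \<le> T \<Longrightarrow> f \<in> F t \<rightarrow>\<^sub>M N"
  by (rule measurable_from_subalg[of "F t" "F s"]) (simp_all add: subalgebra_def sets_F_mono)

lemma adapted_noise:
  assumes "t \<in> {0..T}"
  shows "W t \<in> borel_measurable (F t)" "tW t \<in> borel_measurable (F t)"
proof -
  have "V \<in> borel_measurable (F t)" if "events_of M borel V \<subseteq> sets (F t)" for V :: "'a \<Rightarrow> real"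
  proof -
    have "V \<in> borel_measurable (vimage_algebra (space M) V borel)"
      by (rule measurable_vimage_algebra1) auto
    then show ?thesis
      by (rule measurable_from_subalg[rotated]) (use that in \<open>simp add: subalgebra_def events_of_def\<close>)
  qed
  moreover have "events_of M borel (W t) \<subseteq> sets (F t)" "events_of M borel (tW t) \<subseteq> sets (F t)"
    using assms by (auto simp: sets_F intro!: sigma_sets.Basic)
  ultimately show "W t \<in> borel_measurable (F t)" "tW t \<in> borel_measurable (F t)" by auto
qed

lemma noise_filtration_sets: "t \<le> T \<Longrightarrow> sets (noise_filtration M tW t) \<subseteq> sets (F t)"
proof -
  assume t: "t \<le> T"
  have "(\<Union>s\<in>{0..t}. events_of M borel (tW s)) \<union> null_sets M \<subseteq> Pow (space M)"
    using filtration_generator[OF t] sets.sets_into_space by blast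
  then show ?thesis
    unfolding noise_filtration_def sets_F[OF t]
    by (subst sets_measure_of) (auto intro!: sigma_sets_mono')
qed

lemma space_noise_filtration [simp]: "space (noise_filtration M tW t) = space M"
  by (simp add: noise_filtration_def space_measure_of_conv)

lemma indicator_integrable: "A \<in> sets M \<Longrightarrow> integrable M (indicator A :: 'a \<Rightarrow> real)"
  by (rule integrable_real_indicator) (auto simp: less_top[symmetric])

definition path_algebra :: "real \<Rightarrow> (real \<Rightarrow> 'a \<Rightarrow> real) \<Rightarrow> 'a measure" where
  "path_algebra t V = vimage_algebra (space M) (path_upto t V) (path_space t)"

lemma space_path_algebra [simp]: "space (path_algebra t V) = space M"
  by (simp add: path_algebra_def)

lemma path_upto_in_path_algebra: "path_upto t V \<in> path_algebra t V \<rightarrow>\<^sub>M path_space t"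
  unfolding path_algebra_def
  by (rule measurable_vimage_algebra1) (auto simp: path_upto_def space_PiM)

lemma path_value_measurable:
  assumes "path_upto t V \<in> N \<rightarrow>\<^sub>M path_space t" "r \<in> {0..t}"
  shows "V r \<in> borel_measurable N"
proof -
  have "(\<lambda>\<omega>. path_upto t V \<omega> r) \<in> borel_measurable N"
    by (rule measurable_compose[OF assms(1) measurable_component_singleton[OF assms(2)]])
  then show ?thesis using assms(2) by (simp add: path_upto_def)
qed

lemma path_upto_measurable:
  assumes "\<And>r. r \<in> {0..t} \<Longrightarrow> V r \<in> borel_measurable N"
  shows "path_upto t V \<in> N \<rightarrow>\<^sub>M path_space t"
  unfolding path_upto_def using assms by (intro measurable_restrict) auto

lemma path_algebra_mono:
  assumes "s \<le> t"
  shows "sets (path_algebra s V) \<subseteq> sets (path_algebra t V)"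
  unfolding path_algebra_def[of s]
  by (rule sets_image_in_sets)
     (use assms in \<open>auto intro!: path_upto_measurable path_value_measurable[OF path_upto_in_path_algebra]\<close>)

text \<open>
  Rectangles \<open>A \<inter> B \<inter> C\<close> of an event of \<open>\<xi>\<close> and one event of each path up to \<open>s\<close>, together with the null
  sets, form an intersection-stable generator of the filtration.  On a rectangle the integral factorises
  by the independence of \<open>\<xi>\<close> from the noises, of the two noises from each other, and of each increment
  from its own past; the formula then extends to the generated sigma-algebra.  The functions \<open>\<phi>\<close> and \<open>\<psi>\<close>
  will be powers.
\<close>

lemma increments_independent:
  fixes \<phi> \<psi> :: "real \<Rightarrow> real"
  assumes st: "0 \<le> s" "s < t" "t \<le> T"
    and m[measurable]: "\<phi> \<in> borel_measurable borel" "\<psi> \<in> borel_measurable borel"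
    and i: "integrable M (\<lambda>\<omega>. \<phi> (W t \<omega> - W s \<omega>))" "integrable M (\<lambda>\<omega>. \<psi> (tW t \<omega> - tW s \<omega>))"
  defines "f \<equiv> \<lambda>\<omega>. \<phi> (W t \<omega> - W s \<omega>) * \<psi> (tW t \<omega> - tW s \<omega>)"
    and "k \<equiv> (\<integral>\<omega>. \<phi> (W t \<omega> - W s \<omega>) \<partial>M) * (\<integral>\<omega>. \<psi> (tW t \<omega> - tW s \<omega>) \<partial>M)"
  shows "integrable M f" and "G \<in> sets (F s) \<Longrightarrow> (\<integral>\<omega>. indicator G \<omega> * f \<omega> \<partial>M) = k * prob G"
proof -
  have bmW: "brownian_motion M T W" and bmtW: "brownian_motion M T tW"
    and paths: "indep_rv M (path_space T) (path_upto T W) (path_space T) (path_upto T tW)"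
    and indxi: "indep_rv M borel \<xi>
       (path_space T \<Otimes>\<^sub>M path_space T) (\<lambda>\<omega>. (path_upto T W \<omega>, path_upto T tW \<omega>))"
    using noise_setup by (auto simp: common_noise_setup_def)
  define both where "both = vimage_algebra (space M) (\<lambda>\<omega>. (path_upto T W \<omega>, path_upto T tW \<omega>))
    (path_space T \<Otimes>\<^sub>M path_space T)"
  have space_both: "space both = space M" by (simp add: both_def)
  have pb: "(\<lambda>\<omega>. (path_upto T W \<omega>, path_upto T tW \<omega>)) \<in> both \<rightarrow>\<^sub>M (path_space T \<Otimes>\<^sub>M path_space T)"
    unfolding both_def by (rule measurable_vimage_algebra1) (auto simp: path_upto_def space_PiM space_pair_measure)
  have sW: "subalgebra both (path_algebra T W)" and stW: "subalgebra both (path_algebra T tW)"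
    using sets_image_in_sets[OF _ measurable_compose[OF pb measurable_fst]]
      sets_image_in_sets[OF _ measurable_compose[OF pb measurable_snd]]
    by (simp_all add: subalgebra_def path_algebra_def space_both)
  have path_sub: "subalgebra (path_algebra T V) (path_algebra s V)" for V
    using path_algebra_mono[of s T] st by (simp add: subalgebra_def)
  have path_M: "subalgebra M (path_algebra T W)" "subalgebra M (path_algebra T tW)"
    using sets_image_in_sets[OF refl path_upto_measurable[OF noise_measurable(1)]]
      sets_image_in_sets[OF refl path_upto_measurable[OF noise_measurable(2)]]
    by (simp_all add: subalgebra_def path_algebra_def)
  have xi_M: "subalgebra M (vimage_algebra (space M) \<xi> borel)"
    using events_of_subset[OF xi_measurable] by (simp add: subalgebra_def events_of_def)
  \<comment> \<open>each noise: its increment against its own past\<close>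
  have one: "integrable M (\<lambda>\<omega>. indicator B \<omega> * \<theta> (V t \<omega> - V s \<omega>))"
      "(\<integral>\<omega>. indicator B \<omega> * \<theta> (V t \<omega> - V s \<omega>) \<partial>M) = prob B * (\<integral>\<omega>. \<theta> (V t \<omega> - V s \<omega>) \<partial>M)"
      "(\<lambda>\<omega>. indicator B \<omega> * \<theta> (V t \<omega> - V s \<omega>)) \<in> borel_measurable (path_algebra T V)"
    if V: "brownian_motion M T V" and B: "B \<in> sets (path_algebra s V)"
      and PM: "subalgebra M (path_algebra T V)"
      and \<theta>: "\<theta> \<in> borel_measurable borel" "integrable M (\<lambda>\<omega>. \<theta> (V t \<omega> - V s \<omega>))"
    for V B and \<theta> :: "real \<Rightarrow> real"
  proof -
    have BM: "B \<in> sets M" using B path_sub[of V] PM by (auto simp: subalgebra_def)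
    have ind: "indep_rv M (path_space s) (path_upto s V) borel (\<lambda>\<omega>. V t \<omega> - V s \<omega>)"
      using V st by (auto simp: brownian_motion_def)
    have u: "(indicator B :: 'a \<Rightarrow> real) \<in> borel_measurable (vimage_algebra (space M) (path_upto s V) (path_space s))"
      using B unfolding path_algebra_def[symmetric] by simp
    have v: "(\<lambda>\<omega>. \<theta> (V t \<omega> - V s \<omega>)) \<in> borel_measurable (vimage_algebra (space M) (\<lambda>\<omega>. V t \<omega> - V s \<omega>) borel)"
      by (rule measurable_compose[OF measurable_vimage_algebra1 \<theta>(1)]) auto
    show "integrable M (\<lambda>\<omega>. indicator B \<omega> * \<theta> (V t \<omega> - V s \<omega>))"
      "(\<integral>\<omega>. indicator B \<omega> * \<theta> (V t \<omega> - V s \<omega>) \<partial>M) = prob B * (\<integral>\<omega>. \<theta> (V t \<omega> - V s \<omega>) \<partial>M)"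
      using indep_rv_integral[OF ind u indicator_integrable[OF BM] v \<theta>(2)] BM by auto
    have [measurable]: "B \<in> sets (path_algebra T V)" "V t \<in> borel_measurable (path_algebra T V)"
       "V s \<in> borel_measurable (path_algebra T V)" "\<theta> \<in> borel_measurable borel"
      using B path_sub[of V] \<theta> st
      by (auto simp: subalgebra_def intro!: path_value_measurable[OF path_upto_in_path_algebra])
    show "(\<lambda>\<omega>. indicator B \<omega> * \<theta> (V t \<omega> - V s \<omega>)) \<in> borel_measurable (path_algebra T V)"
      by measurable
  qed
  define u where "u B \<omega> = indicator B \<omega> * \<phi> (W t \<omega> - W s \<omega>)" for B \<omega>
  define v where "v C \<omega> = indicator C \<omega> * \<psi> (tW t \<omega> - tW s \<omega>)" for C \<omega>
  \<comment> \<open>first the two noises, then \<open>\<xi>\<close> against both\<close>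
  have prod: "integrable M (\<lambda>\<omega>. indicator A \<omega> * (u B \<omega> * v C \<omega>))"
     "(\<integral>\<omega>. indicator A \<omega> * (u B \<omega> * v C \<omega>) \<partial>M) = prob A * (prob B * prob C) * k"
    if A: "A \<in> events_of M borel \<xi>" and B: "B \<in> sets (path_algebra s W)" and C: "C \<in> sets (path_algebra s tW)"
    for A B C
  proof -
    note uB = one[OF bmW B path_M(1) m(1) i(1), folded u_def]
    note vC = one[OF bmtW C path_M(2) m(2) i(2), folded v_def]
    note uv = indep_rv_integral[OF paths uB(3)[unfolded path_algebra_def] uB(1) vC(3)[unfolded path_algebra_def] vC(1)]
    have uvm: "(\<lambda>\<omega>. u B \<omega> * v C \<omega>) \<in> borel_measurable both"
      using measurable_from_subalg[OF sW uB(3)] measurable_from_subalg[OF stW vC(3)] by simp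
    have Am: "(indicator A :: 'a \<Rightarrow> real) \<in> borel_measurable (vimage_algebra (space M) \<xi> borel)" and "A \<in> sets M"
      using A xi_M by (auto simp: events_of_def subalgebra_def)
    show "integrable M (\<lambda>\<omega>. indicator A \<omega> * (u B \<omega> * v C \<omega>))"
     "(\<integral>\<omega>. indicator A \<omega> * (u B \<omega> * v C \<omega>) \<partial>M) = prob A * (prob B * prob C) * k"
      using indep_rv_integral[OF indxi Am indicator_integrable[OF \<open>A \<in> sets M\<close>] uvm[unfolded both_def] uv(1)]
        uB(2) vC(2) uv(2) \<open>A \<in> sets M\<close>
      by (auto simp: k_def)
  qed
  have top: "space M \<in> events_of M borel \<xi>" "space M \<in> sets (path_algebra s V)" for V
    using sets.top[of "vimage_algebra (space M) \<xi> borel"] sets.top[of "path_algebra s V"]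
    by (simp_all add: events_of_def)
  have full: "f \<omega> = indicator (space M) \<omega> * (u (space M) \<omega> * v (space M) \<omega>)" if "\<omega> \<in> space M" for \<omega>
    using that by (simp add: f_def u_def v_def)
  show fi: "integrable M f"
    using prod(1)[OF top(1) top(2) top(2)] full by (simp cong: Bochner_Integration.integrable_cong)
  have fE: "integral\<^sup>L M f = k"
    using prod(2)[OF top(1) top(2) top(2)] full by (simp add: prob_space cong: Bochner_Integration.integral_cong)
  define R where "R = {A \<inter> B \<inter> C |A B C. A \<in> events_of M borel \<xi> \<and> B \<in> sets (path_algebra s W) \<and>
    C \<in> sets (path_algebra s tW)}"
  have RM: "R \<subseteq> sets M"
  proof -
    have "events_of M borel \<xi> \<subseteq> sets M" "sets (path_algebra s W) \<subseteq> sets M" "sets (path_algebra s tW) \<subseteq> sets M"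
      using xi_M path_M path_sub[of W] path_sub[of tW] by (auto simp: events_of_def subalgebra_def)
    then show ?thesis unfolding R_def by blast
  qed
  show "(\<integral>\<omega>. indicator G \<omega> * f \<omega> \<partial>M) = k * prob G" if "G \<in> sets (F s)" for G
  proof -
    have "A \<in> R" if A: "A \<in> events_of M borel \<xi>" for A
    proof -
      have "A = A \<inter> space M \<inter> space M"
        using sets.sets_into_space[OF A[unfolded events_of_def]] by auto
      then show ?thesis using A top unfolding R_def by blast
    qed
    then have "events_of M borel \<xi> \<subseteq> R" by blast
    moreover have "events_of M borel (W r) \<union> events_of M borel (tW r) \<subseteq> R" if r: "r \<in> {0..s}" for r
    proof -
      have e: "events_of M borel (V r) \<subseteq> sets (path_algebra s V)" for V
        unfolding events_of_def
        by (rule sets_image_in_sets) (auto intro!: path_value_measurable[OF path_upto_in_path_algebra r])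
      have "A \<in> R" if "A \<in> sets (path_algebra s W)" for A
        using that top sets.sets_into_space[OF that]
        unfolding R_def by (intro CollectI exI[of _ "space M"] exI[of _ A]) auto
      moreover have "A \<in> R" if "A \<in> sets (path_algebra s tW)" for A
        using that top sets.sets_into_space[OF that]
        unfolding R_def by (intro CollectI exI[of _ "space M"] exI[of _ A]) auto
      ultimately show ?thesis using e by blast
    qed
    ultimately have "events_of M borel \<xi> \<union> (\<Union>r\<in>{0..s}. events_of M borel (W r) \<union> events_of M borel (tW r))
        \<union> null_sets M \<subseteq> R \<union> null_sets M"
      by blast
    from sigma_sets_mono'[OF this, of "space M"] have G: "G \<in> sigma_sets (space M) (R \<union> null_sets M)"
      using that st sets_F[of s] by auto
    have stable: "Int_stable (R \<union> null_sets M)"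
    proof (rule Int_stableI)
      fix a b assume ab: "a \<in> R \<union> null_sets M" "b \<in> R \<union> null_sets M"
      show "a \<inter> b \<in> R \<union> null_sets M"
      proof (cases "a \<in> R \<and> b \<in> R")
        case True
        then obtain A B C A' B' C' where
          "a = A \<inter> B \<inter> C" "A \<in> events_of M borel \<xi>" "B \<in> sets (path_algebra s W)" "C \<in> sets (path_algebra s tW)"
          "b = A' \<inter> B' \<inter> C'" "A' \<in> events_of M borel \<xi>" "B' \<in> sets (path_algebra s W)" "C' \<in> sets (path_algebra s tW)"
          unfolding R_def by auto
        then have "a \<inter> b = (A \<inter> A') \<inter> (B \<inter> B') \<inter> (C \<inter> C') \<and> A \<inter> A' \<in> events_of M borel \<xi> \<and>
            B \<inter> B' \<in> sets (path_algebra s W) \<and> C \<inter> C' \<in> sets (path_algebra s tW)"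
          by (auto simp: events_of_def)
        then show ?thesis unfolding R_def by blast
      next
        case False
        have "a \<in> sets M" "b \<in> sets M" using ab RM by auto
        with False ab show ?thesis
          by (auto intro: null_set_Int1 null_set_Int2)
      qed
    qed
    have RN: "R \<union> null_sets M \<subseteq> sets M"
      using RM by auto
    have generator: "(\<integral>\<omega>. indicator A \<omega> * f \<omega> \<partial>M) = k * prob A" if "A \<in> R \<union> null_sets M" for A
      using that
    proof
      assume "A \<in> R"
      then obtain A1 B C where A: "A = A1 \<inter> B \<inter> C"
        and m: "A1 \<in> events_of M borel \<xi>" "B \<in> sets (path_algebra s W)" "C \<in> sets (path_algebra s tW)"
        unfolding R_def by auto
      have m': "A1 \<in> sets M" "B \<in> sets (path_algebra T W)" "C \<in> sets (path_algebra T tW)"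
        using m xi_M path_sub[of W] path_sub[of tW] by (auto simp: events_of_def subalgebra_def)
      then have m'': "B \<in> sets M" "C \<in> sets M" using path_M by (auto simp: subalgebra_def)
      have "prob (B \<inter> C) = prob B * prob C"
        using paths m' unfolding indep_rv_def indep_sets2_eq events_of_def path_algebra_def by auto
      moreover have "B \<inter> C \<in> sets both" using m' sW stW by (auto simp: subalgebra_def)
      then have "prob (A1 \<inter> (B \<inter> C)) = prob A1 * prob (B \<inter> C)"
        using indxi m unfolding indep_rv_def indep_sets2_eq events_of_def both_def by blast
      ultimately have pA: "prob A = prob A1 * (prob B * prob C)" by (simp add: A Int_assoc)
      have "indicator A \<omega> * f \<omega> = indicator A1 \<omega> * (u B \<omega> * v C \<omega>)" for \<omega>
        by (auto simp: A f_def u_def v_def indicator_def)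
      with prod(2)[OF m] pA show ?thesis by simp
    next
      assume A: "A \<in> null_sets M"
      then have "AE \<omega> in M. indicator A \<omega> * f \<omega> = 0"
        by (intro AE_I'[OF A]) (auto simp: indicator_def)
      then have "(\<integral>\<omega>. indicator A \<omega> * f \<omega> \<partial>M) = 0" by (rule integral_eq_zero_AE)
      with A show ?thesis by (simp add: measure_eq_0_null_sets)
    qed
    show ?thesis
      by (rule integral_indicator_sigma_sets[OF fi fE stable RN generator G])
  qed
qed

lemma brownian_increment_moments:
  assumes V: "brownian_motion M T V" and st: "0 \<le> s" "s < t" "t \<le> T"
  shows "integrable M (\<lambda>\<omega>. V t \<omega> - V s \<omega>)" "(\<integral>\<omega>. V t \<omega> - V s \<omega> \<partial>M) = 0"
    "integrable M (\<lambda>\<omega>. (V t \<omega> - V s \<omega>)\<^sup>2)" "(\<integral>\<omega>. (V t \<omega> - V s \<omega>)\<^sup>2 \<partial>M) = t - s"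
proof -
  have D: "distributed M lborel (\<lambda>\<omega>. V t \<omega> - V s \<omega>) (normal_density 0 (sqrt (t - s)))"
    using V st by (auto simp: brownian_motion_def)
  have pos: "0 < sqrt (t - s)" using st by simp
  show "integrable M (\<lambda>\<omega>. V t \<omega> - V s \<omega>)"
    using integrable_normal_moment[of "sqrt (t - s)" 0 1] distributed_integrable[OF D, of "\<lambda>x. x"] pos
    by simp
  show "integrable M (\<lambda>\<omega>. (V t \<omega> - V s \<omega>)\<^sup>2)"
    using integrable_normal_moment[of "sqrt (t - s)" 0 2] distributed_integrable[OF D, of "\<lambda>x. x\<^sup>2"] pos
    by simp
  show e: "(\<integral>\<omega>. V t \<omega> - V s \<omega> \<partial>M) = 0"
    by (rule normal_distributed_expectation[OF pos D])
  show "(\<integral>\<omega>. (V t \<omega> - V s \<omega>)\<^sup>2 \<partial>M) = t - s"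
    using normal_distributed_variance[OF pos D] st by (simp add: e)
qed

text \<open>
  All that stochastic integration uses of a pair of driving noises: each one is a
  square-integrable martingale of the filtration and their bracket is \<open>c \<cdot> t\<close>.  It allows the
  isometry for one noise (\<open>c = 1\<close>) and the orthogonality of two independent noises (\<open>c = 0\<close>)
  to be proved together.
\<close>

definition bracket :: "(real \<Rightarrow> 'a \<Rightarrow> real) \<Rightarrow> (real \<Rightarrow> 'a \<Rightarrow> real) \<Rightarrow> real \<Rightarrow> bool" where
  "bracket V V' c \<longleftrightarrow>
     (\<forall>r\<in>{0..T}. V r \<in> borel_measurable (F r) \<and> V' r \<in> borel_measurable (F r)) \<and>
     (\<forall>s t. 0 \<le> s \<and> s \<le> t \<and> t \<le> T \<longrightarrow>
        square_integrable M (\<lambda>\<omega>. V t \<omega> - V s \<omega>) \<and> square_integrable M (\<lambda>\<omega>. V' t \<omega> - V' s \<omega>) \<and>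
        (\<forall>G\<in>sets (F s).
           (\<integral>\<omega>. indicator G \<omega> * (V t \<omega> - V s \<omega>) \<partial>M) = 0 \<and>
           (\<integral>\<omega>. indicator G \<omega> * (V' t \<omega> - V' s \<omega>) \<partial>M) = 0 \<and>
           (\<integral>\<omega>. indicator G \<omega> * ((V t \<omega> - V s \<omega>) * (V' t \<omega> - V' s \<omega>)) \<partial>M) = c * (t - s) * prob G))"

lemma bracket_noise:
  shows "bracket W W 1" "bracket tW tW 1" "bracket W tW 0" "bracket tW W 0"
proof -
  have bm: "brownian_motion M T W" "brownian_motion M T tW"
    using noise_setup by (auto simp: common_noise_setup_def)
  have sq: "square_integrable M (\<lambda>\<omega>. W t \<omega> - W s \<omega>)" "square_integrable M (\<lambda>\<omega>. tW t \<omega> - tW s \<omega>)"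
    if "0 \<le> s" "s \<le> t" "t \<le> T" for s t
    using that brownian_increment_moments(3)[OF bm(1), of s t] brownian_increment_moments(3)[OF bm(2), of s t]
      noise_measurable[of s] noise_measurable[of t]
    by (cases "s = t"; simp add: square_integrable_def)+
  have facts: "(\<integral>\<omega>. indicator G \<omega> * (W t \<omega> - W s \<omega>) \<partial>M) = 0 \<and>
      (\<integral>\<omega>. indicator G \<omega> * (tW t \<omega> - tW s \<omega>) \<partial>M) = 0 \<and>
      (\<integral>\<omega>. indicator G \<omega> * (W t \<omega> - W s \<omega>)\<^sup>2 \<partial>M) = (t - s) * prob G \<and>
      (\<integral>\<omega>. indicator G \<omega> * (tW t \<omega> - tW s \<omega>)\<^sup>2 \<partial>M) = (t - s) * prob G \<and>
      (\<integral>\<omega>. indicator G \<omega> * ((W t \<omega> - W s \<omega>) * (tW t \<omega> - tW s \<omega>)) \<partial>M) = 0"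
    if st: "0 \<le> s" "s \<le> t" "t \<le> T" and G: "G \<in> sets (F s)" for s t G
  proof -
    consider "s = t" | "s < t" using st by linarith
    then show ?thesis
    proof cases
      case 1
      then show ?thesis by simp
    next
      case 2
      note mW = brownian_increment_moments[OF bm(1) st(1) 2 st(3)]
      note mtW = brownian_increment_moments[OF bm(2) st(1) 2 st(3)]
      note ind = increments_independent(2)[OF st(1) 2 st(3) _ _ _ _ G]
      have one: "integrable M (\<lambda>_. 1::real)" "(\<integral>\<omega>. (1::real) \<partial>M) = 1" by (simp_all add: prob_space)
      have "(\<integral>\<omega>. indicator G \<omega> * ((W t \<omega> - W s \<omega>) * 1) \<partial>M) = 0"
        by (subst ind[of "\<lambda>x. x" "\<lambda>_. 1"]) (use mW(1) in \<open>simp_all only: mW(2) one, simp_all\<close>)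
      moreover have "(\<integral>\<omega>. indicator G \<omega> * (1 * (tW t \<omega> - tW s \<omega>)) \<partial>M) = 0"
        by (subst ind[of "\<lambda>_. 1" "\<lambda>x. x"]) (use mtW(1) in \<open>simp_all only: mtW(2) one, simp_all\<close>)
      moreover have "(\<integral>\<omega>. indicator G \<omega> * ((W t \<omega> - W s \<omega>)\<^sup>2 * 1) \<partial>M) = (t - s) * prob G"
        by (subst ind[of "\<lambda>x. x\<^sup>2" "\<lambda>_. 1"]) (use mW(3) in \<open>simp_all only: mW(4) one, simp_all\<close>)
      moreover have "(\<integral>\<omega>. indicator G \<omega> * (1 * (tW t \<omega> - tW s \<omega>)\<^sup>2) \<partial>M) = (t - s) * prob G"
        by (subst ind[of "\<lambda>_. 1" "\<lambda>x. x\<^sup>2"]) (use mtW(3) in \<open>simp_all only: mtW(4) one, simp_all\<close>)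
      moreover have "(\<integral>\<omega>. indicator G \<omega> * ((W t \<omega> - W s \<omega>) * (tW t \<omega> - tW s \<omega>)) \<partial>M) = 0"
        by (subst ind[of "\<lambda>x. x" "\<lambda>x. x"]) (use mW(1) mtW(1) in \<open>simp_all only: mW(2) mtW(2), simp_all\<close>)
      ultimately show ?thesis by (simp only: mult_1_right mult_1_left)
    qed
  qed
  show "bracket W W 1" "bracket tW tW 1" "bracket W tW 0" "bracket tW W 0"
    unfolding bracket_def
    using adapted_noise sq facts
    by (simp_all add: mult.commute[of "tW _ _ - _" "W _ _ - _"] power2_eq_square[symmetric])
qed

text \<open>The hypothesis on \<open>f\<close> says that its conditional expectation is the constant \<open>k\<close>.\<close>

lemma integral_mult_adapted:
  assumes s: "s \<le> T" and f: "integrable M f" and \<eta>: "\<eta> \<in> borel_measurable (F s)"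
    and i: "integrable M (\<lambda>\<omega>. \<eta> \<omega> * f \<omega>)"
    and G: "\<And>G. G \<in> sets (F s) \<Longrightarrow> (\<integral>\<omega>. indicator G \<omega> * f \<omega> \<partial>M) = k * prob G"
  shows "(\<integral>\<omega>. \<eta> \<omega> * f \<omega> \<partial>M) = k * (\<integral>\<omega>. \<eta> \<omega> \<partial>M)"
proof -
  interpret S: finite_measure_subalgebra M "F s"
    using s by unfold_locales (simp add: subalgebra_F)
  have "AE \<omega> in M. real_cond_exp M (F s) f \<omega> = k"
  proof (rule S.real_cond_exp_charact)
    fix A assume A: "A \<in> sets (F s)"
    then have "A \<in> sets M" using s sets_F_subset by auto
    then show "(\<integral>\<omega>\<in>A. f \<omega> \<partial>M) = (\<integral>\<omega>\<in>A. k \<partial>M)"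
      using G[OF A] by (simp add: set_lebesgue_integral_def)
  qed (use f in auto)
  then have "(\<integral>\<omega>. \<eta> \<omega> * real_cond_exp M (F s) f \<omega> \<partial>M) = (\<integral>\<omega>. \<eta> \<omega> * k \<partial>M)"
    using measurable_F_M[OF \<eta> s] by (intro integral_cong_AE) auto
  then show ?thesis
    using S.real_cond_exp_intg(2)[OF i \<eta>] f by (simp add: mult.commute)
qed

end

section \<open>The product of time and scenario space\<close>

abbreviation time_upto :: "real \<Rightarrow> real measure" where
  "time_upto t \<equiv> restrict_space lborel {0..t}"

lemma finite_measure_time_upto: "finite_measure (time_upto t)"
  by (rule finite_measureI) (simp add: emeasure_restrict_space emeasure_lborel_Icc_eq)

lemma integral_double_sum:
  fixes f :: "nat \<Rightarrow> nat \<Rightarrow> 'b \<Rightarrow> real"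
  assumes "\<And>i j. i < n \<Longrightarrow> j < n' \<Longrightarrow> integrable N (f i j)"
  shows "(\<integral>x. (\<Sum>i<n. \<Sum>j<n'. f i j x) \<partial>N) = (\<Sum>i<n. \<Sum>j<n'. \<integral>x. f i j x \<partial>N)"
proof -
  have "(\<integral>x. (\<Sum>i<n. \<Sum>j<n'. f i j x) \<partial>N) = (\<Sum>i<n. \<integral>x. (\<Sum>j<n'. f i j x) \<partial>N)"
    by (intro Bochner_Integration.integral_sum Bochner_Integration.integrable_sum assms) auto
  also have "\<dots> = (\<Sum>i<n. \<Sum>j<n'. \<integral>x. f i j x \<partial>N)"
    by (intro sum.cong refl Bochner_Integration.integral_sum assms) auto
  finally show ?thesis .
qed

context common_noise
begin

abbreviation prod_upto :: "real \<Rightarrow> (real \<times> 'a) measure" where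
  "prod_upto t \<equiv> time_upto t \<Otimes>\<^sub>M M"

lemma pair_sigma_finite_prod_upto: "pair_sigma_finite (time_upto t) M"
proof -
  interpret A: finite_measure "time_upto t" by (rule finite_measure_time_upto)
  show ?thesis by (rule pair_sigma_finite.intro) unfold_locales
qed

lemma finite_measure_prod_upto: "finite_measure (prod_upto t)"
proof -
  interpret A: finite_measure "time_upto t" by (rule finite_measure_time_upto)
  show ?thesis
    by (rule finite_measureI)
       (simp add: space_pair_measure emeasure_pair_measure_Times sets.top[of "time_upto t", simplified]
         emeasure_space_1 ennreal_mult_eq_top_iff A.emeasure_finite[of "{0..t}"])
qed

lemma fst_prod_upto: "fst \<in> borel_measurable (prod_upto t)"
  by (rule measurable_compose[OF measurable_fst]) (simp add: measurable_restrict_space1)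

lemma space_prod_upto: "z \<in> space (prod_upto t) \<Longrightarrow> fst z \<in> {0..t} \<and> snd z \<in> space M"
  by (auto simp: space_pair_measure)

lemma measurable_prod_upto_mono:
  assumes "f \<in> prod_upto t \<rightarrow>\<^sub>M N" "s \<le> t"
  shows "f \<in> prod_upto s \<rightarrow>\<^sub>M N"
proof -
  have "(\<lambda>x. x) \<in> time_upto s \<rightarrow>\<^sub>M time_upto t"
    using assms(2) by (intro measurable_restrict_space3) auto
  then have "(\<lambda>z. (fst z, snd z)) \<in> prod_upto s \<rightarrow>\<^sub>M prod_upto t"
    by (intro measurable_Pair measurable_compose[OF measurable_fst]) auto
  from measurable_compose[OF this assms(1)] show ?thesis by simp
qed

lemma nn_integral_prod_upto:
  assumes "(\<lambda>z. f (fst z) (snd z)) \<in> borel_measurable (prod_upto t)"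
  shows "(\<integral>\<^sup>+z. f (fst z) (snd z) \<partial>prod_upto t) = (\<integral>\<^sup>+\<omega>. (\<integral>\<^sup>+s\<in>{0..t}. f s \<omega> \<partial>lborel) \<partial>M)"
proof -
  interpret P: pair_sigma_finite "time_upto t" M by (rule pair_sigma_finite_prod_upto)
  show ?thesis
    using P.nn_integral_snd[OF assms] by (simp add: nn_integral_restrict_space)
qed

lemma nn_integral_prod_upto_mono:
  assumes "(\<lambda>z. f (fst z) (snd z)) \<in> borel_measurable (prod_upto t)" "s \<le> t"
  shows "(\<integral>\<^sup>+z. f (fst z) (snd z) \<partial>prod_upto s) \<le> (\<integral>\<^sup>+z. f (fst z) (snd z) \<partial>prod_upto t)"
  unfolding nn_integral_prod_upto[OF assms(1)] nn_integral_prod_upto[OF measurable_prod_upto_mono[OF assms]]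
  using assms(2) by (intro nn_integral_mono mult_mono) (auto simp: indicator_def)

abbreviation process_L2 :: "real \<Rightarrow> (real \<Rightarrow> 'a \<Rightarrow> real) \<Rightarrow> bool" where
  "process_L2 t \<gamma> \<equiv> square_integrable (prod_upto t) (\<lambda>z. \<gamma> (fst z) (snd z))"

lemma process_L2_mono:
  assumes "process_L2 t \<gamma>" "s \<le> t"
  shows "process_L2 s \<gamma>"
proof -
  have m: "(\<lambda>z. \<gamma> (fst z) (snd z)) \<in> borel_measurable (prod_upto t)"
    using assms(1) by (simp add: square_integrable_def)
  then have "(\<lambda>z. ennreal ((\<gamma> (fst z) (snd z))\<^sup>2)) \<in> borel_measurable (prod_upto t)" by measurable
  from nn_integral_prod_upto_mono[of "\<lambda>s \<omega>. ennreal ((\<gamma> s \<omega>)\<^sup>2)", OF this assms(2)]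
  show ?thesis
    using assms(1) by (auto simp: square_integrable_iff_nn_integral[OF m]
      square_integrable_iff_nn_integral[OF measurable_prod_upto_mono[OF m assms(2)]])
qed

lemma progressive_measurable_prod:
  assumes "progressive T F N \<alpha>" "t \<in> {0..T}"
  shows "(\<lambda>z. \<alpha> (fst z) (snd z)) \<in> prod_upto t \<rightarrow>\<^sub>M N"
proof -
  have "(\<lambda>x. x) \<in> time_upto t \<rightarrow>\<^sub>M restrict_space borel {0..t}"
    by (intro measurable_restrict_space3) auto
  moreover have "(\<lambda>x. x) \<in> M \<rightarrow>\<^sub>M F t"
    using assms(2) by (intro measurable_F_M) auto
  ultimately have "(\<lambda>z. (fst z, snd z)) \<in> prod_upto t \<rightarrow>\<^sub>M restrict_space borel {0..t} \<Otimes>\<^sub>M F t"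
    by (intro measurable_Pair measurable_compose[OF measurable_fst] measurable_compose[OF measurable_snd])
  moreover have "(\<lambda>(s, \<omega>). \<alpha> s \<omega>) \<in> restrict_space borel {0..t} \<Otimes>\<^sub>M F t \<rightarrow>\<^sub>M N"
    using assms by (simp add: progressive_def)
  ultimately have "(\<lambda>z. case (fst z, snd z) of (s, \<omega>) \<Rightarrow> \<alpha> s \<omega>) \<in> prod_upto t \<rightarrow>\<^sub>M N"
    by (rule measurable_compose)
  then show ?thesis by simp
qed

lemma progressive_adapted:
  assumes "progressive T F N \<alpha>" "t \<in> {0..T}"
  shows "\<alpha> t \<in> F t \<rightarrow>\<^sub>M N"
proof -
  have "(\<lambda>\<omega>. (t, \<omega>)) \<in> F t \<rightarrow>\<^sub>M restrict_space borel {0..t} \<Otimes>\<^sub>M F t"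
    using assms(2) by (intro measurable_Pair) (auto simp: space_restrict_space)
  from measurable_compose[OF this, of "\<lambda>(s, \<omega>). \<alpha> s \<omega>" N] assms show ?thesis
    by (simp add: progressive_def)
qed

lemma L2_prog_iff:
  "\<gamma> \<in> L2_prog M T F \<longleftrightarrow> progressive T F borel \<gamma> \<and> process_L2 T \<gamma>"
proof -
  have T: "T \<in> {0..T}" using T_pos by simp
  have "process_L2 T \<gamma> \<longleftrightarrow> (\<integral>\<^sup>+\<omega>. (\<integral>\<^sup>+t\<in>{0..T}. ennreal ((\<gamma> t \<omega>)\<^sup>2) \<partial>lborel) \<partial>M) < \<infinity>"
    if "progressive T F borel \<gamma>"
  proof -
    note m = progressive_measurable_prod[OF that T]
    then have "(\<lambda>z. ennreal ((\<gamma> (fst z) (snd z))\<^sup>2)) \<in> borel_measurable (prod_upto T)" by measurable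
    from nn_integral_prod_upto[of "\<lambda>s \<omega>. ennreal ((\<gamma> s \<omega>)\<^sup>2)", OF this]
    show ?thesis by (simp add: square_integrable_iff_nn_integral[OF m])
  qed
  then show ?thesis by (auto simp: L2_prog_def)
qed

section \<open>The Ito isometry and the martingale property\<close>

lemma bracket_sym: "bracket V V' c \<Longrightarrow> bracket V' V c"
  unfolding bracket_def by (simp add: mult.commute[of "_ - _ :: real" "_ - _ :: real"])

lemma bracket_square_integrable:
  assumes "bracket V V' c" "0 \<le> s" "0 \<le> t" "s \<le> T" "t \<le> T"
  shows "square_integrable M (\<lambda>\<omega>. V t \<omega> - V s \<omega>)"
proof -
  have sq: "square_integrable M (\<lambda>\<omega>. V t \<omega> - V s \<omega>)" if "0 \<le> s" "s \<le> t" "t \<le> T" for s t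
    using assms(1) that by (simp add: bracket_def)
  show ?thesis
  proof (cases "s \<le> t")
    case True
    then show ?thesis using sq assms by simp
  next
    case False
    then show ?thesis using square_integrable_minus[OF sq[of t s]] assms by simp
  qed
qed

lemma bracket_martingale:
  assumes "bracket V V' c" "0 \<le> s" "s \<le> t" "t \<le> T" "\<eta> \<in> borel_measurable (F s)" "square_integrable M \<eta>"
  shows "(\<integral>\<omega>. \<eta> \<omega> * (V t \<omega> - V s \<omega>) \<partial>M) = 0"
proof -
  have sq: "square_integrable M (\<lambda>\<omega>. V t \<omega> - V s \<omega>)"
    using assms by (intro bracket_square_integrable) auto
  have "(\<integral>\<omega>. \<eta> \<omega> * (V t \<omega> - V s \<omega>) \<partial>M) = 0 * (\<integral>\<omega>. \<eta> \<omega> \<partial>M)"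
    using assms square_integrable_mult[OF assms(6) sq] square_integrable_imp_integrable[OF sq]
    by (intro integral_mult_adapted[of s]) (auto simp: bracket_def)
  then show ?thesis by simp
qed

definition bounded_adapted :: "real \<Rightarrow> ('a \<Rightarrow> real) \<Rightarrow> bool" where
  "bounded_adapted s h \<longleftrightarrow> h \<in> borel_measurable (F s) \<and> (\<exists>C. \<forall>\<omega>\<in>space M. \<bar>h \<omega>\<bar> \<le> C)"

lemma bounded_adapted_mono: "bounded_adapted s h \<Longrightarrow> s \<le> t \<Longrightarrow> t \<le> T \<Longrightarrow> bounded_adapted t h"
  by (auto simp: bounded_adapted_def intro: measurable_F_mono)

lemma bounded_adapted_mult:
  assumes "bounded_adapted s h" "bounded_adapted s k"
  shows "bounded_adapted s (\<lambda>\<omega>. h \<omega> * k \<omega>)"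
proof -
  obtain C D where "\<forall>\<omega>\<in>space M. \<bar>h \<omega>\<bar> \<le> C" "\<forall>\<omega>\<in>space M. \<bar>k \<omega>\<bar> \<le> D"
    using assms by (auto simp: bounded_adapted_def)
  then have "\<forall>\<omega>\<in>space M. \<bar>h \<omega> * k \<omega>\<bar> \<le> C * D"
    by (auto simp: abs_mult intro!: mult_mono elim: order_trans[OF abs_ge_zero])
  then show ?thesis using assms by (auto simp: bounded_adapted_def)
qed

lemma bounded_adapted_square_integrable_mult:
  assumes "bounded_adapted s h" "s \<le> T" "square_integrable M f"
  shows "square_integrable M (\<lambda>\<omega>. h \<omega> * f \<omega>)"
  using assms by (auto simp: bounded_adapted_def intro: square_integrable_bounded_mult measurable_F_M)

lemma bracket_square:
  assumes B: "bracket V V' c" and st: "0 \<le> s" "s \<le> t" "t \<le> T" and h: "bounded_adapted s h"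
  shows "(\<integral>\<omega>. h \<omega> * ((V t \<omega> - V s \<omega>) * (V' t \<omega> - V' s \<omega>)) \<partial>M) = c * (t - s) * (\<integral>\<omega>. h \<omega> \<partial>M)"
proof -
  have sq: "square_integrable M (\<lambda>\<omega>. V t \<omega> - V s \<omega>)" "square_integrable M (\<lambda>\<omega>. V' t \<omega> - V' s \<omega>)"
    using bracket_square_integrable[OF B] bracket_square_integrable[OF bracket_sym[OF B]] st by auto
  have i: "integrable M (\<lambda>\<omega>. h \<omega> * ((V t \<omega> - V s \<omega>) * (V' t \<omega> - V' s \<omega>)))"
    using square_integrable_mult[OF bounded_adapted_square_integrable_mult[OF h _ sq(1)] sq(2)] st
    by (simp add: mult.assoc)
  show ?thesis
    using B st h i square_integrable_mult[OF sq]
    by (intro integral_mult_adapted[of s]) (auto simp: bracket_def bounded_adapted_def)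
qed

text \<open>
  Two cells are compared without refining the partitions they come from: each increment is cut at the
  end points of the other.  Pieces over disjoint intervals are orthogonal, because the later one is a
  martingale increment and the earlier one is known when it starts; the common interval gives the
  bracket.
\<close>

lemma bracket_cell_aux:
  assumes B: "bracket V V' c" and ab: "0 \<le> a" "a \<le> b" "b \<le> T" "0 \<le> a'" "a' \<le> b'" "b' \<le> T" and le: "a \<le> a'"
    and h: "bounded_adapted a h" and k: "bounded_adapted a' k"
  shows "(\<integral>\<omega>. (h \<omega> * (V b \<omega> - V a \<omega>)) * (k \<omega> * (V' b' \<omega> - V' a' \<omega>)) \<partial>M)
    = c * max 0 (min b b' - max a a') * (\<integral>\<omega>. h \<omega> * k \<omega> \<partial>M)"
proof -
  note sqV = bracket_square_integrable[OF B]
  note sqV' = bracket_square_integrable[OF bracket_sym[OF B]]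
  have hk: "bounded_adapted a' (\<lambda>\<omega>. h \<omega> * k \<omega>)"
    using bounded_adapted_mult[OF bounded_adapted_mono[OF h le] k] ab by simp
  \<comment> \<open>an increment is orthogonal to what is known at its left end point\<close>
  have past: "(\<integral>\<omega>. (h \<omega> * k \<omega>) * ((U r \<omega> - U r0 \<omega>) * (U' t \<omega> - U' s \<omega>)) \<partial>M) = 0"
    if U: "bracket U U' c" and le: "0 \<le> r0" "r0 \<le> s" "0 \<le> r" "r \<le> s" "a' \<le> s" "s \<le> t" "t \<le> T" for U U' r r0 s t
  proof -
    have ad: "U r \<in> borel_measurable (F r)" "U r0 \<in> borel_measurable (F r0)"
      using U le by (auto simp: bracket_def)
    have [measurable]: "U r \<in> borel_measurable (F s)" "U r0 \<in> borel_measurable (F s)"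
        "(\<lambda>\<omega>. h \<omega> * k \<omega>) \<in> borel_measurable (F s)"
      using le ad hk by (auto intro: measurable_F_mono simp: bounded_adapted_def)
    have "(\<integral>\<omega>. ((h \<omega> * k \<omega>) * (U r \<omega> - U r0 \<omega>)) * (U' t \<omega> - U' s \<omega>) \<partial>M) = 0"
    proof (rule bracket_martingale[OF bracket_sym[OF U]])
      show "(\<lambda>\<omega>. h \<omega> * k \<omega> * (U r \<omega> - U r0 \<omega>)) \<in> borel_measurable (F s)" by measurable
      show "square_integrable M (\<lambda>\<omega>. h \<omega> * k \<omega> * (U r \<omega> - U r0 \<omega>))"
        using ab le by (intro bounded_adapted_square_integrable_mult[OF hk] bracket_square_integrable[OF U]) auto
    qed (use le ab in auto)
    then show ?thesis by (simp add: mult.assoc)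
  qed
  have past': "(\<integral>\<omega>. (h \<omega> * k \<omega>) * ((V t \<omega> - V s \<omega>) * (V' r \<omega> - V' r0 \<omega>)) \<partial>M) = 0"
    if "0 \<le> r0" "r0 \<le> s" "0 \<le> r" "r \<le> s" "a' \<le> s" "s \<le> t" "t \<le> T" for r r0 s t
    using past[OF bracket_sym[OF B] that] by (simp add: mult.commute[of "V' r _ - _"])
  have i: "integrable M (\<lambda>\<omega>. (h \<omega> * k \<omega>) * ((V t \<omega> - V s \<omega>) * (V' t' \<omega> - V' s' \<omega>)))"
    if "0 \<le> s" "0 \<le> t" "0 \<le> s'" "0 \<le> t'" "s \<le> T" "t \<le> T" "s' \<le> T" "t' \<le> T" for s t s' t'
    using square_integrable_mult[OF bounded_adapted_square_integrable_mult[OF hk _ sqV] sqV'] that ab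
    by (simp add: mult.assoc)
  define E where "E t s t' s' = (\<integral>\<omega>. (h \<omega> * k \<omega>) * ((V t \<omega> - V s \<omega>) * (V' t' \<omega> - V' s' \<omega>)) \<partial>M)" for t s t' s'
  have split1: "E t s t' s' = E r s t' s' + E t r t' s'"
    if "0 \<le> s" "0 \<le> t" "0 \<le> s'" "0 \<le> t'" "s \<le> T" "t \<le> T" "s' \<le> T" "t' \<le> T" "0 \<le> r" "r \<le> T" for t s t' s' r
  proof -
    have "E t s t' s' = (\<integral>\<omega>. (h \<omega> * k \<omega>) * ((V r \<omega> - V s \<omega>) * (V' t' \<omega> - V' s' \<omega>)) + (h \<omega> * k \<omega>) * ((V t \<omega> - V r \<omega>) * (V' t' \<omega> - V' s' \<omega>)) \<partial>M)"
      unfolding E_def by (intro Bochner_Integration.integral_cong) (auto simp: algebra_simps)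
    also have "\<dots> = E r s t' s' + E t r t' s'"
      unfolding E_def using that by (intro Bochner_Integration.integral_add i) auto
    finally show ?thesis .
  qed
  have split2: "E t s t' s' = E t s r s' + E t s t' r"
    if "0 \<le> s" "0 \<le> t" "0 \<le> s'" "0 \<le> t'" "s \<le> T" "t \<le> T" "s' \<le> T" "t' \<le> T" "0 \<le> r" "r \<le> T" for t s t' s' r
  proof -
    have "E t s t' s' = (\<integral>\<omega>. (h \<omega> * k \<omega>) * ((V t \<omega> - V s \<omega>) * (V' r \<omega> - V' s' \<omega>)) + (h \<omega> * k \<omega>) * ((V t \<omega> - V s \<omega>) * (V' t' \<omega> - V' r \<omega>)) \<partial>M)"
      unfolding E_def by (intro Bochner_Integration.integral_cong) (auto simp: algebra_simps)
    also have "\<dots> = E t s r s' + E t s t' r"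
      unfolding E_def using that by (intro Bochner_Integration.integral_add i) auto
    finally show ?thesis .
  qed
  have sq: "E t a' t a' = c * (t - a') * (\<integral>\<omega>. h \<omega> * k \<omega> \<partial>M)" if "a' \<le> t" "t \<le> T" for t
    unfolding E_def using bracket_square[OF B _ _ _ hk] that ab by auto
  have "E b a b' a' = c * max 0 (min b b' - max a a') * (\<integral>\<omega>. h \<omega> * k \<omega> \<partial>M)"
  proof (cases "b \<le> a'")
    case True
    then show ?thesis using past[OF B, of a a' b b'] ab le by (simp add: E_def max_def min_def)
  next
    case False
    have "E b a b' a' = E a' a b' a' + E b a' b' a'"
      using ab le by (intro split1) auto
    also have "E a' a b' a' = 0"
      using past[OF B, of a a' a' b'] ab le by (simp add: E_def)
    also have "E b a' b' a' = E (min b b') a' (min b b') a'"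
    proof (cases "b \<le> b'")
      case True
      then show ?thesis
        using split2[of a' b a' b' b] past[OF B, of a' b b b'] ab le False by (simp add: E_def)
    next
      case F: False
      then show ?thesis
        using split1[of a' b a' b' b'] past'[of a' b' b' b] ab le False by (simp add: E_def)
    qed
    also have "\<dots> = c * (min b b' - a') * (\<integral>\<omega>. h \<omega> * k \<omega> \<partial>M)"
      using False ab by (intro sq) auto
    finally show ?thesis using False le ab by (simp add: max_def)
  qed
  moreover have "(\<integral>\<omega>. (h \<omega> * (V b \<omega> - V a \<omega>)) * (k \<omega> * (V' b' \<omega> - V' a' \<omega>)) \<partial>M) = E b a b' a'"
    unfolding E_def by (intro Bochner_Integration.integral_cong) (auto simp: algebra_simps)
  ultimately show ?thesis by simp
qed

lemma bracket_cell:
  assumes B: "bracket V V' c" and ab: "0 \<le> a" "a \<le> b" "b \<le> T" "0 \<le> a'" "a' \<le> b'" "b' \<le> T"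
    and h: "bounded_adapted a h" and k: "bounded_adapted a' k"
  shows "(\<integral>\<omega>. (h \<omega> * (V b \<omega> - V a \<omega>)) * (k \<omega> * (V' b' \<omega> - V' a' \<omega>)) \<partial>M)
    = c * max 0 (min b b' - max a a') * (\<integral>\<omega>. h \<omega> * k \<omega> \<partial>M)"
proof (cases "a \<le> a'")
  case True
  then show ?thesis using bracket_cell_aux[OF B ab _ h k] by simp
next
  case False
  then show ?thesis
    using bracket_cell_aux[OF bracket_sym[OF B] ab(4-6) ab(1-3) _ k h]
    by (simp add: mult.commute[of "h _ * _"] mult.commute[of "h _" "k _"] min.commute max.commute)
qed

lemma bounded_adapted_process_cell:
  assumes c: "bounded_adapted a c" and a: "a \<le> T"
  shows "process_L2 t (\<lambda>s \<omega>. c \<omega> * indicator {a<..b} s)"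
proof -
  interpret P: finite_measure "prod_upto t" by (rule finite_measure_prod_upto)
  obtain C where C: "\<And>\<omega>. \<omega> \<in> space M \<Longrightarrow> \<bar>c \<omega>\<bar> \<le> C" and [measurable]: "c \<in> borel_measurable M"
    using c a by (auto simp: bounded_adapted_def intro: measurable_F_M)
  note [measurable] = fst_prod_upto
  have "\<bar>c (snd z) * indicator {a<..b} (fst z)\<bar> \<le> C" if "z \<in> space (prod_upto t)" for z
  proof -
    have "\<bar>c (snd z)\<bar> \<le> C" using C space_prod_upto[OF that] by auto
    moreover have "0 \<le> C" using calculation abs_ge_zero order_trans by blast
    ultimately show ?thesis by (simp add: abs_mult indicator_def)
  qed
  moreover have "(\<lambda>z. c (snd z) * indicator {a<..b} (fst z)) \<in> borel_measurable (prod_upto t)"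
    by measurable
  ultimately have "square_integrable (prod_upto t) (\<lambda>z. (c (snd z) * indicator {a<..b} (fst z)) * 1)"
    by (intro square_integrable_bounded_mult[OF P.square_integrable_const])
  then show ?thesis by simp
qed

lemma integral_prod_cell:
  assumes t: "t \<le> T" and ab: "0 \<le> a" "b \<le> t" "0 \<le> a'" "b' \<le> t" "a \<le> T" "a' \<le> T"
    and c: "bounded_adapted a c" and d: "bounded_adapted a' d"
  shows "(\<integral>z. (c (snd z) * indicator {a<..b} (fst z)) * (d (snd z) * indicator {a'<..b'} (fst z)) \<partial>prod_upto t)
    = max 0 (min b b' - max a a') * (\<integral>\<omega>. c \<omega> * d \<omega> \<partial>M)"
proof -
  interpret P: pair_sigma_finite "time_upto t" M by (rule pair_sigma_finite_prod_upto)
  have "integrable (prod_upto t) (\<lambda>z. (c (snd z) * indicator {a<..b} (fst z)) * (d (snd z) * indicator {a'<..b'} (fst z)))"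
    by (rule square_integrable_mult[OF bounded_adapted_process_cell[OF c ab(5)] bounded_adapted_process_cell[OF d ab(6)]])
  then have "integrable (prod_upto t)
      (case_prod (\<lambda>s \<omega>. (c \<omega> * indicator {a<..b} s) * (d \<omega> * indicator {a'<..b'} s)))"
    by (simp add: split_beta')
  from P.integral_snd[OF this]
  have "(\<integral>z. (c (snd z) * indicator {a<..b} (fst z)) * (d (snd z) * indicator {a'<..b'} (fst z)) \<partial>prod_upto t)
    = (\<integral>\<omega>. \<integral>s. (c \<omega> * indicator {a<..b} s) * (d \<omega> * indicator {a'<..b'} s) \<partial>time_upto t \<partial>M)"
    by (simp add: split_beta')
  also have "\<dots> = (\<integral>\<omega>. max 0 (min b b' - max a a') * (c \<omega> * d \<omega>) \<partial>M)"
  proof (intro Bochner_Integration.integral_cong refl)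
    fix \<omega>
    have "(\<integral>s. (c \<omega> * indicator {a<..b} s) * (d \<omega> * indicator {a'<..b'} s) \<partial>time_upto t)
      = (\<integral>s. indicator {0..t} s *\<^sub>R ((c \<omega> * indicator {a<..b} s) * (d \<omega> * indicator {a'<..b'} s)) \<partial>lborel)"
      by (rule integral_restrict_space) simp
    also have "\<dots> = (\<integral>s. indicator {max a a'<..min b b'} s * (c \<omega> * d \<omega>) \<partial>lborel)"
      by (intro Bochner_Integration.integral_cong refl) (use ab in \<open>auto simp: indicator_def\<close>)
    also have "\<dots> = max 0 (min b b' - max a a') * (c \<omega> * d \<omega>)"
      by (cases "max a a' \<le> min b b'") auto
    finally show "(\<integral>s. (c \<omega> * indicator {a<..b} s) * (d \<omega> * indicator {a'<..b'} s) \<partial>time_upto t)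
      = max 0 (min b b' - max a a') * (c \<omega> * d \<omega>)" .
  qed
  finally show ?thesis by simp
qed

text \<open>
  Cutting every cell off at \<open>t\<close> does not change the values up to \<open>t\<close>.  The coefficients of cells that start
  after \<open>t\<close> are set to 0, since they are not known at the new left end point.
\<close>

lemma simple_integrand_cells:
  assumes S: "simple_integrand T F n \<tau> h" and t: "t \<in> {0..T}"
  obtains a b :: "nat \<Rightarrow> real" and c :: "nat \<Rightarrow> 'a \<Rightarrow> real" where
    "\<And>i. i < n \<Longrightarrow> 0 \<le> a i \<and> a i \<le> b i \<and> b i \<le> t \<and> bounded_adapted (a i) (c i)"
    "\<And>V \<omega>. simple_ito V n \<tau> h t \<omega> = (\<Sum>i<n. c i \<omega> * (V (b i) \<omega> - V (a i) \<omega>))"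
    "\<And>s \<omega>. s \<le> t \<Longrightarrow> simple_process n \<tau> h s \<omega> = (\<Sum>i<n. c i \<omega> * indicator {a i<..b i} s)"
proof
  define a where "a i = min (\<tau> i) t" for i
  define b where "b i = min (\<tau> (Suc i)) t" for i
  define c where "c i = (if \<tau> i \<le> t then h i else (\<lambda>_. 0))" for i
  have \<tau>: "\<tau> i \<in> {0..T}" "\<tau> i \<le> \<tau> (Suc i)" "h i \<in> borel_measurable (F (\<tau> i))"
      "\<exists>C. \<forall>\<omega>\<in>space M. \<bar>h i \<omega>\<bar> \<le> C" if "i < n" for i
    using S that by (auto simp: simple_integrand_def)
  show "0 \<le> a i \<and> a i \<le> b i \<and> b i \<le> t \<and> bounded_adapted (a i) (c i)" if "i < n" for i
    using \<tau>[OF that] t by (auto simp: a_def b_def c_def bounded_adapted_def)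
  show "simple_ito V n \<tau> h t \<omega> = (\<Sum>i<n. c i \<omega> * (V (b i) \<omega> - V (a i) \<omega>))" for V \<omega>
    unfolding simple_ito_def
  proof (rule sum.cong)
    fix i assume "i \<in> {..<n}"
    then show "h i \<omega> * (V (min (\<tau> (Suc i)) t) \<omega> - V (min (\<tau> i) t) \<omega>) = c i \<omega> * (V (b i) \<omega> - V (a i) \<omega>)"
      using \<tau>(2)[of i] by (auto simp: a_def b_def c_def min_def)
  qed simp
  show "simple_process n \<tau> h s \<omega> = (\<Sum>i<n. c i \<omega> * indicator {a i<..b i} s)" if "s \<le> t" for s \<omega>
    unfolding simple_process_def
  proof (rule sum.cong)
    fix i assume "i \<in> {..<n}"
    then show "h i \<omega> * indicator {\<tau> i<..\<tau> (Suc i)} s = c i \<omega> * indicator {a i<..b i} s"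
      using \<tau>(2)[of i] that by (auto simp: a_def b_def c_def min_def indicator_def)
  qed simp
qed

lemma simple_ito_square_integrable:
  assumes B: "bracket V V' e" and S: "simple_integrand T F n \<tau> h" and t: "t \<in> {0..T}"
  shows "square_integrable M (simple_ito V n \<tau> h t)"
proof -
  obtain a b c where *: "\<And>i. i < n \<Longrightarrow> 0 \<le> a i \<and> a i \<le> b i \<and> b i \<le> t \<and> bounded_adapted (a i) (c i)"
    and eq: "\<And>V \<omega>. simple_ito V n \<tau> h t \<omega> = (\<Sum>i<n. c i \<omega> * (V (b i) \<omega> - V (a i) \<omega>))"
    by (rule simple_integrand_cells[OF S t]) blast
  have "square_integrable M (\<lambda>\<omega>. \<Sum>i<n. c i \<omega> * (V (b i) \<omega> - V (a i) \<omega>))"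
    using * t by (intro square_integrable_sum bounded_adapted_square_integrable_mult bracket_square_integrable[OF B])
      fastforce+
  then show ?thesis unfolding eq[abs_def] .
qed

lemma simple_process_L2:
  assumes S: "simple_integrand T F n \<tau> h" and t: "t \<in> {0..T}"
  shows "process_L2 t (simple_process n \<tau> h)"
  unfolding simple_process_def
  using S by (intro square_integrable_sum bounded_adapted_process_cell)
    (auto simp: simple_integrand_def bounded_adapted_def)

lemma simple_ito_isometry:
  assumes B: "bracket V V' e" and S: "simple_integrand T F n \<tau> h" and S': "simple_integrand T F n' \<tau>' h'"
    and t: "t \<in> {0..T}"
  shows "(\<integral>\<omega>. simple_ito V n \<tau> h t \<omega> * simple_ito V' n' \<tau>' h' t \<omega> \<partial>M)
    = e * (\<integral>z. simple_process n \<tau> h (fst z) (snd z) * simple_process n' \<tau>' h' (fst z) (snd z) \<partial>prod_upto t)"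
proof -
  obtain a b c where cells: "\<And>i. i < n \<Longrightarrow> 0 \<le> a i \<and> a i \<le> b i \<and> b i \<le> t \<and> bounded_adapted (a i) (c i)"
    and I: "\<And>V \<omega>. simple_ito V n \<tau> h t \<omega> = (\<Sum>i<n. c i \<omega> * (V (b i) \<omega> - V (a i) \<omega>))"
    and P: "\<And>s \<omega>. s \<le> t \<Longrightarrow> simple_process n \<tau> h s \<omega> = (\<Sum>i<n. c i \<omega> * indicator {a i<..b i} s)"
    by (rule simple_integrand_cells[OF S t]) blast
  obtain a' b' c' where cells': "\<And>i. i < n' \<Longrightarrow> 0 \<le> a' i \<and> a' i \<le> b' i \<and> b' i \<le> t \<and> bounded_adapted (a' i) (c' i)"
    and I': "\<And>V \<omega>. simple_ito V n' \<tau>' h' t \<omega> = (\<Sum>i<n'. c' i \<omega> * (V (b' i) \<omega> - V (a' i) \<omega>))"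
    and P': "\<And>s \<omega>. s \<le> t \<Longrightarrow> simple_process n' \<tau>' h' s \<omega> = (\<Sum>i<n'. c' i \<omega> * indicator {a' i<..b' i} s)"
    by (rule simple_integrand_cells[OF S' t]) blast
  have tT: "t \<le> T" using t by simp
  define X where "X i \<omega> = c i \<omega> * (V (b i) \<omega> - V (a i) \<omega>)" for i \<omega>
  define Y where "Y j \<omega> = c' j \<omega> * (V' (b' j) \<omega> - V' (a' j) \<omega>)" for j \<omega>
  define x where "x i z = c i (snd z) * indicator {a i<..b i} (fst z)" for i and z :: "real \<times> 'a"
  define y where "y j z = c' j (snd z) * indicator {a' j<..b' j} (fst z)" for j and z :: "real \<times> 'a"
  have sX: "square_integrable M (X i)" "square_integrable (prod_upto t) (x i)" if "i < n" for i
    unfolding X_def x_def using cells[OF that] tT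
    by (auto intro!: bounded_adapted_square_integrable_mult[where s = "a i"] bracket_square_integrable[OF B] bounded_adapted_process_cell)
  have sY: "square_integrable M (Y j)" "square_integrable (prod_upto t) (y j)" if "j < n'" for j
    unfolding Y_def y_def using cells'[OF that] tT
    by (auto intro!: bounded_adapted_square_integrable_mult[where s = "a' j"] bracket_square_integrable[OF bracket_sym[OF B]]
      bounded_adapted_process_cell)
  have cell: "(\<integral>\<omega>. X i \<omega> * Y j \<omega> \<partial>M) = e * (\<integral>z. x i z * y j z \<partial>prod_upto t)" if "i < n" "j < n'" for i j
    unfolding X_def Y_def x_def y_def
    using cells[OF that(1)] cells'[OF that(2)] tT
      bracket_cell[OF B, of "a i" "b i" "a' j" "b' j" "c i" "c' j"]
      integral_prod_cell[OF tT, of "a i" "b i" "a' j" "b' j" "c i" "c' j"]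
    by simp
  have "(\<integral>\<omega>. simple_ito V n \<tau> h t \<omega> * simple_ito V' n' \<tau>' h' t \<omega> \<partial>M)
    = (\<integral>\<omega>. (\<Sum>i<n. \<Sum>j<n'. X i \<omega> * Y j \<omega>) \<partial>M)"
    by (simp add: I I' sum_product X_def Y_def)
  also have "\<dots> = (\<Sum>i<n. \<Sum>j<n'. \<integral>\<omega>. X i \<omega> * Y j \<omega> \<partial>M)"
    using sX(1) sY(1) by (intro integral_double_sum square_integrable_mult)
  also have "\<dots> = e * (\<Sum>i<n. \<Sum>j<n'. \<integral>z. x i z * y j z \<partial>prod_upto t)"
    using cell by (simp add: sum_distrib_left)
  also have "(\<Sum>i<n. \<Sum>j<n'. \<integral>z. x i z * y j z \<partial>prod_upto t) = (\<integral>z. (\<Sum>i<n. \<Sum>j<n'. x i z * y j z) \<partial>prod_upto t)"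
    using sX(2) sY(2) by (intro integral_double_sum[symmetric] square_integrable_mult)
  also have "\<dots> = (\<integral>z. simple_process n \<tau> h (fst z) (snd z) * simple_process n' \<tau>' h' (fst z) (snd z) \<partial>prod_upto t)"
  proof (intro Bochner_Integration.integral_cong refl)
    fix z assume "z \<in> space (prod_upto t)"
    then have z: "fst z \<le> t" using space_prod_upto by auto
    show "(\<Sum>i<n. \<Sum>j<n'. x i z * y j z)
        = simple_process n \<tau> h (fst z) (snd z) * simple_process n' \<tau>' h' (fst z) (snd z)"
      by (simp only: P[OF z] P'[OF z] sum_product x_def y_def)
  qed
  finally show ?thesis .
qed

text \<open>
  Only the part of a cell after \<open>s\<close> contributes to the difference of the two sides, and there it is a
  coefficient times a later increment of the noise.
\<close>

lemma simple_ito_martingale: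
  assumes B: "bracket V V' e" and S: "simple_integrand T F n \<tau> h" and st: "0 \<le> s" "s \<le> t" "t \<le> T"
    and \<eta>: "\<eta> \<in> borel_measurable (F s)" "square_integrable M \<eta>"
  shows "(\<integral>\<omega>. \<eta> \<omega> * simple_ito V n \<tau> h t \<omega> \<partial>M) = (\<integral>\<omega>. \<eta> \<omega> * simple_ito V n \<tau> h s \<omega> \<partial>M)"
proof -
  define D where "D i \<omega> = (V (min (\<tau> (Suc i)) t) \<omega> - V (min (\<tau> i) t) \<omega>)
      - (V (min (\<tau> (Suc i)) s) \<omega> - V (min (\<tau> i) s) \<omega>)" for i \<omega>
  have \<tau>: "\<tau> i \<in> {0..T}" "\<tau> (Suc i) \<in> {0..T}" "\<tau> i \<le> \<tau> (Suc i)" "bounded_adapted (\<tau> i) (h i)" if "i < n" for i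
    using S that by (auto simp: simple_integrand_def bounded_adapted_def)
  have sqD: "square_integrable M (\<lambda>\<omega>. h i \<omega> * D i \<omega>)" if "i < n" for i
    unfolding D_def using \<tau>[OF that] st
    by (intro bounded_adapted_square_integrable_mult[OF \<tau>(4)[OF that]] square_integrable_diff bracket_square_integrable[OF B]) auto
  have zero: "(\<integral>\<omega>. \<eta> \<omega> * (h i \<omega> * D i \<omega>) \<partial>M) = 0" if "i < n" for i
  proof -
    note \<tau>i = \<tau>[OF that]
    \<comment> \<open>the increment that the cell contributes after time \<open>s\<close>\<close>
    define r where "r = min (max (\<tau> i) s) t"
    define u where "u = max r (min (\<tau> (Suc i)) t)"
    have D: "D i \<omega> = V u \<omega> - V r \<omega>" for \<omega>
      using \<tau>i st by (auto simp: D_def u_def r_def min_def max_def)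
    consider "\<tau> i \<le> t" | "u = r" using \<tau>i by (fastforce simp: u_def r_def)
    then show ?thesis
    proof cases
      case 1
      then have r: "r = max (\<tau> i) s" "r \<le> T" "0 \<le> r" using st by (auto simp: r_def)
      have h: "bounded_adapted r (h i)" and \<eta>r: "\<eta> \<in> borel_measurable (F r)"
        using r bounded_adapted_mono[OF \<tau>i(4)] measurable_F_mono[OF \<eta>(1)] by auto
      have "(\<integral>\<omega>. (h i \<omega> * \<eta> \<omega>) * (V u \<omega> - V r \<omega>) \<partial>M) = 0"
        using r st \<tau>i \<eta>r h bounded_adapted_square_integrable_mult[OF h r(2) \<eta>(2)]
        by (intro bracket_martingale[OF B]) (auto simp: u_def bounded_adapted_def)
      then show ?thesis by (simp add: D ac_simps)
    next
      case 2
      then show ?thesis by (simp add: D)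
    qed
  qed
  have "(\<integral>\<omega>. \<eta> \<omega> * simple_ito V n \<tau> h t \<omega> \<partial>M) - (\<integral>\<omega>. \<eta> \<omega> * simple_ito V n \<tau> h s \<omega> \<partial>M)
     = (\<integral>\<omega>. \<eta> \<omega> * simple_ito V n \<tau> h t \<omega> - \<eta> \<omega> * simple_ito V n \<tau> h s \<omega> \<partial>M)"
    using st by (intro Bochner_Integration.integral_diff[symmetric] square_integrable_mult \<eta> simple_ito_square_integrable[OF B S]) auto
  also have "\<dots> = (\<integral>\<omega>. (\<Sum>i<n. \<eta> \<omega> * (h i \<omega> * D i \<omega>)) \<partial>M)"
    by (intro Bochner_Integration.integral_cong refl)
       (simp add: simple_ito_def D_def sum_distrib_left sum_subtractf[symmetric] algebra_simps)
  also have "\<dots> = (\<Sum>i<n. \<integral>\<omega>. \<eta> \<omega> * (h i \<omega> * D i \<omega>) \<partial>M)"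
    using sqD by (intro Bochner_Integration.integral_sum square_integrable_mult \<eta>) auto
  also have "\<dots> = 0" using zero by simp
  finally show ?thesis by simp
qed

text \<open>
  The part of \<open>has_ito_integral\<close> that concerns a single time, as convergence on the product space.  Simple
  integrals are limits of constant sequences in this sense, so the isometry below also compares a simple
  integral with a general one.
\<close>

definition ito_limit :: "(real \<Rightarrow> 'a \<Rightarrow> real) \<Rightarrow> (real \<Rightarrow> 'a \<Rightarrow> real) \<Rightarrow> real \<Rightarrow> ('a \<Rightarrow> real) \<Rightarrow> bool" where
  "ito_limit V \<gamma> t I \<longleftrightarrow> process_L2 t \<gamma> \<and> square_integrable M I \<and>
     (\<exists>n \<tau> h. (\<forall>k. simple_integrand T F (n k) (\<tau> k) (h k)) \<and>
        (\<lambda>k. \<integral>\<^sup>+z. ennreal ((simple_process (n k) (\<tau> k) (h k) (fst z) (snd z) - \<gamma> (fst z) (snd z))\<^sup>2) \<partial>prod_upto t)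
          \<longlonglongrightarrow> 0 \<and>
        (\<lambda>k. \<integral>\<^sup>+\<omega>. ennreal ((simple_ito V (n k) (\<tau> k) (h k) t \<omega> - I \<omega>)\<^sup>2) \<partial>M) \<longlonglongrightarrow> 0)"

lemma ito_limit_simple:
  assumes "bracket V V' e" "simple_integrand T F n \<tau> h" "t \<in> {0..T}"
  shows "ito_limit V (simple_process n \<tau> h) t (simple_ito V n \<tau> h t)"
  unfolding ito_limit_def
  using assms simple_process_L2[OF assms(2,3)] simple_ito_square_integrable[OF assms]
  by (intro conjI exI[of _ "\<lambda>_. n"] exI[of _ "\<lambda>_. \<tau>"] exI[of _ "\<lambda>_. h"]) simp_all

lemma has_ito_integral_imp_ito_limit:
  assumes B: "bracket V V' e" and H: "has_ito_integral M T F V \<gamma> t I" and t: "t \<in> {0..T}"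
  shows "ito_limit V \<gamma> t I"
proof -
  obtain n \<tau> h where S: "\<And>k. simple_integrand T F (n k) (\<tau> k) (h k)"
    and 1: "(\<lambda>k. \<integral>\<^sup>+\<omega>. (\<integral>\<^sup>+s\<in>{0..t}.
            ennreal ((simple_process (n k) (\<tau> k) (h k) s \<omega> - \<gamma> s \<omega>)\<^sup>2) \<partial>lborel) \<partial>M) \<longlonglongrightarrow> 0"
    and 2: "(\<lambda>k. \<integral>\<^sup>+\<omega>. ennreal ((simple_ito V (n k) (\<tau> k) (h k) t \<omega> - I \<omega>)\<^sup>2) \<partial>M) \<longlonglongrightarrow> 0"
    and \<gamma>: "\<gamma> \<in> L2_prog M T F" and I: "I \<in> borel_measurable M"
    using H unfolding has_ito_integral_def by blast
  have \<gamma>2: "process_L2 t \<gamma>"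
    using \<gamma> t process_L2_mono unfolding L2_prog_iff by auto
  have "(\<lambda>z. ennreal ((simple_process (n k) (\<tau> k) (h k) (fst z) (snd z) - \<gamma> (fst z) (snd z))\<^sup>2)) \<in> borel_measurable (prod_upto t)" for k
    using square_integrable_measurable[OF square_integrable_diff[OF simple_process_L2[OF S[of k] t] \<gamma>2]]
    by measurable
  from nn_integral_prod_upto[of "\<lambda>s \<omega>. ennreal ((simple_process (n k) (\<tau> k) (h k) s \<omega> - \<gamma> s \<omega>)\<^sup>2)" for k, OF this] 1
  have "(\<lambda>k. \<integral>\<^sup>+z. ennreal ((simple_process (n k) (\<tau> k) (h k) (fst z) (snd z) - \<gamma> (fst z) (snd z))\<^sup>2) \<partial>prod_upto t)
          \<longlonglongrightarrow> 0"
    by simp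
  moreover have "square_integrable M I"
  proof -
    have "eventually (\<lambda>k. (\<integral>\<^sup>+\<omega>. ennreal ((simple_ito V (n k) (\<tau> k) (h k) t \<omega> - I \<omega>)\<^sup>2) \<partial>M) < 1) sequentially"
      using order_tendstoD(2)[OF 2, of 1] by simp
    then obtain k where "(\<integral>\<^sup>+\<omega>. ennreal ((simple_ito V (n k) (\<tau> k) (h k) t \<omega> - I \<omega>)\<^sup>2) \<partial>M) < 1"
      by (auto simp: eventually_sequentially)
    then have "(\<integral>\<^sup>+\<omega>. ennreal ((simple_ito V (n k) (\<tau> k) (h k) t \<omega> - I \<omega>)\<^sup>2) \<partial>M) < \<infinity>"
      by (rule order_less_trans) simp
    from square_integrable_of_close[OF simple_ito_square_integrable[OF B S t] I this] show ?thesis .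
  qed
  ultimately show ?thesis unfolding ito_limit_def using \<gamma>2 S 2 by blast
qed

lemma ito_limit_isometry:
  assumes B: "bracket V V' e" and I: "ito_limit V \<gamma> t I" and J: "ito_limit V' \<delta> t J" and t: "t \<in> {0..T}"
  shows "(\<integral>\<omega>. I \<omega> * J \<omega> \<partial>M) = e * (\<integral>z. \<gamma> (fst z) (snd z) * \<delta> (fst z) (snd z) \<partial>prod_upto t)"
proof -
  obtain n \<tau> h where S: "\<And>k. simple_integrand T F (n k) (\<tau> k) (h k)"
    and 1: "(\<lambda>k. \<integral>\<^sup>+z. ennreal ((simple_process (n k) (\<tau> k) (h k) (fst z) (snd z) - \<gamma> (fst z) (snd z))\<^sup>2) \<partial>prod_upto t)
          \<longlonglongrightarrow> 0"
      "(\<lambda>k. \<integral>\<^sup>+\<omega>. ennreal ((simple_ito V (n k) (\<tau> k) (h k) t \<omega> - I \<omega>)\<^sup>2) \<partial>M) \<longlonglongrightarrow> 0"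
    and sq: "process_L2 t \<gamma>" "square_integrable M I"
    using I unfolding ito_limit_def by blast
  obtain n' \<tau>' h' where S': "\<And>k. simple_integrand T F (n' k) (\<tau>' k) (h' k)"
    and 2: "(\<lambda>k. \<integral>\<^sup>+z. ennreal ((simple_process (n' k) (\<tau>' k) (h' k) (fst z) (snd z) - \<delta> (fst z) (snd z))\<^sup>2) \<partial>prod_upto t)
          \<longlonglongrightarrow> 0"
      "(\<lambda>k. \<integral>\<^sup>+\<omega>. ennreal ((simple_ito V' (n' k) (\<tau>' k) (h' k) t \<omega> - J \<omega>)\<^sup>2) \<partial>M) \<longlonglongrightarrow> 0"
    and sq': "process_L2 t \<delta>" "square_integrable M J"
    using J unfolding ito_limit_def by blast
  note l1 = tendsto_integral_mult[OF sq(1) sq'(1) simple_process_L2[OF S t] simple_process_L2[OF S' t] 1(1) 2(1)]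
  note l2 = tendsto_integral_mult[OF sq(2) sq'(2) simple_ito_square_integrable[OF B S t]
    simple_ito_square_integrable[OF bracket_sym[OF B] S' t] 1(2) 2(2)]
  show ?thesis
    using LIMSEQ_unique[OF l2[unfolded simple_ito_isometry[OF B S S' t]] tendsto_mult_left[OF l1, of e]] .
qed

lemma ito_limit_square_dist:
  assumes B: "bracket V V 1" and I: "ito_limit V \<gamma> t I" and J: "ito_limit V \<delta> t J" and t: "t \<in> {0..T}"
  shows "(\<integral>\<^sup>+\<omega>. ennreal ((I \<omega> - J \<omega>)\<^sup>2) \<partial>M)
    = (\<integral>\<^sup>+z. ennreal ((\<gamma> (fst z) (snd z) - \<delta> (fst z) (snd z))\<^sup>2) \<partial>prod_upto t)"
proof -
  have sq: "process_L2 t \<gamma>" "square_integrable M I" "process_L2 t \<delta>" "square_integrable M J"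
    using I J by (auto simp: ito_limit_def)
  note iso = ito_limit_isometry[OF B _ _ t, simplified]
  have "(\<integral>\<omega>. (I \<omega> - J \<omega>)\<^sup>2 \<partial>M) = (\<integral>z. (\<gamma> (fst z) (snd z) - \<delta> (fst z) (snd z))\<^sup>2 \<partial>prod_upto t)"
    unfolding integral_square_diff[OF sq(2,4)] integral_square_diff[OF sq(1,3)]
      iso[OF I I] iso[OF I J] iso[OF J J] ..
  then show ?thesis
    by (simp add: nn_integral_square_eq square_integrable_diff sq)
qed

text \<open>
  The integrals at \<open>s\<close> and at \<open>t\<close> are limits of unrelated simple integrals.  The isometry shows that those
  approximating \<open>I\<close>, evaluated at \<open>s\<close>, converge to \<open>J\<close>.
\<close>

lemma ito_limit_martingale:
  assumes B: "bracket V V 1" and I: "ito_limit V \<gamma> t I" and J: "ito_limit V \<gamma> s J"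
    and st: "0 \<le> s" "s \<le> t" "t \<le> T" and \<eta>: "\<eta> \<in> borel_measurable (F s)" "square_integrable M \<eta>"
  shows "(\<integral>\<omega>. \<eta> \<omega> * I \<omega> \<partial>M) = (\<integral>\<omega>. \<eta> \<omega> * J \<omega> \<partial>M)"
proof -
  have s: "s \<in> {0..T}" and t: "t \<in> {0..T}" using st by auto
  obtain n \<tau> h where S: "\<And>k. simple_integrand T F (n k) (\<tau> k) (h k)"
    and 1: "(\<lambda>k. \<integral>\<^sup>+z. ennreal ((simple_process (n k) (\<tau> k) (h k) (fst z) (snd z) - \<gamma> (fst z) (snd z))\<^sup>2) \<partial>prod_upto t)
          \<longlonglongrightarrow> 0"
      "(\<lambda>k. \<integral>\<^sup>+\<omega>. ennreal ((simple_ito V (n k) (\<tau> k) (h k) t \<omega> - I \<omega>)\<^sup>2) \<partial>M) \<longlonglongrightarrow> 0"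
    and sq: "process_L2 t \<gamma>" "square_integrable M I"
    using I unfolding ito_limit_def by blast
  have sqJ: "square_integrable M J" using J by (simp add: ito_limit_def)
  \<comment> \<open>stopping the approximating simple integrals of \<open>I\<close> at time \<open>s\<close> approximates \<open>J\<close>, by the isometry\<close>
  have "(\<lambda>k. \<integral>\<^sup>+z. ennreal ((simple_process (n k) (\<tau> k) (h k) (fst z) (snd z) - \<gamma> (fst z) (snd z))\<^sup>2) \<partial>prod_upto s)
          \<longlonglongrightarrow> 0"
  proof (rule tendsto_sandwich[OF _ _ tendsto_const 1(1)])
    show "\<forall>\<^sub>F k in sequentially.
        (\<integral>\<^sup>+z. ennreal ((simple_process (n k) (\<tau> k) (h k) (fst z) (snd z) - \<gamma> (fst z) (snd z))\<^sup>2) \<partial>prod_upto s)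
      \<le> (\<integral>\<^sup>+z. ennreal ((simple_process (n k) (\<tau> k) (h k) (fst z) (snd z) - \<gamma> (fst z) (snd z))\<^sup>2) \<partial>prod_upto t)"
    proof (intro always_eventually allI)
      fix k
      have "(\<lambda>z. ennreal ((simple_process (n k) (\<tau> k) (h k) (fst z) (snd z) - \<gamma> (fst z) (snd z))\<^sup>2)) \<in> borel_measurable (prod_upto t)"
        using square_integrable_measurable[OF square_integrable_diff[OF simple_process_L2[OF S[of k] t] sq(1)]]
        by measurable
      from nn_integral_prod_upto_mono[of "\<lambda>s \<omega>. ennreal ((simple_process (n k) (\<tau> k) (h k) s \<omega> - \<gamma> s \<omega>)\<^sup>2)", OF this st(2)]
      show "(\<integral>\<^sup>+z. ennreal ((simple_process (n k) (\<tau> k) (h k) (fst z) (snd z) - \<gamma> (fst z) (snd z))\<^sup>2) \<partial>prod_upto s)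
      \<le> (\<integral>\<^sup>+z. ennreal ((simple_process (n k) (\<tau> k) (h k) (fst z) (snd z) - \<gamma> (fst z) (snd z))\<^sup>2) \<partial>prod_upto t)" .
    qed
  qed simp
  then have 2: "(\<lambda>k. \<integral>\<^sup>+\<omega>. ennreal ((simple_ito V (n k) (\<tau> k) (h k) s \<omega> - J \<omega>)\<^sup>2) \<partial>M) \<longlonglongrightarrow> 0"
    unfolding ito_limit_square_dist[OF B ito_limit_simple[OF B S s] J s] .
  have const: "(\<lambda>k::nat. \<integral>\<^sup>+\<omega>. ennreal ((\<eta> \<omega> - \<eta> \<omega>)\<^sup>2) \<partial>M) \<longlonglongrightarrow> 0" by simp
  note l1 = tendsto_integral_mult[OF \<eta>(2) sq(2) \<eta>(2) simple_ito_square_integrable[OF B S t] const 1(2)]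
  note l2 = tendsto_integral_mult[OF \<eta>(2) sqJ \<eta>(2) simple_ito_square_integrable[OF B S s] const 2]
  show ?thesis
    using LIMSEQ_unique[OF l1[unfolded simple_ito_martingale[OF B S st \<eta>]] l2] .
qed

end

section \<open>The expected product of two Ito processes\<close>

definition drift :: "(real \<Rightarrow> 'a \<Rightarrow> real) \<Rightarrow> real \<Rightarrow> 'a \<Rightarrow> real" where
  "drift \<beta> t \<omega> = (\<integral>s. \<beta> s \<omega> \<partial>time_upto t)"

lemma drift_eq: "drift \<beta> t \<omega> = (LINT s:{0..t}|lborel. \<beta> s \<omega>)"
  by (simp add: drift_def integral_restrict_space set_lebesgue_integral_def)

lemma drift_0: "drift \<beta> 0 \<omega> = 0"
proof -
  have "AE s in lborel. indicator {0..0::real} s *\<^sub>R \<beta> s \<omega> = 0"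
    using AE_lborel_singleton[of "0::real"] by eventually_elim (auto simp: indicator_def)
  then show ?thesis
    unfolding drift_eq set_lebesgue_integral_def by (rule integral_eq_zero_AE)
qed

text \<open>
  The product rule for two absolutely continuous functions vanishing at 0: Fubini on the two triangles of
  the square.
\<close>

lemma
  fixes a b :: "real \<Rightarrow> real"
  assumes a: "integrable (time_upto t) a" and b: "integrable (time_upto t) b"
  shows integrable_time_upto_product:
      "integrable (time_upto t) (\<lambda>s. a s * (\<integral>r. b r \<partial>time_upto s) + (\<integral>r. a r \<partial>time_upto s) * b s)"
    and integral_time_upto_product:
      "(\<integral>s. a s \<partial>time_upto t) * (\<integral>s. b s \<partial>time_upto t)
    = (\<integral>s. a s * (\<integral>r. b r \<partial>time_upto s) + (\<integral>r. a r \<partial>time_upto s) * b s \<partial>time_upto t)"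
proof -
  interpret A: finite_measure "time_upto t" by (rule finite_measure_time_upto)
  interpret P: pair_sigma_finite "time_upto t" "time_upto t" by (rule pair_sigma_finite.intro) unfold_locales
  note [measurable] = borel_measurable_integrable[OF a] borel_measurable_integrable[OF b]
  have id[measurable]: "(\<lambda>x. x) \<in> borel_measurable (time_upto t)"
    by (simp add: measurable_restrict_space1)
  have ab: "integrable (time_upto t \<Otimes>\<^sub>M time_upto t) (\<lambda>(x, y). a x * b y)"
  proof (rule P.Fubini_integrable)
    show "integrable (time_upto t) (\<lambda>x. \<integral>y. norm (case (x, y) of (x, y) \<Rightarrow> a x * b y) \<partial>time_upto t)"
      using a by (simp add: abs_mult)
    show "AE x in time_upto t. integrable (time_upto t) (\<lambda>y. case (x, y) of (x, y) \<Rightarrow> a x * b y)"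
      using b by simp
  qed measurable
  define lo where "lo = (\<lambda>x y. if y \<le> x then a x * b y else 0)"
  define hi where "hi = (\<lambda>x y. if x < y then a x * b y else 0)"
  have [measurable]: "case_prod lo \<in> borel_measurable (time_upto t \<Otimes>\<^sub>M time_upto t)"
      "case_prod hi \<in> borel_measurable (time_upto t \<Otimes>\<^sub>M time_upto t)"
    unfolding lo_def hi_def split_beta' by measurable
  have ilo: "integrable (time_upto t \<Otimes>\<^sub>M time_upto t) (case_prod lo)"
    and ihi: "integrable (time_upto t \<Otimes>\<^sub>M time_upto t) (case_prod hi)"
    by (rule Bochner_Integration.integrable_bound[OF ab], measurable, auto simp: lo_def hi_def)+
  have inner_lo: "(\<integral>y. lo x y \<partial>time_upto t) = a x * (\<integral>r. b r \<partial>time_upto x)" if "x \<in> {0..t}" for x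
  proof -
    have "(\<integral>y. lo x y \<partial>time_upto t) = (\<integral>y. indicator {0..t} y *\<^sub>R lo x y \<partial>lborel)"
      by (rule integral_restrict_space) simp
    also have "\<dots> = (\<integral>y. a x * (indicator {0..x} y *\<^sub>R b y) \<partial>lborel)"
      by (intro Bochner_Integration.integral_cong refl) (use that in \<open>auto simp: indicator_def lo_def\<close>)
    finally show ?thesis by (simp add: integral_restrict_space)
  qed
  have inner_hi: "(\<integral>x. hi x y \<partial>time_upto t) = (\<integral>r. a r \<partial>time_upto y) * b y" if "y \<in> {0..t}" for y
  proof -
    have "(\<integral>x. hi x y \<partial>time_upto t) = (\<integral>x. indicator {0..t} x *\<^sub>R hi x y \<partial>lborel)"
      by (rule integral_restrict_space) simp
    also have "\<dots> = (\<integral>x. (indicator {0..y} x *\<^sub>R a x) * b y \<partial>lborel)"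
    proof (rule integral_cong_AE)
      have "(\<lambda>x. indicator {0..t} x *\<^sub>R hi x y) \<in> borel_measurable lborel"
      proof -
        have "(\<lambda>x. hi x y) \<in> borel_measurable (time_upto t)"
          unfolding hi_def by measurable
        then show ?thesis
          by (subst (asm) borel_measurable_restrict_space_iff) auto
      qed
      then show "(\<lambda>x. indicator {0..t} x *\<^sub>R hi x y) \<in> borel_measurable lborel" .
      have "(\<lambda>x. indicator {0..t} x *\<^sub>R a x) \<in> borel_measurable lborel"
        using borel_measurable_integrable[OF a] by (subst (asm) borel_measurable_restrict_space_iff) auto
      then have "(\<lambda>x. indicator {0..y} x *\<^sub>R (indicator {0..t} x *\<^sub>R a x)) \<in> borel_measurable lborel"
        by measurable
      moreover have "(\<lambda>x. indicator {0..y} x *\<^sub>R (indicator {0..t} x *\<^sub>R a x)) = (\<lambda>x. indicator {0..y} x *\<^sub>R a x)"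
        using that by (auto simp: indicator_def)
      ultimately have "(\<lambda>x. indicator {0..y} x *\<^sub>R a x) \<in> borel_measurable lborel" by simp
      then show "(\<lambda>x. (indicator {0..y} x *\<^sub>R a x) * b y) \<in> borel_measurable lborel" by measurable
      show "AE x in lborel. indicator {0..t} x *\<^sub>R hi x y = (indicator {0..y} x *\<^sub>R a x) * b y"
        using AE_lborel_singleton[of y]
        by eventually_elim (use that in \<open>auto simp: indicator_def hi_def\<close>)
    qed
    finally show ?thesis by (simp add: integral_restrict_space)
  qed
  have lo: "(\<integral>x. \<integral>y. lo x y \<partial>time_upto t \<partial>time_upto t) = (\<integral>s. a s * (\<integral>r. b r \<partial>time_upto s) \<partial>time_upto t)"
    by (intro Bochner_Integration.integral_cong refl inner_lo) simp
  have hi: "(\<integral>y. \<integral>x. hi x y \<partial>time_upto t \<partial>time_upto t) = (\<integral>s. (\<integral>r. a r \<partial>time_upto s) * b s \<partial>time_upto t)"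
    by (intro Bochner_Integration.integral_cong refl inner_hi) simp
  have i1: "integrable (time_upto t) (\<lambda>s. a s * (\<integral>r. b r \<partial>time_upto s))"
    using P.integrable_fst[OF ilo]
    by (rule iffD1[OF Bochner_Integration.integrable_cong[OF refl], rotated]) (simp add: inner_lo)
  have i2: "integrable (time_upto t) (\<lambda>s. (\<integral>r. a r \<partial>time_upto s) * b s)"
    using P.integrable_snd[OF ihi]
    by (rule iffD1[OF Bochner_Integration.integrable_cong[OF refl], rotated]) (simp add: inner_hi)
  have "(\<integral>s. a s \<partial>time_upto t) * (\<integral>s. b s \<partial>time_upto t) = (\<integral>x. \<integral>y. a x * b y \<partial>time_upto t \<partial>time_upto t)"
    by simp
  also have "\<dots> = (\<integral>z. (case z of (x, y) \<Rightarrow> a x * b y) \<partial>(time_upto t \<Otimes>\<^sub>M time_upto t))"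
    by (rule P.integral_fst[OF ab])
  also have "\<dots> = (\<integral>z. case_prod lo z + case_prod hi z \<partial>(time_upto t \<Otimes>\<^sub>M time_upto t))"
    by (intro Bochner_Integration.integral_cong) (auto simp: lo_def hi_def)
  also have "\<dots> = (\<integral>x. \<integral>y. lo x y \<partial>time_upto t \<partial>time_upto t) + (\<integral>y. \<integral>x. hi x y \<partial>time_upto t \<partial>time_upto t)"
    using P.integral_fst[OF ilo] P.integral_snd[OF ihi] ilo ihi by simp
  finally show "(\<integral>s. a s \<partial>time_upto t) * (\<integral>s. b s \<partial>time_upto t)
    = (\<integral>s. a s * (\<integral>r. b r \<partial>time_upto s) + (\<integral>r. a r \<partial>time_upto s) * b s \<partial>time_upto t)"
    using i1 i2 by (simp add: lo hi)
  show "integrable (time_upto t) (\<lambda>s. a s * (\<integral>r. b r \<partial>time_upto s) + (\<integral>r. a r \<partial>time_upto s) * b s)"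
    using i1 i2 by simp
qed

context common_noise
begin

abbreviation process_inner :: "real \<Rightarrow> (real \<Rightarrow> 'a \<Rightarrow> real) \<Rightarrow> (real \<Rightarrow> 'a \<Rightarrow> real) \<Rightarrow> real" where
  "process_inner t \<gamma> \<delta> \<equiv> (\<integral>z. \<gamma> (fst z) (snd z) * \<delta> (fst z) (snd z) \<partial>prod_upto t)"

lemma process_L2_sections:
  assumes "process_L2 t \<beta>"
  shows "AE \<omega> in M. square_integrable (time_upto t) (\<lambda>s. \<beta> s \<omega>)"
    and "AE s in time_upto t. square_integrable M (\<beta> s)"
    and "integrable M (\<lambda>\<omega>. \<integral>s. (\<beta> s \<omega>)\<^sup>2 \<partial>time_upto t)"
proof -
  interpret P: pair_sigma_finite "time_upto t" M by (rule pair_sigma_finite_prod_upto)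
  have i: "integrable (prod_upto t) (\<lambda>(s, \<omega>). (\<beta> s \<omega>)\<^sup>2)"
    using square_integrable_power2[OF assms] by (simp add: split_beta')
  have m: "(\<lambda>(s, \<omega>). \<beta> s \<omega>) \<in> borel_measurable (prod_upto t)"
    using assms by (simp add: square_integrable_def split_beta')
  have "(\<lambda>s. \<beta> s \<omega>) \<in> borel_measurable (time_upto t)" if "\<omega> \<in> space M" for \<omega>
    using measurable_compose[OF measurable_Pair2'[OF that, of "time_upto t"] m] by simp
  then show "AE \<omega> in M. square_integrable (time_upto t) (\<lambda>s. \<beta> s \<omega>)"
    using P.AE_integrable_snd[OF i] AE_space by (auto simp: square_integrable_def)
  have "\<beta> s \<in> borel_measurable M" if "s \<in> space (time_upto t)" for s
    using measurable_compose[OF measurable_Pair1'[OF that, of M] m] by simp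
  then show "AE s in time_upto t. square_integrable M (\<beta> s)"
    using P.AE_integrable_fst[OF i] AE_space[of "time_upto t"] by (auto simp: square_integrable_def)
  show "integrable M (\<lambda>\<omega>. \<integral>s. (\<beta> s \<omega>)\<^sup>2 \<partial>time_upto t)"
    using P.integrable_snd[OF i] .
qed

lemma drift_measurable_prod:
  assumes m: "(\<lambda>z. \<beta> (fst z) (snd z)) \<in> borel_measurable (prod_upto t)"
  shows "(\<lambda>z. drift \<beta> (fst z) (snd z)) \<in> borel_measurable (prod_upto t)"
proof -
  interpret A: finite_measure "time_upto t" by (rule finite_measure_time_upto)
  have sw: "(\<lambda>(z, r). \<beta> r (snd z)) \<in> borel_measurable (prod_upto t \<Otimes>\<^sub>M time_upto t)"
  proof -
    have "(\<lambda>y. (snd y, snd (fst y))) \<in> prod_upto t \<Otimes>\<^sub>M time_upto t \<rightarrow>\<^sub>M prod_upto t"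
      by measurable
    from measurable_compose[OF this m] show ?thesis by (simp add: split_beta')
  qed
  have t1[measurable]: "(\<lambda>y. fst (fst y)) \<in> borel_measurable (prod_upto t \<Otimes>\<^sub>M time_upto t)"
    by (rule measurable_compose[OF measurable_fst fst_prod_upto])
  have t2[measurable]: "snd \<in> borel_measurable (prod_upto t \<Otimes>\<^sub>M time_upto t)"
    by (rule measurable_compose[OF measurable_snd]) (simp add: measurable_restrict_space1)
  have [measurable]: "(\<lambda>y. \<beta> (snd y) (snd (fst y))) \<in> borel_measurable (prod_upto t \<Otimes>\<^sub>M time_upto t)"
    using sw by (simp add: split_beta')
  have "(\<lambda>y. if snd y \<le> fst (fst y) then \<beta> (snd y) (snd (fst y)) else 0) \<in> borel_measurable (prod_upto t \<Otimes>\<^sub>M time_upto t)"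
    by measurable
  then have "(\<lambda>(z, r). if r \<le> fst z then \<beta> r (snd z) else 0) \<in> borel_measurable (prod_upto t \<Otimes>\<^sub>M time_upto t)"
    by (simp add: split_beta')
  from A.borel_measurable_lebesgue_integral[OF this]
  have "(\<lambda>z. \<integral>r. (if r \<le> fst z then \<beta> r (snd z) else 0) \<partial>time_upto t) \<in> borel_measurable (prod_upto t)" .
  moreover have "drift \<beta> (fst z) (snd z) = (\<integral>r. (if r \<le> fst z then \<beta> r (snd z) else 0) \<partial>time_upto t)"
    if "z \<in> space (prod_upto t)" for z
    unfolding drift_def using space_prod_upto[OF that]
    by (simp add: integral_restrict_space)
       (auto intro!: Bochner_Integration.integral_cong simp: indicator_def)
  ultimately show ?thesis by (simp cong: measurable_cong)
qed

lemma drift_square_integrable: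
  assumes "process_L2 t \<beta>"
  shows "square_integrable M (drift \<beta> t)"
proof -
  interpret A: finite_measure "time_upto t" by (rule finite_measure_time_upto)
  interpret P: pair_sigma_finite "time_upto t" M by (rule pair_sigma_finite_prod_upto)
  interpret Q: finite_measure "prod_upto t" by (rule finite_measure_prod_upto)
  have "integrable (prod_upto t) (case_prod \<beta>)"
    using Q.square_integrable_imp_integrable[OF assms] by (simp add: split_beta')
  from P.integrable_snd[OF this] have m: "drift \<beta> t \<in> borel_measurable M"
    unfolding drift_def[abs_def] by (rule borel_measurable_integrable)
  define c :: real where "c = (\<integral>s. 1\<^sup>2 \<partial>time_upto t)"
  have "integrable M (\<lambda>\<omega>. (drift \<beta> t \<omega>)\<^sup>2)"
  proof (rule Bochner_Integration.integrable_bound)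
    show "integrable M (\<lambda>\<omega>. c * (\<integral>s. (\<beta> s \<omega>)\<^sup>2 \<partial>time_upto t))"
      using process_L2_sections(3)[OF assms] by simp
    show "(\<lambda>\<omega>. (drift \<beta> t \<omega>)\<^sup>2) \<in> borel_measurable M" using m by measurable
    show "AE \<omega> in M. norm ((drift \<beta> t \<omega>)\<^sup>2) \<le> norm (c * (\<integral>s. (\<beta> s \<omega>)\<^sup>2 \<partial>time_upto t))"
      using process_L2_sections(1)[OF assms]
    proof eventually_elim
      case (elim \<omega>)
      from Cauchy_Schwarz_integral[OF A.square_integrable_const[of 1] elim]
      have "\<bar>drift \<beta> t \<omega>\<bar> \<le> sqrt (c * (\<integral>s. (\<beta> s \<omega>)\<^sup>2 \<partial>time_upto t))"
        by (simp add: drift_def c_def real_sqrt_mult)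
      then have "\<bar>drift \<beta> t \<omega>\<bar>\<^sup>2 \<le> (sqrt (c * (\<integral>s. (\<beta> s \<omega>)\<^sup>2 \<partial>time_upto t)))\<^sup>2"
        by (intro power_mono) auto
      moreover have "0 \<le> c * (\<integral>s. (\<beta> s \<omega>)\<^sup>2 \<partial>time_upto t)" by (simp add: c_def)
      ultimately show ?case by simp
    qed
  qed
  with m show ?thesis by (simp add: square_integrable_def)
qed

text \<open>A null set \<open>N\<close> of scenarios spans the null set \<open>{0..t} \<times> N\<close>, so \<open>Q\<close> need not define a measurable set.\<close>

lemma AE_prod_upto_snd:
  assumes "AE \<omega> in M. Q \<omega>"
  shows "AE z in prod_upto t. Q (snd z)"
proof -
  obtain N where N: "N \<in> null_sets M" "{\<omega> \<in> space M. \<not> Q \<omega>} \<subseteq> N"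
    using assms by (auto simp: eventually_ae_filter)
  have t: "{0..t} \<in> sets (time_upto t)" using sets.top[of "time_upto t"] by simp
  show ?thesis
  proof (rule AE_I', rule null_setsI)
    show "{0..t} \<times> N \<in> sets (prod_upto t)" using t N(1) by auto
    show "emeasure (prod_upto t) ({0..t} \<times> N) = 0"
      using t N(1) by (simp add: emeasure_pair_measure_Times null_sets_def)
    show "{z \<in> space (prod_upto t). \<not> Q (snd z)} \<subseteq> {0..t} \<times> N"
      using N(2) by (auto simp: space_pair_measure)
  qed
qed

lemma process_L2_time_constant:
  assumes "square_integrable M \<eta>"
  shows "process_L2 t (\<lambda>_. \<eta>)"
proof -
  interpret A: finite_measure "time_upto t" by (rule finite_measure_time_upto)
  interpret P: pair_sigma_finite "time_upto t" M by (rule pair_sigma_finite_prod_upto)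
  have [measurable]: "\<eta> \<in> borel_measurable M" using assms by (simp add: square_integrable_def)
  have fin: "emeasure (time_upto t) {0..t} < \<top>"
    using A.emeasure_finite[of "{0..t}"] unfolding less_top infinity_ennreal_def .
  have "(\<integral>\<^sup>+z. ennreal ((\<eta> (snd z))\<^sup>2) \<partial>prod_upto t) = (\<integral>\<^sup>+s. \<integral>\<^sup>+\<omega>. ennreal ((\<eta> \<omega>)\<^sup>2) \<partial>M \<partial>time_upto t)"
    by (subst nn_integral_fst[symmetric]) auto
  also have "\<dots> < \<infinity>"
    using assms fin by (simp add: square_integrable_iff_nn_integral ennreal_mult_less_top top.not_eq_extremum)
  finally show ?thesis by (subst square_integrable_iff_nn_integral) auto
qed

lemma process_L2_abs: "process_L2 t \<beta> \<Longrightarrow> process_L2 t (\<lambda>s \<omega>. \<bar>\<beta> s \<omega>\<bar>)"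
  by (rule square_integrable_abs)

text \<open>The drift up to any earlier time is dominated by the integral of \<open>\<bar>\<beta>\<bar>\<close> over the whole interval.\<close>

lemma drift_process_L2:
  assumes "process_L2 t \<beta>"
  shows "process_L2 t (drift \<beta>)"
proof (rule square_integrable_bound)
  show "process_L2 t (\<lambda>_. drift (\<lambda>s \<omega>. \<bar>\<beta> s \<omega>\<bar>) t)"
    by (intro process_L2_time_constant drift_square_integrable process_L2_abs assms)
  show "(\<lambda>z. drift \<beta> (fst z) (snd z)) \<in> borel_measurable (prod_upto t)"
    using assms by (intro drift_measurable_prod) (simp add: square_integrable_def)
  interpret A: finite_measure "time_upto t" by (rule finite_measure_time_upto)
  have "\<bar>drift \<beta> s \<omega>\<bar> \<le> \<bar>drift (\<lambda>s \<omega>. \<bar>\<beta> s \<omega>\<bar>) t \<omega>\<bar>"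
    if "s \<in> {0..t}" "square_integrable (time_upto t) (\<lambda>s. \<beta> s \<omega>)" for s \<omega>
  proof -
    have "integrable (time_upto t) (\<lambda>r. \<bar>\<beta> r \<omega>\<bar>)"
      using A.square_integrable_imp_integrable[OF that(2)] by simp
    then have i: "integrable lborel (\<lambda>r. indicator {0..t} r *\<^sub>R \<bar>\<beta> r \<omega>\<bar>)"
      by (simp add: integrable_restrict_space)
    have "\<bar>drift \<beta> s \<omega>\<bar> \<le> (\<integral>r. \<bar>\<beta> r \<omega>\<bar> \<partial>time_upto s)"
      unfolding drift_def by (rule integral_abs_bound)
    also have "\<dots> = (\<integral>r. indicator {0..s} r *\<^sub>R \<bar>\<beta> r \<omega>\<bar> \<partial>lborel)"
      by (rule integral_restrict_space) simp
    also have "\<dots> \<le> (\<integral>r. indicator {0..t} r *\<^sub>R \<bar>\<beta> r \<omega>\<bar> \<partial>lborel)"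
    proof (rule integral_mono'[OF i])
      show "indicator {0..s} r *\<^sub>R \<bar>\<beta> r \<omega>\<bar> \<le> indicator {0..t} r *\<^sub>R \<bar>\<beta> r \<omega>\<bar>" for r
        using that by (auto simp: indicator_def)
    qed (auto simp: indicator_def)
    also have "\<dots> = drift (\<lambda>s \<omega>. \<bar>\<beta> s \<omega>\<bar>) t \<omega>"
      unfolding drift_def by (rule integral_restrict_space[symmetric]) simp
    finally show ?thesis by simp
  qed
  note bound = this
  show "AE z in prod_upto t. \<bar>drift \<beta> (fst z) (snd z)\<bar> \<le> \<bar>drift (\<lambda>s \<omega>. \<bar>\<beta> s \<omega>\<bar>) t (snd z)\<bar>"
    using AE_prod_upto_snd[OF process_L2_sections(1)[OF assms]] AE_space[of "prod_upto t"]
  proof eventually_elim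
    case (elim z)
    show ?case
      using space_prod_upto[OF elim(2)] by (intro bound elim(1)) blast
  qed
qed

lemma integral_mult_drift:
  assumes "process_L2 t \<beta>" "square_integrable M \<eta>"
  shows "(\<integral>\<omega>. \<eta> \<omega> * drift \<beta> t \<omega> \<partial>M) = process_inner t (\<lambda>_. \<eta>) \<beta>"
proof -
  interpret P: pair_sigma_finite "time_upto t" M by (rule pair_sigma_finite_prod_upto)
  have "integrable (prod_upto t) (case_prod (\<lambda>s \<omega>. \<eta> \<omega> * \<beta> s \<omega>))"
    using square_integrable_mult[OF process_L2_time_constant[OF assms(2)] assms(1)] by (simp add: split_beta')
  from P.integral_snd[OF this] show ?thesis by (simp add: drift_def split_beta')
qed

definition ito_process_L2 ::
    "(real \<Rightarrow> 'a \<Rightarrow> real) \<Rightarrow> (real \<Rightarrow> 'a \<Rightarrow> real) \<Rightarrow> (real \<Rightarrow> 'a \<Rightarrow> real) \<Rightarrow> (real \<Rightarrow> 'a \<Rightarrow> real) \<Rightarrow> bool" where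
  "ito_process_L2 Z \<beta> \<gamma> t\<gamma> \<longleftrightarrow>
     has_ito_differential M T F W tW Z \<beta> \<gamma> t\<gamma> \<and> \<beta> \<in> L2_prog M T F \<and> square_integrable M (Z 0)"

definition martingale_part :: "(real \<Rightarrow> 'a \<Rightarrow> real) \<Rightarrow> (real \<Rightarrow> 'a \<Rightarrow> real) \<Rightarrow> real \<Rightarrow> 'a \<Rightarrow> real" where
  "martingale_part Z \<beta> t \<omega> = Z t \<omega> - Z 0 \<omega> - drift \<beta> t \<omega>"

lemma martingale_part_limits:
  assumes "ito_process_L2 Z \<beta> \<gamma> t\<gamma>" "t \<in> {0..T}"
  obtains I J where "ito_limit W \<gamma> t I" "ito_limit tW t\<gamma> t J"
    "AE \<omega> in M. martingale_part Z \<beta> t \<omega> = I \<omega> + J \<omega>"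
proof -
  obtain I J where IJ: "has_ito_integral M T F W \<gamma> t I" "has_ito_integral M T F tW t\<gamma> t J"
    "AE \<omega> in M. Z t \<omega> = Z 0 \<omega> + (LINT s:{0..t}|lborel. \<beta> s \<omega>) + I \<omega> + J \<omega>"
    using assms unfolding ito_process_L2_def has_ito_differential_def by blast
  show ?thesis
  proof (rule that)
    show "ito_limit W \<gamma> t I" "ito_limit tW t\<gamma> t J"
      using has_ito_integral_imp_ito_limit IJ(1,2) bracket_noise assms(2) by blast+
    show "AE \<omega> in M. martingale_part Z \<beta> t \<omega> = I \<omega> + J \<omega>"
      using IJ(3) by eventually_elim (simp add: martingale_part_def drift_eq)
  qed
qed

lemma ito_process_measurable:
  assumes "ito_process_L2 Z \<beta> \<gamma> t\<gamma>"
  shows "progressive T F borel Z" "progressive T F borel \<beta>" "process_L2 T \<beta>" "t \<in> {0..T} \<Longrightarrow> process_L2 t \<beta>"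
    "(\<lambda>z. Z (fst z) (snd z)) \<in> borel_measurable (prod_upto T)" "t \<in> {0..T} \<Longrightarrow> Z t \<in> borel_measurable (F t)"
    "t \<in> {0..T} \<Longrightarrow> Z t \<in> borel_measurable M"
proof -
  show Z: "progressive T F borel Z" and "progressive T F borel \<beta>" and \<beta>: "process_L2 T \<beta>"
    using assms by (auto simp: ito_process_L2_def has_ito_differential_def L2_prog_iff)
  show "process_L2 t \<beta>" if "t \<in> {0..T}"
    using process_L2_mono[OF \<beta>] that by simp
  show "(\<lambda>z. Z (fst z) (snd z)) \<in> borel_measurable (prod_upto T)"
    using T_pos by (intro progressive_measurable_prod[OF Z]) simp
  show ad: "Z t \<in> borel_measurable (F t)" if "t \<in> {0..T}"
    by (rule progressive_adapted[OF Z that])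
  show "Z t \<in> borel_measurable M" if "t \<in> {0..T}"
    using measurable_F_M[OF ad[OF that]] that by simp
qed

lemma ito_process_diffusion_L2:
  assumes "ito_process_L2 Z \<beta> \<gamma> t\<gamma>"
  shows "process_L2 T \<gamma>" "process_L2 T t\<gamma>"
proof -
  obtain I J where "ito_limit W \<gamma> T I" "ito_limit tW t\<gamma> T J"
    by (rule martingale_part_limits[OF assms, of T]) (use T_pos in auto)
  then show "process_L2 T \<gamma>" "process_L2 T t\<gamma>" by (auto simp: ito_limit_def)
qed

lemma martingale_part_measurable:
  assumes "ito_process_L2 Z \<beta> \<gamma> t\<gamma>" "t \<in> {0..T}"
  shows "martingale_part Z \<beta> t \<in> borel_measurable M"
proof -
  have "Z t \<in> borel_measurable M" "Z 0 \<in> borel_measurable M" "drift \<beta> t \<in> borel_measurable M"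
    using ito_process_measurable[OF assms(1)] assms(2) T_pos drift_square_integrable[of t \<beta>]
    by (auto simp: square_integrable_def)
  then show ?thesis unfolding martingale_part_def[abs_def] by measurable
qed

lemma martingale_part_square_integrable:
  assumes "ito_process_L2 Z \<beta> \<gamma> t\<gamma>" "t \<in> {0..T}"
  shows "square_integrable M (martingale_part Z \<beta> t)"
proof -
  obtain I J where IJ: "ito_limit W \<gamma> t I" "ito_limit tW t\<gamma> t J"
    "AE \<omega> in M. martingale_part Z \<beta> t \<omega> = I \<omega> + J \<omega>"
    by (rule martingale_part_limits[OF assms])
  then show ?thesis
    by (intro square_integrable_AE_cong[OF square_integrable_add[of M I J] martingale_part_measurable[OF assms]])
       (auto simp: ito_limit_def)
qed

lemma martingale_part_0: "martingale_part Z \<beta> 0 \<omega> = 0"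
  by (simp add: martingale_part_def drift_0)

lemma martingale_part_martingale:
  assumes Z: "ito_process_L2 Z \<beta> \<gamma> t\<gamma>" and st: "0 \<le> s" "s \<le> t" "t \<le> T"
    and \<eta>: "\<eta> \<in> borel_measurable (F s)" "square_integrable M \<eta>"
  shows "(\<integral>\<omega>. \<eta> \<omega> * martingale_part Z \<beta> t \<omega> \<partial>M) = (\<integral>\<omega>. \<eta> \<omega> * martingale_part Z \<beta> s \<omega> \<partial>M)"
proof -
  have t: "t \<in> {0..T}" and s: "s \<in> {0..T}" using st by auto
  obtain I J where IJ: "ito_limit W \<gamma> t I" "ito_limit tW t\<gamma> t J"
    "AE \<omega> in M. martingale_part Z \<beta> t \<omega> = I \<omega> + J \<omega>"
    by (rule martingale_part_limits[OF Z t])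
  obtain I' J' where IJ': "ito_limit W \<gamma> s I'" "ito_limit tW t\<gamma> s J'"
    "AE \<omega> in M. martingale_part Z \<beta> s \<omega> = I' \<omega> + J' \<omega>"
    by (rule martingale_part_limits[OF Z s])
  have sq: "square_integrable M I" "square_integrable M J" "square_integrable M I'" "square_integrable M J'"
    using IJ IJ' by (auto simp: ito_limit_def)
  have eq: "(\<integral>\<omega>. \<eta> \<omega> * N \<omega> \<partial>M) = (\<integral>\<omega>. \<eta> \<omega> * I \<omega> \<partial>M) + (\<integral>\<omega>. \<eta> \<omega> * J \<omega> \<partial>M)"
    if "AE \<omega> in M. N \<omega> = I \<omega> + J \<omega>" "square_integrable M I" "square_integrable M J" "N \<in> borel_measurable M" for N I J
  proof -
    have "(\<integral>\<omega>. \<eta> \<omega> * N \<omega> \<partial>M) = (\<integral>\<omega>. \<eta> \<omega> * I \<omega> + \<eta> \<omega> * J \<omega> \<partial>M)"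
    proof (rule integral_cong_AE)
      have [measurable]: "\<eta> \<in> borel_measurable M" "N \<in> borel_measurable M" "I \<in> borel_measurable M" "J \<in> borel_measurable M"
        using that \<eta> by (auto simp: square_integrable_def)
      show "(\<lambda>\<omega>. \<eta> \<omega> * N \<omega>) \<in> borel_measurable M" "(\<lambda>\<omega>. \<eta> \<omega> * I \<omega> + \<eta> \<omega> * J \<omega>) \<in> borel_measurable M"
        by measurable
      show "AE \<omega> in M. \<eta> \<omega> * N \<omega> = \<eta> \<omega> * I \<omega> + \<eta> \<omega> * J \<omega>"
        using that(1) by eventually_elim (simp add: algebra_simps)
    qed
    then show ?thesis
      using square_integrable_mult[OF \<eta>(2) that(2)] square_integrable_mult[OF \<eta>(2) that(3)] by simp
  qed
  show ?thesis
    using eq[OF IJ(3) sq(1,2) martingale_part_measurable[OF Z t]]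
      eq[OF IJ'(3) sq(3,4) martingale_part_measurable[OF Z s]]
      ito_limit_martingale[OF bracket_noise(1) IJ(1) IJ'(1) st \<eta>]
      ito_limit_martingale[OF bracket_noise(2) IJ(2) IJ'(2) st \<eta>] by simp
qed

lemma martingale_part_isometry:
  assumes Z: "ito_process_L2 Z \<beta> \<gamma> t\<gamma>" and P: "ito_process_L2 P \<alpha> q tq" and t: "t \<in> {0..T}"
  shows "(\<integral>\<omega>. martingale_part Z \<beta> t \<omega> * martingale_part P \<alpha> t \<omega> \<partial>M)
    = process_inner t \<gamma> q + process_inner t t\<gamma> tq"
proof -
  obtain I J where IJ: "ito_limit W \<gamma> t I" "ito_limit tW t\<gamma> t J"
    "AE \<omega> in M. martingale_part Z \<beta> t \<omega> = I \<omega> + J \<omega>"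
    by (rule martingale_part_limits[OF Z t])
  obtain I' J' where IJ': "ito_limit W q t I'" "ito_limit tW tq t J'"
    "AE \<omega> in M. martingale_part P \<alpha> t \<omega> = I' \<omega> + J' \<omega>"
    by (rule martingale_part_limits[OF P t])
  have sq: "square_integrable M I" "square_integrable M J" "square_integrable M I'" "square_integrable M J'"
    using IJ IJ' by (auto simp: ito_limit_def)
  have "(\<integral>\<omega>. martingale_part Z \<beta> t \<omega> * martingale_part P \<alpha> t \<omega> \<partial>M)
      = (\<integral>\<omega>. (I \<omega> * I' \<omega> + I \<omega> * J' \<omega>) + (J \<omega> * I' \<omega> + J \<omega> * J' \<omega>) \<partial>M)"
  proof (rule integral_cong_AE)
    have [measurable]: "martingale_part Z \<beta> t \<in> borel_measurable M" "martingale_part P \<alpha> t \<in> borel_measurable M"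
        "I \<in> borel_measurable M" "J \<in> borel_measurable M" "I' \<in> borel_measurable M" "J' \<in> borel_measurable M"
      using sq martingale_part_measurable[OF Z t] martingale_part_measurable[OF P t] by (auto simp: square_integrable_def)
    show "(\<lambda>\<omega>. martingale_part Z \<beta> t \<omega> * martingale_part P \<alpha> t \<omega>) \<in> borel_measurable M"
      "(\<lambda>\<omega>. (I \<omega> * I' \<omega> + I \<omega> * J' \<omega>) + (J \<omega> * I' \<omega> + J \<omega> * J' \<omega>)) \<in> borel_measurable M"
      by measurable
    show "AE \<omega> in M. martingale_part Z \<beta> t \<omega> * martingale_part P \<alpha> t \<omega>
      = (I \<omega> * I' \<omega> + I \<omega> * J' \<omega>) + (J \<omega> * I' \<omega> + J \<omega> * J' \<omega>)"
      using IJ(3) IJ'(3) by eventually_elim (simp add: algebra_simps)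
  qed
  also have "\<dots> = ((\<integral>\<omega>. I \<omega> * I' \<omega> \<partial>M) + (\<integral>\<omega>. I \<omega> * J' \<omega> \<partial>M))
      + ((\<integral>\<omega>. J \<omega> * I' \<omega> \<partial>M) + (\<integral>\<omega>. J \<omega> * J' \<omega> \<partial>M))"
    using square_integrable_mult[OF sq(1,3)] square_integrable_mult[OF sq(1,4)]
      square_integrable_mult[OF sq(2,3)] square_integrable_mult[OF sq(2,4)] by simp
  also have "\<dots> = process_inner t \<gamma> q + process_inner t t\<gamma> tq"
    using ito_limit_isometry[OF bracket_noise(1) IJ(1) IJ'(1) t]
      ito_limit_isometry[OF bracket_noise(2) IJ(2) IJ'(2) t]
      ito_limit_isometry[OF bracket_noise(3) IJ(1) IJ'(2) t]
      ito_limit_isometry[OF bracket_noise(4) IJ(2) IJ'(1) t] by simp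
  finally show ?thesis .
qed

lemma ito_process_square_integrable:
  assumes "ito_process_L2 Z \<beta> \<gamma> t\<gamma>" "t \<in> {0..T}"
  shows "square_integrable M (Z t)"
proof -
  have "square_integrable M (\<lambda>\<omega>. (Z 0 \<omega> + drift \<beta> t \<omega>) + martingale_part Z \<beta> t \<omega>)"
    using assms martingale_part_square_integrable[OF assms] drift_square_integrable[OF ito_process_measurable(4)[OF assms]]
    by (intro square_integrable_add) (auto simp: ito_process_L2_def)
  then show ?thesis by (simp add: martingale_part_def)
qed

lemma process_L2_of_bounded_moments:
  assumes m: "(\<lambda>z. X (fst z) (snd z)) \<in> borel_measurable (prod_upto T)"
    and b: "\<And>t. t \<in> {0..T} \<Longrightarrow> (\<integral>\<^sup>+\<omega>. ennreal ((X t \<omega>)\<^sup>2) \<partial>M) \<le> C" and C: "C < \<infinity>"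
  shows "process_L2 T X"
proof -
  interpret A: finite_measure "time_upto T" by (rule finite_measure_time_upto)
  have fin: "emeasure (time_upto T) {0..T} < \<top>"
    using A.emeasure_finite[of "{0..T}"] unfolding less_top infinity_ennreal_def .
  have "(\<integral>\<^sup>+z. ennreal ((X (fst z) (snd z))\<^sup>2) \<partial>prod_upto T) = (\<integral>\<^sup>+s. \<integral>\<^sup>+\<omega>. ennreal ((X s \<omega>)\<^sup>2) \<partial>M \<partial>time_upto T)"
    using m by (subst nn_integral_fst[symmetric]) auto
  also have "\<dots> \<le> (\<integral>\<^sup>+s. C \<partial>time_upto T)"
    using b by (intro nn_integral_mono) simp
  also have "\<dots> < \<infinity>" using C fin by (simp add: ennreal_mult_less_top)
  finally show ?thesis by (subst square_integrable_iff_nn_integral[OF m])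
qed

lemma martingale_part_process_L2:
  assumes Z: "ito_process_L2 Z \<beta> \<gamma> t\<gamma>"
  shows "process_L2 T (martingale_part Z \<beta>)"
proof -
  note \<gamma> = ito_process_diffusion_L2[OF Z]
  have [measurable]: "(\<lambda>z. Z (fst z) (snd z)) \<in> borel_measurable (prod_upto T)"
     "Z 0 \<in> borel_measurable M" "(\<lambda>z. drift \<beta> (fst z) (snd z)) \<in> borel_measurable (prod_upto T)"
    using ito_process_measurable(5,7)[OF Z] T_pos square_integrable_measurable[OF drift_process_L2[OF ito_process_measurable(3)[OF Z]]]
    by auto
  have m: "(\<lambda>z. martingale_part Z \<beta> (fst z) (snd z)) \<in> borel_measurable (prod_upto T)"
    unfolding martingale_part_def by measurable
  define C where "C = (\<integral>\<^sup>+z. ennreal ((\<gamma> (fst z) (snd z))\<^sup>2) \<partial>prod_upto T) + (\<integral>\<^sup>+z. ennreal ((t\<gamma> (fst z) (snd z))\<^sup>2) \<partial>prod_upto T)"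
  have C: "C < \<top>"
    using \<gamma> square_integrable_iff_nn_integral[OF square_integrable_measurable[OF \<gamma>(1)]]
      square_integrable_iff_nn_integral[OF square_integrable_measurable[OF \<gamma>(2)]]
    by (simp add: C_def)
  have mono: "(\<integral>\<^sup>+z. ennreal ((\<delta> (fst z) (snd z))\<^sup>2) \<partial>prod_upto s) \<le> (\<integral>\<^sup>+z. ennreal ((\<delta> (fst z) (snd z))\<^sup>2) \<partial>prod_upto T)"
    if "process_L2 T \<delta>" "s \<le> T" for \<delta> s
  proof -
    have "(\<lambda>z. ennreal ((\<delta> (fst z) (snd z))\<^sup>2)) \<in> borel_measurable (prod_upto T)"
      using square_integrable_measurable[OF that(1)] by measurable
    from nn_integral_prod_upto_mono[of "\<lambda>s \<omega>. ennreal ((\<delta> s \<omega>)\<^sup>2)", OF this that(2)] show ?thesis .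
  qed
  have bound: "(\<integral>\<^sup>+\<omega>. ennreal ((martingale_part Z \<beta> s \<omega>)\<^sup>2) \<partial>M) \<le> C" if s: "s \<in> {0..T}" for s
  proof -
    have sT: "s \<le> T" using s by simp
    have "(\<integral>\<^sup>+\<omega>. ennreal ((martingale_part Z \<beta> s \<omega>)\<^sup>2) \<partial>M)
        = ennreal ((\<integral>z. (\<gamma> (fst z) (snd z))\<^sup>2 \<partial>prod_upto s) + (\<integral>z. (t\<gamma> (fst z) (snd z))\<^sup>2 \<partial>prod_upto s))"
      using nn_integral_square_eq[OF martingale_part_square_integrable[OF Z s]] martingale_part_isometry[OF Z Z s]
      by (simp add: power2_eq_square)
    also have "\<dots> = (\<integral>\<^sup>+z. ennreal ((\<gamma> (fst z) (snd z))\<^sup>2) \<partial>prod_upto s) + (\<integral>\<^sup>+z. ennreal ((t\<gamma> (fst z) (snd z))\<^sup>2) \<partial>prod_upto s)"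
      using nn_integral_square_eq[OF process_L2_mono[OF \<gamma>(1) sT]] nn_integral_square_eq[OF process_L2_mono[OF \<gamma>(2) sT]]
      by (simp add: ennreal_plus)
    also have "\<dots> \<le> C"
      unfolding C_def by (intro add_mono mono \<gamma> sT)
    finally show ?thesis .
  qed
  show ?thesis
    using process_L2_of_bounded_moments[OF m bound] C by simp
qed

lemma ito_process_process_L2:
  assumes Z: "ito_process_L2 Z \<beta> \<gamma> t\<gamma>"
  shows "process_L2 T Z"
proof -
  have "process_L2 T (\<lambda>s \<omega>. (Z 0 \<omega> + drift \<beta> s \<omega>) + martingale_part Z \<beta> s \<omega>)"
    using Z by (intro square_integrable_add martingale_part_process_L2[OF Z] drift_process_L2
        ito_process_measurable(3)[OF Z] process_L2_time_constant) (auto simp: ito_process_L2_def)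
  then show ?thesis by (simp add: martingale_part_def)
qed

text \<open>The integrand \<open>\<alpha>\<^sub>s\<close> is known at time \<open>s\<close>, so it does not see the martingale after \<open>s\<close>.\<close>

lemma process_inner_martingale_part:
  assumes \<alpha>: "\<alpha> \<in> L2_prog M T F" and Z: "ito_process_L2 Z \<beta> \<gamma> t\<gamma>" and t: "t \<in> {0..T}"
  shows "process_inner t \<alpha> (\<lambda>_. martingale_part Z \<beta> t) = process_inner t \<alpha> (martingale_part Z \<beta>)"
proof -
  interpret P: pair_sigma_finite "time_upto t" M by (rule pair_sigma_finite_prod_upto)
  have tT: "t \<le> T" using t by simp
  have \<alpha>L: "process_L2 t \<alpha>" and ad: "\<And>s. s \<in> {0..T} \<Longrightarrow> \<alpha> s \<in> borel_measurable (F s)"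
    using \<alpha> process_L2_mono[OF _ tT] by (auto simp: L2_prog_iff intro: progressive_adapted)
  have i1: "integrable (prod_upto t) (\<lambda>(s, \<omega>). \<alpha> s \<omega> * martingale_part Z \<beta> t \<omega>)"
    using square_integrable_mult[OF \<alpha>L process_L2_time_constant[OF martingale_part_square_integrable[OF Z t]]]
    by (simp add: split_beta')
  have i2: "integrable (prod_upto t) (\<lambda>(s, \<omega>). \<alpha> s \<omega> * martingale_part Z \<beta> s \<omega>)"
    using square_integrable_mult[OF \<alpha>L process_L2_mono[OF martingale_part_process_L2[OF Z] tT]]
    by (simp add: split_beta')
  have "(\<integral>s. \<integral>\<omega>. \<alpha> s \<omega> * martingale_part Z \<beta> t \<omega> \<partial>M \<partial>time_upto t)
      = (\<integral>s. \<integral>\<omega>. \<alpha> s \<omega> * martingale_part Z \<beta> s \<omega> \<partial>M \<partial>time_upto t)"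
  proof (rule integral_cong_AE)
    show "AE s in time_upto t. (\<integral>\<omega>. \<alpha> s \<omega> * martingale_part Z \<beta> t \<omega> \<partial>M) = (\<integral>\<omega>. \<alpha> s \<omega> * martingale_part Z \<beta> s \<omega> \<partial>M)"
      using process_L2_sections(2)[OF \<alpha>L] AE_space[of "time_upto t"]
    proof eventually_elim
      case (elim s)
      then have "s \<in> {0..T}" "0 \<le> s" "s \<le> t" using t by auto
      then show ?case by (intro martingale_part_martingale[OF Z] tT ad elim(1))
    qed
  qed (use P.integrable_fst[OF i1] P.integrable_fst[OF i2] in \<open>auto dest: borel_measurable_integrable\<close>)
  then show ?thesis
    using P.integral_fst[OF i1] P.integral_fst[OF i2] by (simp add: split_beta')
qed

lemma integral_drift_product:
  assumes \<beta>: "process_L2 t \<beta>" and \<alpha>: "process_L2 t \<alpha>"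
  shows "(\<integral>\<omega>. drift \<beta> t \<omega> * drift \<alpha> t \<omega> \<partial>M) = process_inner t \<beta> (drift \<alpha>) + process_inner t (drift \<beta>) \<alpha>"
proof -
  interpret A: finite_measure "time_upto t" by (rule finite_measure_time_upto)
  interpret P: pair_sigma_finite "time_upto t" M by (rule pair_sigma_finite_prod_upto)
  have i1: "integrable (prod_upto t) (\<lambda>z. \<beta> (fst z) (snd z) * drift \<alpha> (fst z) (snd z))"
    and i2: "integrable (prod_upto t) (\<lambda>z. drift \<beta> (fst z) (snd z) * \<alpha> (fst z) (snd z))"
    using square_integrable_mult[OF \<beta> drift_process_L2[OF \<alpha>]] square_integrable_mult[OF drift_process_L2[OF \<beta>] \<alpha>] by auto
  have i: "integrable (prod_upto t) (case_prod (\<lambda>s \<omega>. \<beta> s \<omega> * drift \<alpha> s \<omega> + drift \<beta> s \<omega> * \<alpha> s \<omega>))"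
    using i1 i2 by (simp add: split_beta')
  have "(\<integral>\<omega>. drift \<beta> t \<omega> * drift \<alpha> t \<omega> \<partial>M)
    = (\<integral>\<omega>. \<integral>s. \<beta> s \<omega> * drift \<alpha> s \<omega> + drift \<beta> s \<omega> * \<alpha> s \<omega> \<partial>time_upto t \<partial>M)"
  proof (rule integral_cong_AE)
    show "(\<lambda>\<omega>. drift \<beta> t \<omega> * drift \<alpha> t \<omega>) \<in> borel_measurable M"
      using drift_square_integrable[OF \<beta>] drift_square_integrable[OF \<alpha>]
      by (auto simp: square_integrable_def)
    show "(\<lambda>\<omega>. \<integral>s. \<beta> s \<omega> * drift \<alpha> s \<omega> + drift \<beta> s \<omega> * \<alpha> s \<omega> \<partial>time_upto t) \<in> borel_measurable M"
      using P.integrable_snd[OF i] by (rule borel_measurable_integrable)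
    show "AE \<omega> in M. drift \<beta> t \<omega> * drift \<alpha> t \<omega> = (\<integral>s. \<beta> s \<omega> * drift \<alpha> s \<omega> + drift \<beta> s \<omega> * \<alpha> s \<omega> \<partial>time_upto t)"
      using process_L2_sections(1)[OF \<beta>] process_L2_sections(1)[OF \<alpha>]
    proof eventually_elim
      case (elim \<omega>)
      show ?case
        unfolding drift_def
        by (rule integral_time_upto_product[OF A.square_integrable_imp_integrable[OF elim(1)]
            A.square_integrable_imp_integrable[OF elim(2)]])
    qed
  qed
  also have "\<dots> = (\<integral>z. \<beta> (fst z) (snd z) * drift \<alpha> (fst z) (snd z) + drift \<beta> (fst z) (snd z) * \<alpha> (fst z) (snd z) \<partial>prod_upto t)"
    using P.integral_snd[OF i] by (simp add: split_beta')
  also have "\<dots> = process_inner t \<beta> (drift \<alpha>) + process_inner t (drift \<beta>) \<alpha>"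
    using i1 i2 by simp
  finally show ?thesis .
qed

lemma process_inner_commute: "process_inner t \<gamma> \<delta> = process_inner t \<delta> \<gamma>"
  by (simp add: mult.commute)

text \<open>
  Both processes are split into initial value, drift and martingale part, \<open>Z = Z\<^sub>0 + A + N\<close> and
  \<open>P = P\<^sub>0 + B + K\<close>.  At time \<open>t\<close> the initial values are orthogonal to the martingale parts, \<open>N\<^sub>t K\<^sub>t\<close> is given
  by the isometry, \<open>A\<^sub>t B\<^sub>t\<close> by the product rule along paths, and in \<open>A\<^sub>t K\<^sub>t = \<integral> \<beta>\<^sub>s K\<^sub>t ds\<close> the martingale
  property replaces \<open>K\<^sub>t\<close> by \<open>K\<^sub>s\<close>.  Collecting the terms with \<open>\<beta>\<close> gives \<open>\<beta> P\<close>, those with \<open>\<alpha>\<close> give \<open>Z \<alpha>\<close>.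
\<close>

theorem ito_product_expectation:
  assumes Z: "ito_process_L2 Z \<beta> \<gamma> t\<gamma>" and P: "ito_process_L2 P \<alpha> q tq" and t: "t \<in> {0..T}"
  shows "(\<integral>\<omega>. Z t \<omega> * P t \<omega> \<partial>M) = (\<integral>\<omega>. Z 0 \<omega> * P 0 \<omega> \<partial>M)
    + process_inner t \<beta> P + process_inner t Z \<alpha> + process_inner t \<gamma> q + process_inner t t\<gamma> tq"
proof -
  have tT: "t \<le> T" and zero: "0 \<in> {0..T}" using t T_pos by auto
  define N where "N = martingale_part Z \<beta>"
  define K where "K = martingale_part P \<alpha>"
  define A where "A = drift \<beta>"
  define B where "B = drift \<alpha>"
  have Zeq: "Z s = (\<lambda>\<omega>. Z 0 \<omega> + A s \<omega> + N s \<omega>)" for s by (auto simp: N_def A_def martingale_part_def)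
  have Peq: "P s = (\<lambda>\<omega>. P 0 \<omega> + B s \<omega> + K s \<omega>)" for s by (auto simp: K_def B_def martingale_part_def)
  note \<beta> = ito_process_measurable(4)[OF Z t] and \<alpha> = ito_process_measurable(4)[OF P t]
  have sqM: "square_integrable M (Z 0)" "square_integrable M (P 0)" "square_integrable M (A t)" "square_integrable M (B t)"
      "square_integrable M (N t)" "square_integrable M (K t)"
    unfolding A_def B_def N_def K_def
    using ito_process_square_integrable[OF Z zero] ito_process_square_integrable[OF P zero]
      drift_square_integrable[OF \<beta>] drift_square_integrable[OF \<alpha>]
      martingale_part_square_integrable[OF Z t] martingale_part_square_integrable[OF P t] by auto
  have sqP: "process_L2 t (\<lambda>_. Z 0)" "process_L2 t (\<lambda>_. P 0)" "process_L2 t A" "process_L2 t B"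
      "process_L2 t N" "process_L2 t K"
    unfolding A_def B_def N_def K_def
    by (intro process_L2_time_constant sqM drift_process_L2 \<alpha> \<beta> process_L2_mono[OF martingale_part_process_L2[OF Z] tT]
      process_L2_mono[OF martingale_part_process_L2[OF P] tT])+
  note m = square_integrable_mult
  \<comment> \<open>the nine terms of the product of \<open>Z\<^sub>0 + A + N\<close> and \<open>P\<^sub>0 + B + K\<close> at time \<open>t\<close>\<close>
  have mart0: "(\<integral>\<omega>. Z 0 \<omega> * K t \<omega> \<partial>M) = 0" "(\<integral>\<omega>. P 0 \<omega> * N t \<omega> \<partial>M) = 0"
    using martingale_part_martingale[OF P _ _ tT ito_process_measurable(6)[OF Z zero] sqM(1)]
      martingale_part_martingale[OF Z _ _ tT ito_process_measurable(6)[OF P zero] sqM(2)] t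
    by (simp_all add: martingale_part_0 N_def K_def)
  have drift0: "(\<integral>\<omega>. Z 0 \<omega> * B t \<omega> \<partial>M) = process_inner t (\<lambda>_. Z 0) \<alpha>"
      "(\<integral>\<omega>. P 0 \<omega> * A t \<omega> \<partial>M) = process_inner t \<beta> (\<lambda>_. P 0)"
    using integral_mult_drift[OF \<alpha> sqM(1)] integral_mult_drift[OF \<beta> sqM(2)]
    by (simp_all add: A_def B_def mult.commute[of "P 0 _"])
  have AK: "(\<integral>\<omega>. K t \<omega> * A t \<omega> \<partial>M) = process_inner t \<beta> K"
    using integral_mult_drift[OF \<beta> sqM(6)] process_inner_martingale_part[OF _ P t, of \<beta>] Z
    by (simp add: A_def K_def ito_process_L2_def mult.commute[of "martingale_part P \<alpha> t _"])
  have NB: "(\<integral>\<omega>. N t \<omega> * B t \<omega> \<partial>M) = process_inner t N \<alpha>"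
    using integral_mult_drift[OF \<alpha> sqM(5)] process_inner_martingale_part[OF _ Z t, of \<alpha>] P
    by (simp add: B_def N_def ito_process_L2_def mult.commute[of "martingale_part Z \<beta> _ _"])
  have AB: "(\<integral>\<omega>. A t \<omega> * B t \<omega> \<partial>M) = process_inner t \<beta> B + process_inner t A \<alpha>"
    unfolding A_def B_def by (rule integral_drift_product[OF \<beta> \<alpha>])
  have NK: "(\<integral>\<omega>. N t \<omega> * K t \<omega> \<partial>M) = process_inner t \<gamma> q + process_inner t t\<gamma> tq"
    unfolding N_def K_def by (rule martingale_part_isometry[OF Z P t])
  have "process_inner t \<beta> P = (\<integral>z. \<beta> (fst z) (snd z) * P 0 (snd z) + \<beta> (fst z) (snd z) * B (fst z) (snd z)
      + \<beta> (fst z) (snd z) * K (fst z) (snd z) \<partial>prod_upto t)"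
    by (intro Bochner_Integration.integral_cong refl) (subst Peq, simp add: algebra_simps)
  also have "\<dots> = process_inner t \<beta> (\<lambda>_. P 0) + process_inner t \<beta> B + process_inner t \<beta> K"
    using m[OF \<beta> sqP(2)] m[OF \<beta> sqP(4)] m[OF \<beta> sqP(6)] by simp
  finally have \<beta>P: "process_inner t \<beta> P = process_inner t \<beta> (\<lambda>_. P 0) + process_inner t \<beta> B + process_inner t \<beta> K" .
  have "process_inner t Z \<alpha> = (\<integral>z. Z 0 (snd z) * \<alpha> (fst z) (snd z) + A (fst z) (snd z) * \<alpha> (fst z) (snd z)
      + N (fst z) (snd z) * \<alpha> (fst z) (snd z) \<partial>prod_upto t)"
    by (intro Bochner_Integration.integral_cong refl) (subst Zeq, simp add: algebra_simps)
  also have "\<dots> = process_inner t (\<lambda>_. Z 0) \<alpha> + process_inner t A \<alpha> + process_inner t N \<alpha>"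
    using m[OF sqP(1) \<alpha>] m[OF sqP(3) \<alpha>] m[OF sqP(5) \<alpha>] by simp
  finally have Z\<alpha>: "process_inner t Z \<alpha> = process_inner t (\<lambda>_. Z 0) \<alpha> + process_inner t A \<alpha> + process_inner t N \<alpha>" .
  have "(\<integral>\<omega>. Z t \<omega> * P t \<omega> \<partial>M) = (\<integral>\<omega>. Z 0 \<omega> * P 0 \<omega> + Z 0 \<omega> * B t \<omega> + Z 0 \<omega> * K t \<omega>
      + P 0 \<omega> * A t \<omega> + A t \<omega> * B t \<omega> + K t \<omega> * A t \<omega> + P 0 \<omega> * N t \<omega> + N t \<omega> * B t \<omega> + N t \<omega> * K t \<omega> \<partial>M)"
    by (intro Bochner_Integration.integral_cong refl) (subst Zeq, subst Peq, simp add: algebra_simps)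
  also have "\<dots> = (\<integral>\<omega>. Z 0 \<omega> * P 0 \<omega> \<partial>M) + (\<integral>\<omega>. Z 0 \<omega> * B t \<omega> \<partial>M) + (\<integral>\<omega>. Z 0 \<omega> * K t \<omega> \<partial>M)
      + (\<integral>\<omega>. P 0 \<omega> * A t \<omega> \<partial>M) + (\<integral>\<omega>. A t \<omega> * B t \<omega> \<partial>M) + (\<integral>\<omega>. K t \<omega> * A t \<omega> \<partial>M)
      + (\<integral>\<omega>. P 0 \<omega> * N t \<omega> \<partial>M) + (\<integral>\<omega>. N t \<omega> * B t \<omega> \<partial>M) + (\<integral>\<omega>. N t \<omega> * K t \<omega> \<partial>M)"
    using m[OF sqM(1,2)] m[OF sqM(1,4)] m[OF sqM(1,6)] m[OF sqM(2,3)] m[OF sqM(3,4)] m[OF sqM(6,3)]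
      m[OF sqM(2,5)] m[OF sqM(5,4)] m[OF sqM(5,6)] by simp
  finally show ?thesis
    by (simp add: mart0 drift0 AK NB AB NK \<beta>P Z\<alpha>)
qed

end

section \<open>Coefficients and the minimiser of the Hamiltonian\<close>

text \<open>The derivative is the pointwise limit of the difference quotients with step \<open>1 / (n + 1)\<close>.\<close>

lemma measurable_deriv:
  fixes \<phi> :: "'b \<Rightarrow> real \<Rightarrow> real"
  assumes m: "\<And>h. (\<lambda>z. \<phi> z (x z + h)) \<in> borel_measurable N"
    and d: "\<And>z. z \<in> space N \<Longrightarrow> (\<phi> z) differentiable (at (x z))"
  shows "(\<lambda>z. deriv (\<phi> z) (x z)) \<in> borel_measurable N"
proof (rule borel_measurable_LIMSEQ_real)
  fix z assume z: "z \<in> space N"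
  have "DERIV (\<phi> z) (x z) :> deriv (\<phi> z) (x z)"
    using d[OF z] by (simp add: DERIV_deriv_iff_real_differentiable)
  then have "((\<lambda>h. (\<phi> z (x z + h) - \<phi> z (x z)) / h) \<longlongrightarrow> deriv (\<phi> z) (x z)) (at 0)"
    by (simp add: DERIV_def)
  moreover have "filterlim (\<lambda>n. inverse (real (Suc n))) (at 0) sequentially"
    using LIMSEQ_inverse_real_of_nat by (simp add: filterlim_at)
  ultimately show "(\<lambda>n. (\<phi> z (x z + inverse (real (Suc n))) - \<phi> z (x z)) / inverse (real (Suc n)))
      \<longlonglongrightarrow> deriv (\<phi> z) (x z)"
    by (rule filterlim_compose)
next
  fix n
  show "(\<lambda>z. (\<phi> z (x z + inverse (real (Suc n))) - \<phi> z (x z)) / inverse (real (Suc n))) \<in> borel_measurable N"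
    using m[of "inverse (real (Suc n))"] m[of 0] by simp
qed

lemma monotone_deriv_above_tangent:
  fixes f :: "real \<Rightarrow> real"
  assumes d: "\<And>x. f differentiable (at x)"
    and mono: "\<And>x x'. (deriv f x' - deriv f x) * (x' - x) \<ge> 0"
  shows "f x' - f x \<ge> deriv f x * (x' - x)"
proof -
  have D: "DERIV f x :> deriv f x" for x
    using d by (simp add: DERIV_deriv_iff_real_differentiable)
  have "deriv f y \<le> deriv f y'" if "y \<le> y'" for y y'
    using mono[of y' y] that by (cases "y = y'") (auto simp: zero_le_mult_iff)
  then have "convex_on UNIV f"
    by (intro convex_on_realI[where f' = "deriv f"] D) auto
  from convex_on_imp_above_tangent[OF this, of x x' "deriv f x"] D[of x] show ?thesis
    by simp
qed

lemma dirac_P2: "return borel 0 \<in> P2" "second_moment (return borel 0) = 0"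
proof -
  have "integrable (return borel 0) (\<lambda>x::real. x\<^sup>2)"
    by (subst integrable_iff_bounded) (simp add: nn_integral_return)
  then show "return borel 0 \<in> P2"
    by (simp add: P2_def space_prob_algebra prob_space_return)
  show "second_moment (return borel 0) = 0"
    by (simp add: second_moment_def integral_return)
qed

lemma space_P2_algebra: "space P2_algebra = P2"
  by (auto simp: P2_algebra_def space_restrict_space P2_def)

lemma second_moment_nonneg: "0 \<le> second_moment m"
  by (simp add: second_moment_def)

text \<open>The hypotheses on the data, with the affine coefficients of \<open>b\<close>, \<open>\<sigma>\<close>, \<open>t\<sigma>\<close> named.\<close>

locale mfg_coefficients =
  fixes T L :: real and b \<sigma> t\<sigma> f :: coeff and g :: "real \<Rightarrow> real measure \<Rightarrow> real"
    and f0 :: "real \<Rightarrow> real \<Rightarrow> real \<Rightarrow> real" and f1 :: "real \<Rightarrow> real \<Rightarrow> real measure \<Rightarrow> real"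
    and b0 \<sigma>0 t\<sigma>0 :: "real \<Rightarrow> real measure \<Rightarrow> real" and b1 b2 \<sigma>1 \<sigma>2 t\<sigma>1 t\<sigma>2 :: "real \<Rightarrow> real"
  assumes L_pos: "0 < L"
    and measurable_b: "measurable_coeff T b" and measurable_f: "measurable_coeff T f"
    and measurable_g: "(\<lambda>(x, m). g x m) \<in> borel_measurable (borel \<Otimes>\<^sub>M P2_algebra)"
    and affine: "affine_coeff T L b b0 b1 b2" "affine_coeff T L \<sigma> \<sigma>0 \<sigma>1 \<sigma>2" "affine_coeff T L t\<sigma> t\<sigma>0 t\<sigma>1 t\<sigma>2"
    and growth: "H2 T L f g" and split_cost: "H3 T L f f0 f1 g" and convexity: "H4 T f0 f1 g"
begin

abbreviation fx :: "real \<Rightarrow> real \<Rightarrow> real \<Rightarrow> real measure \<Rightarrow> real" where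
  "fx t x u m \<equiv> deriv (\<lambda>x. f t x u m) x"

abbreviation fu :: "real \<Rightarrow> real \<Rightarrow> real \<Rightarrow> real measure \<Rightarrow> real" where
  "fu t x u m \<equiv> deriv (\<lambda>u. f t x u m) u"

abbreviation gx :: "real \<Rightarrow> real measure \<Rightarrow> real" where
  "gx x m \<equiv> deriv (\<lambda>x. g x m) x"

abbreviation f0u :: "real \<Rightarrow> real \<Rightarrow> real \<Rightarrow> real" where
  "f0u t x u \<equiv> deriv (\<lambda>u. f0 t x u) u"

text \<open>The derivative in the control of the part \<open>b p + \<sigma> q + t\<sigma> tq\<close> of the Hamiltonian.\<close>

abbreviation control_slope :: "real \<Rightarrow> real \<Rightarrow> real \<Rightarrow> real \<Rightarrow> real" where
  "control_slope t p q tq \<equiv> b2 t * p + \<sigma>2 t * q + t\<sigma>2 t * tq"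

lemma f0_DERIV:
  assumes "t \<in> {0..T}"
  shows "DERIV (\<lambda>x. f0 t x u) x :> deriv (\<lambda>x. f0 t x u) x" "DERIV (\<lambda>u. f0 t x u) u :> f0u t x u"
proof -
  have d: "(\<lambda>(x, u). f0 t x u) differentiable (at (x, u))"
    using split_cost assms by (auto simp: H3_def)
  have "((\<lambda>(x, u). f0 t x u) \<circ> (\<lambda>x. (x, u))) differentiable (at x)"
    by (rule differentiable_chain_at) (use d in \<open>auto simp: differentiable_def intro!: has_derivative_Pair derivative_eq_intros\<close>)
  then show "DERIV (\<lambda>x. f0 t x u) x :> deriv (\<lambda>x. f0 t x u) x"
    by (simp add: DERIV_deriv_iff_real_differentiable o_def)
  have "((\<lambda>(x, u). f0 t x u) \<circ> (\<lambda>u. (x, u))) differentiable (at u)"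
    by (rule differentiable_chain_at) (use d in \<open>auto simp: differentiable_def intro!: has_derivative_Pair derivative_eq_intros\<close>)
  then show "DERIV (\<lambda>u. f0 t x u) u :> f0u t x u"
    by (simp add: DERIV_deriv_iff_real_differentiable o_def)
qed

lemma f_DERIV:
  assumes t: "t \<in> {0..T}" and m: "m \<in> P2"
  shows "DERIV (\<lambda>x. f t x u m) x :> deriv (\<lambda>x. f0 t x u) x + deriv (\<lambda>x. f1 t x m) x"
    and "DERIV (\<lambda>u. f t x u m) u :> f0u t x u"
proof -
  have f: "(\<lambda>x. f t x u m) = (\<lambda>x. f0 t x u + f1 t x m)" "(\<lambda>u. f t x u m) = (\<lambda>u. f0 t x u + f1 t x m)" for x u
    using split_cost t m by (auto simp: H3_def)
  have "DERIV (\<lambda>x. f1 t x m) x :> deriv (\<lambda>x. f1 t x m) x"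
    using split_cost t m by (auto simp: H3_def DERIV_deriv_iff_real_differentiable)
  with f0_DERIV[OF t] show "DERIV (\<lambda>x. f t x u m) x :> deriv (\<lambda>x. f0 t x u) x + deriv (\<lambda>x. f1 t x m) x"
    unfolding f by (intro DERIV_add)
  show "DERIV (\<lambda>u. f t x u m) u :> f0u t x u"
    unfolding f using DERIV_add[OF f0_DERIV(2)[OF t] DERIV_const] by simp
qed

lemma f_partials:
  assumes "t \<in> {0..T}" "m \<in> P2"
  shows "fx t x u m = deriv (\<lambda>x. f0 t x u) x + deriv (\<lambda>x. f1 t x m) x" "fu t x u m = f0u t x u"
    "(\<lambda>x. f t x u m) differentiable (at x)" "(\<lambda>u. f t x u m) differentiable (at u)"
  using f_DERIV[OF assms] DERIV_imp_deriv real_differentiable_def by blast+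

lemma f_above_tangent:
  assumes t: "t \<in> {0..T}" and m: "m \<in> P2"
  shows "f t x' u' m - f t x u m \<ge> fx t x u m * (x' - x) + fu t x u m * (u' - u)"
proof -
  have f: "f t x u m = f0 t x u + f1 t x m" for x u
    using split_cost t m by (auto simp: H3_def)
  obtain C where "C > 0" and "f0 t x' u' - f0 t x u
      - (deriv (\<lambda>x. f0 t x u) x * (x' - x) + f0u t x u * (u' - u)) \<ge> C * \<bar>u' - u\<bar>\<^sup>2"
    using convexity t by (auto simp: H4_def)
  moreover have "0 \<le> C * \<bar>u' - u\<bar>\<^sup>2" using \<open>C > 0\<close> by simp
  moreover have "f1 t x' m - f1 t x m \<ge> deriv (\<lambda>x. f1 t x m) x * (x' - x)"
    using split_cost convexity t m by (intro monotone_deriv_above_tangent) (auto simp: H3_def H4_def)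
  moreover have "f t x' u' m = f0 t x' u' + f1 t x' m" "f t x u m = f0 t x u + f1 t x m" by (rule f)+
  ultimately show ?thesis
    unfolding f_partials(1,2)[OF t m] distrib_right by linarith
qed

lemma g_above_tangent:
  assumes "m \<in> P2"
  shows "g x' m - g x m \<ge> gx x m * (x' - x)"
  using growth convexity assms by (intro monotone_deriv_above_tangent) (auto simp: H2_def H4_def)

lemma partials_bound:
  assumes "t \<in> {0..T}" "m \<in> P2"
  shows "\<bar>fx t x u m\<bar> \<le> L * (1 + \<bar>x\<bar> + \<bar>u\<bar> + sqrt (second_moment m))"
    "\<bar>fu t x u m\<bar> \<le> L * (1 + \<bar>x\<bar> + \<bar>u\<bar> + sqrt (second_moment m))"
    "\<bar>gx x m\<bar> \<le> L * (1 + \<bar>x\<bar> + \<bar>u\<bar> + sqrt (second_moment m))"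
  using growth assms unfolding H2_def by auto

text \<open>
  Convexity bounds \<open>f\<close> from below by its tangent at the origin and \<open>f(0, 0)\<close> from below by the tangent at
  \<open>(x, u)\<close>.  The bound is a square plus a product of two linear terms, so it is integrable as soon as
  state, control and \<open>sqrt (second_moment m)\<close> are square-integrable.
\<close>

lemma f_growth:
  assumes t: "t \<in> {0..T}" and m: "m \<in> P2"
  shows "\<bar>f t x u m\<bar> \<le> L * (1 + (sqrt (second_moment m))\<^sup>2)
    + L * (1 + \<bar>x\<bar> + \<bar>u\<bar> + sqrt (second_moment m)) * (\<bar>x\<bar> + \<bar>u\<bar>)"
proof -
  define s where "s = sqrt (second_moment m)"
  define B where "B = L * (1 + \<bar>x\<bar> + \<bar>u\<bar> + s)"
  have s: "0 \<le> s" "s\<^sup>2 = second_moment m" by (auto simp: s_def second_moment_nonneg)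
  have c: "\<bar>f t 0 0 m\<bar> \<le> L * (1 + s\<^sup>2)"
    using growth t m unfolding H2_def s by auto
  have le: "L * (1 + \<bar>0\<bar> + \<bar>0\<bar> + s) \<le> B"
    unfolding B_def using L_pos by (intro mult_left_mono) auto
  have d: "\<bar>fx t x u m\<bar> \<le> B" "\<bar>fu t x u m\<bar> \<le> B" "\<bar>fx t 0 0 m\<bar> \<le> B" "\<bar>fu t 0 0 m\<bar> \<le> B"
    using partials_bound(1,2)[OF t m, where x = x and u = u] partials_bound(1,2)[OF t m, where x = 0 and u = 0] le
    unfolding B_def s_def by linarith+
  have mult: "\<bar>k * y\<bar> \<le> B * \<bar>y\<bar>" if "\<bar>k\<bar> \<le> B" for k y
    using that by (auto simp: abs_mult intro: mult_right_mono)
  have "f t x u m - f t 0 0 m \<ge> fx t 0 0 m * x + fu t 0 0 m * u"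
    "f t 0 0 m - f t x u m \<ge> - (fx t x u m * x) - fu t x u m * u"
    using f_above_tangent[OF t m, where x = 0 and u = 0 and x' = x and u' = u]
      f_above_tangent[OF t m, where x = x and u = u and x' = 0 and u' = 0] by simp_all
  then have "\<bar>f t x u m\<bar> \<le> L * (1 + s\<^sup>2) + B * \<bar>x\<bar> + B * \<bar>u\<bar>"
    using c mult[OF d(1), of x] mult[OF d(2), of u] mult[OF d(3), of x] mult[OF d(4), of u] by linarith
  then show ?thesis by (simp add: B_def s_def algebra_simps)
qed

lemma g_growth:
  assumes m: "m \<in> P2" and T: "0 \<le> T"
  shows "\<bar>g x m\<bar> \<le> L * (1 + (sqrt (second_moment m))\<^sup>2) + L * (1 + \<bar>x\<bar> + sqrt (second_moment m)) * \<bar>x\<bar>"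
proof -
  have t: "0 \<in> {0..T}" using T by simp
  define s where "s = sqrt (second_moment m)"
  define B where "B = L * (1 + \<bar>x\<bar> + s)"
  have s: "0 \<le> s" "s\<^sup>2 = second_moment m" by (auto simp: s_def second_moment_nonneg)
  have c: "\<bar>g 0 m\<bar> \<le> L * (1 + s\<^sup>2)"
    using growth t m unfolding H2_def s by auto
  have le: "L * (1 + \<bar>0\<bar> + \<bar>0\<bar> + s) \<le> B"
    unfolding B_def using L_pos by (intro mult_left_mono) auto
  have d: "\<bar>gx x m\<bar> \<le> B" "\<bar>gx 0 m\<bar> \<le> B"
    using partials_bound(3)[OF t m, of x 0] partials_bound(3)[OF t m, of 0 0] le
    unfolding B_def s_def by simp_all
  have mult: "\<bar>k * y\<bar> \<le> B * \<bar>y\<bar>" if "\<bar>k\<bar> \<le> B" for k y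
    using that by (auto simp: abs_mult intro: mult_right_mono)
  have "g x m - g 0 m \<ge> gx 0 m * x" "g 0 m - g x m \<ge> - (gx x m * x)"
    using g_above_tangent[OF m, where x = 0 and x' = x] g_above_tangent[OF m, where x = x and x' = 0] by simp_all
  then show ?thesis
    using c mult[OF d(1), of x] mult[OF d(2), of x] unfolding B_def s_def by linarith
qed

lemma f0u_strongly_monotone:
  obtains C where "C > 0" "\<And>t x u u'. t \<in> {0..T} \<Longrightarrow> (f0u t x u' - f0u t x u) * (u' - u) \<ge> C * (u' - u)\<^sup>2"
    "\<And>t x u u'. t \<in> {0..T} \<Longrightarrow> f0 t x u' - f0 t x u - f0u t x u * (u' - u) \<ge> C * (u' - u)\<^sup>2"
proof -
  obtain C where C: "C > 0" and *: "\<And>t x x' u u'. t \<in> {0..T} \<Longrightarrow> f0 t x' u' - f0 t x u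
      - (deriv (\<lambda>x. f0 t x u) x * (x' - x) + f0u t x u * (u' - u)) \<ge> C * \<bar>u' - u\<bar>\<^sup>2"
    using convexity by (auto simp: H4_def)
  have 1: "f0 t x u' - f0 t x u - f0u t x u * (u' - u) \<ge> C * (u' - u)\<^sup>2" if "t \<in> {0..T}" for t x u u'
    using *[OF that, where x = x and x' = x and u = u and u' = u'] by simp
  have 2: "(f0u t x u' - f0u t x u) * (u' - u) \<ge> C * (u' - u)\<^sup>2" if "t \<in> {0..T}" for t x u u'
  proof -
    have "C * (u' - u)\<^sup>2 + C * (u - u')\<^sup>2 \<le> (f0u t x u' - f0u t x u) * (u' - u)"
      using 1[OF that, where x = x and u = u and u' = u'] 1[OF that, where x = x and u = u' and u' = u] by (simp add: algebra_simps)
    moreover have "0 \<le> C * (u - u')\<^sup>2" using C by simp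
    ultimately show ?thesis by linarith
  qed
  show ?thesis using that[OF C 2 1] .
qed

lemma f0u_continuous:
  assumes "t \<in> {0..T}"
  shows "continuous_on UNIV (f0u t x)"
proof -
  have "lipschitz_on L UNIV (\<lambda>(x, u). (deriv (\<lambda>x. f0 t x u) x, f0u t x u))"
    using split_cost assms by (auto simp: H3_def)
  then have c: "continuous_on UNIV (\<lambda>(x, u). (deriv (\<lambda>x. f0 t x u) x, f0u t x u))"
    by (rule lipschitz_on_continuous_on)
  have "continuous_on UNIV (\<lambda>u. snd ((\<lambda>(x, u). (deriv (\<lambda>x. f0 t x u) x, f0u t x u)) (x, u)))"
    by (intro continuous_on_snd continuous_on_compose2[OF c] continuous_intros) auto
  then show ?thesis by simp
qed

text \<open>
  The slope of \<open>u \<mapsto> y + f\<^sub>0\<^sub>u(t, x, u)\<close> is at least \<open>C\<close>, so it has changed sign at distance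
  \<open>\<bar>y + f\<^sub>0\<^sub>u(t, x, 0)\<bar> / C\<close> from the origin.
\<close>

lemma first_order_condition_solvable:
  obtains K where "\<And>t x y. t \<in> {0..T} \<Longrightarrow> \<exists>u. y + f0u t x u = 0 \<and> \<bar>u\<bar> \<le> K * \<bar>y + f0u t x 0\<bar>" "0 \<le> K"
proof -
  obtain C where C: "C > 0"
    "\<And>t x u u'. t \<in> {0..T} \<Longrightarrow> (f0u t x u' - f0u t x u) * (u' - u) \<ge> C * (u' - u)\<^sup>2"
    by (rule f0u_strongly_monotone) blast
  have "\<exists>u. y + f0u t x u = 0 \<and> \<bar>u\<bar> \<le> (1 / C) * \<bar>y + f0u t x 0\<bar>" if t: "t \<in> {0..T}" for t x y
  proof -
    define r where "r = (1 / C) * \<bar>y + f0u t x 0\<bar>"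
    have Cr: "C * r = \<bar>y + f0u t x 0\<bar>" and r: "0 \<le> r" using C(1) by (auto simp: r_def)
    have "0 \<le> y + f0u t x r \<and> y + f0u t x (- r) \<le> 0"
    proof (cases "r = 0")
      case True
      then show ?thesis using Cr by simp
    next
      case False
      then have r': "0 < r" using r by simp
      have "C * r * r \<le> (f0u t x r - f0u t x 0) * r" "C * r * r \<le> (f0u t x 0 - f0u t x (- r)) * r"
        using C(2)[OF t, where x = x and u = 0 and u' = r] C(2)[OF t, where x = x and u = 0 and u' = "- r"] by (simp_all add: power2_eq_square algebra_simps)
      then have "C * r \<le> f0u t x r - f0u t x 0" "C * r \<le> f0u t x 0 - f0u t x (- r)"
        using r' by simp_all
      then show ?thesis using Cr by linarith
    qed
    moreover have "continuous_on {-r..r} (\<lambda>u. y + f0u t x u)"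
      by (intro continuous_intros continuous_on_subset[OF f0u_continuous[OF t]]) auto
    ultimately obtain u where "-r \<le> u" "u \<le> r" "y + f0u t x u = 0"
      using IVT'[of "\<lambda>u. y + f0u t x u" "-r" 0 r] r by auto
    then show ?thesis by (intro exI[of _ u]) (auto simp: r_def)
  qed
  then show ?thesis using C(1) by (intro that[of "1 / C"]) auto
qed

lemma affine_eq:
  assumes "t \<in> {0..T}" "m \<in> P2"
  shows "b t x u m = b0 t m + b1 t * x + b2 t * u" "\<sigma> t x u m = \<sigma>0 t m + \<sigma>1 t * x + \<sigma>2 t * u"
    "t\<sigma> t x u m = t\<sigma>0 t m + t\<sigma>1 t * x + t\<sigma>2 t * u"
  using affine assms by (simp_all add: affine_coeff_def)

lemma affine_bounds:
  assumes "t \<in> {0..T}"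
  shows "\<bar>b1 t\<bar> \<le> L" "\<bar>b2 t\<bar> \<le> L" "\<bar>\<sigma>1 t\<bar> \<le> L" "\<bar>\<sigma>2 t\<bar> \<le> L" "\<bar>t\<sigma>1 t\<bar> \<le> L" "\<bar>t\<sigma>2 t\<bar> \<le> L"
    "m \<in> P2 \<Longrightarrow> \<bar>b0 t m\<bar> \<le> L * (1 + sqrt (second_moment m))"
  using affine assms by (simp_all add: affine_coeff_def)

lemma hamiltonian_control:
  assumes "t \<in> {0..T}" "m \<in> P2"
  shows "hamiltonian b \<sigma> t\<sigma> f t x p q tq v m - hamiltonian b \<sigma> t\<sigma> f t x p q tq u m
    = control_slope t p q tq * (v - u) + (f0 t x v - f0 t x u)"
proof -
  have "f t x u m = f0 t x u + f1 t x m" for u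
    using split_cost assms by (auto simp: H3_def)
  then show ?thesis by (simp add: hamiltonian_def affine_eq[OF assms] algebra_simps)
qed

text \<open>
  At a critical point \<open>u\<close> the Hamiltonian satisfies \<open>H(v) - H(u) \<ge> C (v - u)\<^sup>2\<close> for every law, so \<open>u\<close> is the only
  minimiser; that no other point minimises follows from a single law, here the Dirac measure.
\<close>

lemma u_hat_unique:
  assumes t: "t \<in> {0..T}" and u: "control_slope t p q tq + f0u t x u = 0"
  shows "u_hat b \<sigma> t\<sigma> f t x p q tq = u"
  unfolding u_hat_def
proof (rule the_equality)
  obtain C where C: "C > 0"
    "\<And>t x u u'. t \<in> {0..T} \<Longrightarrow> f0 t x u' - f0 t x u - f0u t x u * (u' - u) \<ge> C * (u' - u)\<^sup>2"
    by (rule f0u_strongly_monotone) blast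
  have gap: "hamiltonian b \<sigma> t\<sigma> f t x p q tq v m - hamiltonian b \<sigma> t\<sigma> f t x p q tq u m \<ge> C * (v - u)\<^sup>2"
    if "m \<in> P2" for v m
  proof -
    have "control_slope t p q tq * (v - u) = - (f0u t x u * (v - u))"
      using u by (metis add.inverse_inverse add_eq_0_iff minus_mult_left)
    then show ?thesis
      using C(2)[OF t, where x = x and u = u and u' = v] by (simp add: hamiltonian_control[OF t that])
  qed
  show "\<forall>m\<in>P2. is_arg_min (\<lambda>v. hamiltonian b \<sigma> t\<sigma> f t x p q tq v m) (\<lambda>_. True) u"
  proof
    fix m assume m: "m \<in> P2"
    have "hamiltonian b \<sigma> t\<sigma> f t x p q tq u m \<le> hamiltonian b \<sigma> t\<sigma> f t x p q tq v m" for v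
      using gap[OF m, of v] C(1) by (smt (verit) mult_nonneg_nonneg zero_le_power2)
    then show "is_arg_min (\<lambda>v. hamiltonian b \<sigma> t\<sigma> f t x p q tq v m) (\<lambda>_. True) u"
      by (auto simp: is_arg_min_def not_less)
  qed
  fix v assume "\<forall>m\<in>P2. is_arg_min (\<lambda>v. hamiltonian b \<sigma> t\<sigma> f t x p q tq v m) (\<lambda>_. True) v"
  then have "hamiltonian b \<sigma> t\<sigma> f t x p q tq v (return borel 0) \<le> hamiltonian b \<sigma> t\<sigma> f t x p q tq u (return borel 0)"
    using dirac_P2(1) by (auto simp: is_arg_min_def not_less)
  with gap[OF dirac_P2(1), of v] have "C * (v - u)\<^sup>2 \<le> 0" by linarith
  then show "v = u" using C(1) by (simp add: mult_le_0_iff)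
qed

lemma u_hat_first_order:
  assumes t: "t \<in> {0..T}"
  shows "control_slope t p q tq + f0u t x (u_hat b \<sigma> t\<sigma> f t x p q tq) = 0"
proof -
  obtain K where K: "\<And>t x y. t \<in> {0..T} \<Longrightarrow> \<exists>u. y + f0u t x u = 0 \<and> \<bar>u\<bar> \<le> K * \<bar>y + f0u t x 0\<bar>"
    by (rule first_order_condition_solvable) blast
  obtain u where "control_slope t p q tq + f0u t x u = 0" using K[OF t] by blast
  with u_hat_unique[OF t this] show ?thesis by simp
qed

lemma u_hat_bound:
  obtains K where "0 \<le> K"
    "\<And>t x p q tq. t \<in> {0..T} \<Longrightarrow> \<bar>u_hat b \<sigma> t\<sigma> f t x p q tq\<bar> \<le> K * (1 + \<bar>x\<bar> + \<bar>p\<bar> + \<bar>q\<bar> + \<bar>tq\<bar>)"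
proof -
  obtain K where K: "\<And>t x y. t \<in> {0..T} \<Longrightarrow> \<exists>u. y + f0u t x u = 0 \<and> \<bar>u\<bar> \<le> K * \<bar>y + f0u t x 0\<bar>" "0 \<le> K"
    by (rule first_order_condition_solvable) blast
  have "\<bar>u_hat b \<sigma> t\<sigma> f t x p q tq\<bar> \<le> (K * L) * (1 + \<bar>x\<bar> + \<bar>p\<bar> + \<bar>q\<bar> + \<bar>tq\<bar>)" if t: "t \<in> {0..T}" for t x p q tq
  proof -
    obtain u where u: "control_slope t p q tq + f0u t x u = 0" "\<bar>u\<bar> \<le> K * \<bar>control_slope t p q tq + f0u t x 0\<bar>"
      using K(1)[OF t] by blast
    have "\<bar>f0u t x 0\<bar> \<le> L * (1 + \<bar>x\<bar>)"
      using partials_bound(2)[OF t dirac_P2(1), of x 0] by (simp add: f_partials(2)[OF t dirac_P2(1)] dirac_P2(2))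
    moreover have "\<bar>b2 t * p\<bar> \<le> L * \<bar>p\<bar>" "\<bar>\<sigma>2 t * q\<bar> \<le> L * \<bar>q\<bar>" "\<bar>t\<sigma>2 t * tq\<bar> \<le> L * \<bar>tq\<bar>"
      using affine_bounds[OF t] by (auto simp: abs_mult intro: mult_right_mono)
    ultimately have "\<bar>control_slope t p q tq + f0u t x 0\<bar> \<le> L * (1 + \<bar>x\<bar> + \<bar>p\<bar> + \<bar>q\<bar> + \<bar>tq\<bar>)"
      by (simp add: algebra_simps) linarith
    from mult_left_mono[OF this K(2)] u(2) show ?thesis
      unfolding u_hat_unique[OF t u(1)] by (simp add: mult.assoc)
  qed
  then show ?thesis using K(2) L_pos by (intro that[of "K * L"]) auto
qed

lemma hamiltonian_x_deriv:
  assumes t: "t \<in> {0..T}" and m: "m \<in> P2"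
  shows "deriv (\<lambda>x. hamiltonian b \<sigma> t\<sigma> f t x p q tq u m) x = b1 t * p + \<sigma>1 t * q + t\<sigma>1 t * tq + fx t x u m"
proof (rule DERIV_imp_deriv)
  have fx: "DERIV (\<lambda>x. f t x u m) x :> fx t x u m"
    using f_partials(3)[OF t m] by (simp add: DERIV_deriv_iff_real_differentiable)
  show "DERIV (\<lambda>x. hamiltonian b \<sigma> t\<sigma> f t x p q tq u m) x :> b1 t * p + \<sigma>1 t * q + t\<sigma>1 t * tq + fx t x u m"
    unfolding hamiltonian_def affine_eq[OF t m]
    by (rule derivative_eq_intros fx refl | simp)+
qed

lemma measurable_coeff_compose:
  assumes "measurable_coeff T \<phi>" "a \<in> N \<rightarrow>\<^sub>M time_space T" "x \<in> borel_measurable N" "u \<in> borel_measurable N"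
    "m \<in> N \<rightarrow>\<^sub>M P2_algebra"
  shows "(\<lambda>z. \<phi> (a z) (x z) (u z) (m z)) \<in> borel_measurable N"
proof -
  have "(\<lambda>z. (a z, x z, u z, m z)) \<in> N \<rightarrow>\<^sub>M time_space T \<Otimes>\<^sub>M borel \<Otimes>\<^sub>M borel \<Otimes>\<^sub>M P2_algebra"
    using assms by (intro measurable_Pair)
  from measurable_compose[OF this assms(1)[unfolded measurable_coeff_def]] show ?thesis by simp
qed

lemma time_space_value: "a \<in> N \<rightarrow>\<^sub>M time_space T \<Longrightarrow> z \<in> space N \<Longrightarrow> a z \<in> {0..T}"
  by (drule measurable_space) (auto simp: space_restrict_space)

lemma P2_algebra_value: "m \<in> N \<rightarrow>\<^sub>M P2_algebra \<Longrightarrow> z \<in> space N \<Longrightarrow> m z \<in> P2"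
  by (drule measurable_space) (auto simp: space_P2_algebra)

lemma measurable_fx:
  assumes "a \<in> N \<rightarrow>\<^sub>M time_space T" "x \<in> borel_measurable N" "u \<in> borel_measurable N" "m \<in> N \<rightarrow>\<^sub>M P2_algebra"
  shows "(\<lambda>z. fx (a z) (x z) (u z) (m z)) \<in> borel_measurable N"
proof (rule measurable_deriv)
  show "(\<lambda>z. f (a z) (x z + h) (u z) (m z)) \<in> borel_measurable N" for h
    using assms by (intro measurable_coeff_compose[OF measurable_f]) auto
  show "(\<lambda>x. f (a z) x (u z) (m z)) differentiable at (x z)" if "z \<in> space N" for z
    using f_partials(3) time_space_value[OF assms(1) that] P2_algebra_value[OF assms(4) that] by blast
qed

text \<open>
  The summand \<open>f\<^sub>0\<close> of \<open>f\<close> may fail to be measurable, as only the sum is assumed to be.  Its derivative in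
  the control, however, is that of \<open>f\<close> at a fixed law.
\<close>

lemma measurable_f0u:
  assumes "a \<in> N \<rightarrow>\<^sub>M time_space T" "x \<in> borel_measurable N"
  shows "(\<lambda>z. f0u (a z) (x z) c) \<in> borel_measurable N"
proof -
  have d: "(\<lambda>z. return borel 0 :: real measure) \<in> N \<rightarrow>\<^sub>M P2_algebra"
    using dirac_P2(1) by (intro measurable_const) (simp add: space_P2_algebra)
  have "(\<lambda>z. deriv (\<lambda>u. f (a z) (x z) u (return borel 0)) c) \<in> borel_measurable N"
  proof (rule measurable_deriv[where x = "\<lambda>_. c"])
    show "(\<lambda>z. f (a z) (x z) (c + h) (return borel 0)) \<in> borel_measurable N" for h
      using assms d by (intro measurable_coeff_compose[OF measurable_f]) auto
    show "(\<lambda>u. f (a z) (x z) u (return borel 0)) differentiable at c" if "z \<in> space N" for z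
      using f_partials(4)[OF time_space_value[OF assms(1) that] dirac_P2(1)] .
  qed
  then show ?thesis
    by (rule measurable_cong[THEN iffD1, rotated])
       (simp add: f_partials(2)[OF time_space_value[OF assms(1)] dirac_P2(1)])
qed

lemma measurable_slopes:
  assumes "a \<in> N \<rightarrow>\<^sub>M time_space T"
  shows "(\<lambda>z. b1 (a z)) \<in> borel_measurable N" "(\<lambda>z. b2 (a z)) \<in> borel_measurable N"
    "(\<lambda>z. \<sigma>1 (a z)) \<in> borel_measurable N" "(\<lambda>z. \<sigma>2 (a z)) \<in> borel_measurable N"
    "(\<lambda>z. t\<sigma>1 (a z)) \<in> borel_measurable N" "(\<lambda>z. t\<sigma>2 (a z)) \<in> borel_measurable N"
  using affine assms by (auto simp: affine_coeff_def intro: measurable_compose)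

text \<open>
  By strong monotonicity the zero of \<open>y + f\<^sub>0\<^sub>u(t, x, \<cdot>)\<close> is at most \<open>c\<close> exactly if the function is
  nonnegative at \<open>c\<close>, which is a measurable condition.
\<close>

lemma measurable_u_hat:
  assumes a: "a \<in> N \<rightarrow>\<^sub>M time_space T" and x: "x \<in> borel_measurable N"
    and p[measurable]: "p \<in> borel_measurable N" "q \<in> borel_measurable N" "tq \<in> borel_measurable N"
  shows "(\<lambda>z. u_hat b \<sigma> t\<sigma> f (a z) (x z) (p z) (q z) (tq z)) \<in> borel_measurable N"
proof (rule borel_measurableI_le)
  fix c
  note [measurable] = measurable_slopes[OF a] measurable_f0u[OF a x, of c]
  obtain C where C: "C > 0"
    "\<And>t x u u'. t \<in> {0..T} \<Longrightarrow> (f0u t x u' - f0u t x u) * (u' - u) \<ge> C * (u' - u)\<^sup>2"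
    by (rule f0u_strongly_monotone) blast
  have "u_hat b \<sigma> t\<sigma> f t y p q tq \<le> c \<longleftrightarrow> 0 \<le> control_slope t p q tq + f0u t y c" (is "?u \<le> c \<longleftrightarrow> _")
    if t: "t \<in> {0..T}" for t y p q tq
  proof -
    have foc: "control_slope t p q tq + f0u t y ?u = 0" by (rule u_hat_first_order[OF t])
    have *: "C * (c - ?u)\<^sup>2 \<le> (control_slope t p q tq + f0u t y c) * (c - ?u)"
    proof -
      have "control_slope t p q tq = - f0u t y ?u" using foc by linarith
      then show ?thesis using C(2)[OF t, where x = y and u = ?u and u' = c] by simp
    qed
    show ?thesis
    proof (cases "?u = c")
      case True
      then show ?thesis using foc by simp
    next
      case False
      then have "0 < C * (c - ?u)\<^sup>2" using C(1) by simp
      with * have "0 < (control_slope t p q tq + f0u t y c) * (c - ?u)" by linarith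
      then show ?thesis by (auto simp: zero_less_mult_iff)
    qed
  qed
  then have "{z \<in> space N. u_hat b \<sigma> t\<sigma> f (a z) (x z) (p z) (q z) (tq z) \<le> c}
      = {z \<in> space N. 0 \<le> control_slope (a z) (p z) (q z) (tq z) + f0u (a z) (x z) c}"
    using time_space_value[OF a] by auto
  also have "\<dots> \<in> sets N" by measurable
  finally show "{z \<in> space N. u_hat b \<sigma> t\<sigma> f (a z) (x z) (p z) (q z) (tq z) \<le> c} \<in> sets N" .
qed

end

section \<open>The conditional law flow\<close>

lemma second_moment_nn_integral:
  assumes "m \<in> P2"
  shows "ennreal (second_moment m) = (\<integral>\<^sup>+x. ennreal (x\<^sup>2) \<partial>m)"
  using assms unfolding second_moment_def P2_def by (intro nn_integral_eq_integral[symmetric]) auto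

lemma measurable_second_moment: "second_moment \<in> borel_measurable P2_algebra"
proof -
  have "(\<lambda>m. enn2real (\<integral>\<^sup>+x. ennreal (x\<^sup>2) \<partial>m)) \<in> borel_measurable (subprob_algebra (borel :: real measure))"
    by (intro measurable_compose[OF nn_integral_measurable_subprob_algebra]) auto
  then have "(\<lambda>m. enn2real (\<integral>\<^sup>+x. ennreal (x\<^sup>2) \<partial>m)) \<in> borel_measurable P2_algebra"
    unfolding P2_algebra_def prob_algebra_def by (intro measurable_restrict_space1)
  moreover have "second_moment m = enn2real (\<integral>\<^sup>+x. ennreal (x\<^sup>2) \<partial>m)" if "m \<in> space P2_algebra" for m
    using second_moment_nn_integral[of m] that second_moment_nonneg[of m]
    by (metis enn2real_ennreal space_P2_algebra)
  ultimately show ?thesis by (simp cong: measurable_cong)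
qed

context common_noise
begin

text \<open>The mixture \<open>bind M \<mu>\<close> of the conditional laws is the law of \<open>X\<close>.\<close>

lemma cond_law_nn_integral:
  assumes sub: "subalgebra M G" and law: "cond_law M G X \<mu>" and X[measurable]: "X \<in> borel_measurable M"
    and [measurable]: "\<phi> \<in> borel_measurable borel"
  shows "(\<integral>\<^sup>+\<omega>. (\<integral>\<^sup>+x. \<phi> x \<partial>\<mu> \<omega>) \<partial>M) = (\<integral>\<^sup>+\<omega>. \<phi> (X \<omega>) \<partial>M)"
proof -
  interpret S: finite_measure_subalgebra M G
    using sub by unfold_locales
  have \<mu>: "\<mu> \<in> M \<rightarrow>\<^sub>M prob_algebra borel"
    using law measurable_from_subalg[OF sub] by (auto simp: cond_law_def)
  then have \<mu>'[measurable]: "\<mu> \<in> M \<rightarrow>\<^sub>M subprob_algebra borel"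
    by (rule measurable_prob_algebraD)
  have "bind M \<mu> = distr M borel X"
  proof (rule measure_eqI)
    show "sets (bind M \<mu>) = sets (distr M borel X)"
      using sets_bind[OF sets_kernel[OF \<mu>'] not_empty] by simp
    fix A assume "A \<in> sets (bind M \<mu>)"
    then have A[measurable]: "A \<in> sets borel"
      using sets_bind[OF sets_kernel[OF \<mu>'] not_empty] by simp
    have prob: "prob_space (\<mu> \<omega>)" if "\<omega> \<in> space M" for \<omega>
      using measurable_space[OF \<mu> that] by (simp add: space_prob_algebra)
    have i: "integrable M (\<lambda>\<omega>. indicator A (X \<omega>) :: real)"
      by (rule integrable_const_bound[where B = 1]) (auto simp: indicator_def)
    have cond: "AE \<omega> in M. measure (\<mu> \<omega>) A = real_cond_exp M G (\<lambda>\<omega>'. indicator A (X \<omega>')) \<omega>"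
      using law A by (auto simp: cond_law_def)
    have "emeasure (bind M \<mu>) A = (\<integral>\<^sup>+\<omega>. emeasure (\<mu> \<omega>) A \<partial>M)"
      using emeasure_bind[OF not_empty \<mu>' A] .
    also have "\<dots> = (\<integral>\<^sup>+\<omega>. ennreal (real_cond_exp M G (\<lambda>\<omega>'. indicator A (X \<omega>')) \<omega>) \<partial>M)"
    proof (rule nn_integral_cong_AE)
      show "AE \<omega> in M. emeasure (\<mu> \<omega>) A = ennreal (real_cond_exp M G (\<lambda>\<omega>'. indicator A (X \<omega>')) \<omega>)"
        using cond AE_space
      proof eventually_elim
        case (elim \<omega>)
        interpret P: prob_space "\<mu> \<omega>" by (rule prob[OF elim(2)])
        show ?case using elim(1) by (simp add: P.emeasure_eq_measure)
      qed
    qed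
    also have "\<dots> = ennreal (\<integral>\<omega>. real_cond_exp M G (\<lambda>\<omega>'. indicator A (X \<omega>')) \<omega> \<partial>M)"
    proof (rule nn_integral_eq_integral)
      show "AE \<omega> in M. 0 \<le> real_cond_exp M G (\<lambda>\<omega>'. indicator A (X \<omega>')) \<omega>"
        using cond by eventually_elim (metis measure_nonneg)
    qed (rule S.real_cond_exp_int(1)[OF i])
    also have "\<dots> = ennreal (\<integral>\<omega>. indicator A (X \<omega>) \<partial>M)"
      by (simp add: S.real_cond_exp_int(2)[OF i])
    also have "\<dots> = (\<integral>\<^sup>+\<omega>. ennreal (indicator A (X \<omega>)) \<partial>M)"
      using i by (intro nn_integral_eq_integral[symmetric]) auto
    also have "\<dots> = (\<integral>\<^sup>+\<omega>. indicator (X -` A \<inter> space M) \<omega> \<partial>M)"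
      by (intro nn_integral_cong) (auto simp: indicator_def)
    also have "\<dots> = emeasure (distr M borel X) A"
      by (simp add: emeasure_distr)
    finally show "emeasure (bind M \<mu>) A = emeasure (distr M borel X) A" .
  qed
  then have "(\<integral>\<^sup>+x. \<phi> x \<partial>bind M \<mu>) = (\<integral>\<^sup>+x. \<phi> x \<partial>distr M borel X)" by simp
  then show ?thesis
    by (subst (asm) nn_integral_bind[OF _ \<mu>']) (auto simp: nn_integral_distr)
qed

lemma noise_filtration_subalgebra:
  "t \<le> T \<Longrightarrow> subalgebra M (noise_filtration M tW t)"
  using noise_filtration_sets[of t] sets_F_subset[of t] by (auto simp: subalgebra_def)

lemma progressive_noise_filtration:
  assumes "progressive T (noise_filtration M tW) N \<alpha>"
  shows "progressive T F N \<alpha>"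
  unfolding progressive_def
proof
  fix t assume t: "t \<in> {0..T}"
  have "(\<lambda>x. x) \<in> F t \<rightarrow>\<^sub>M noise_filtration M tW t"
    using noise_filtration_sets[of t] t
    by (intro measurable_from_subalg[of "F t" "noise_filtration M tW t"]) (auto simp: subalgebra_def)
  then have "(\<lambda>z. (fst z, snd z)) \<in> restrict_space borel {0..t} \<Otimes>\<^sub>M F t
      \<rightarrow>\<^sub>M restrict_space borel {0..t} \<Otimes>\<^sub>M noise_filtration M tW t"
    by (intro measurable_Pair measurable_compose[OF measurable_snd]) auto
  moreover have "(\<lambda>(s, \<omega>). \<alpha> s \<omega>) \<in> restrict_space borel {0..t} \<Otimes>\<^sub>M noise_filtration M tW t \<rightarrow>\<^sub>M N"
    using assms t by (auto simp: progressive_def)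
  ultimately have "(\<lambda>z. case (fst z, snd z) of (s, \<omega>) \<Rightarrow> \<alpha> s \<omega>) \<in> restrict_space borel {0..t} \<Otimes>\<^sub>M F t \<rightarrow>\<^sub>M N"
    by (rule measurable_compose)
  then show "(\<lambda>(s, \<omega>). \<alpha> s \<omega>) \<in> restrict_space borel {0..t} \<Otimes>\<^sub>M F t \<rightarrow>\<^sub>M N" by (simp add: split_beta')
qed

text \<open>
  The second moments of the flow have the expectation of \<open>X\<^sub>t\<^sup>2\<close>; measurability is first transferred
  from the noise filtration to the full one.
\<close>

lemma cond_law_flow_L2:
  assumes flow: "cond_law_flow M T (noise_filtration M tW) X m"
    and X: "\<And>t. t \<in> {0..T} \<Longrightarrow> X t \<in> borel_measurable M"
    and b: "\<And>t. t \<in> {0..T} \<Longrightarrow> (\<integral>\<^sup>+\<omega>. ennreal ((X t \<omega>)\<^sup>2) \<partial>M) \<le> C" and C: "C < \<infinity>"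
  shows "progressive T F P2_algebra m" "process_L2 T (\<lambda>t \<omega>. sqrt (second_moment (m t \<omega>)))"
    "t \<in> {0..T} \<Longrightarrow> square_integrable M (\<lambda>\<omega>. sqrt (second_moment (m t \<omega>)))"
proof -
  have T: "T \<in> {0..T}" using T_pos by simp
  show prog: "progressive T F P2_algebra m"
    using flow by (intro progressive_noise_filtration) (simp add: cond_law_flow_def)
  have bound: "(\<integral>\<^sup>+\<omega>. ennreal ((sqrt (second_moment (m t \<omega>)))\<^sup>2) \<partial>M) \<le> C" if t: "t \<in> {0..T}" for t
  proof -
    have P2: "m t \<omega> \<in> P2" if "\<omega> \<in> space M" for \<omega>
      using measurable_space[OF progressive_adapted[OF prog t], of \<omega>] that by (simp add: space_P2_algebra)
    have "(\<integral>\<^sup>+\<omega>. ennreal ((sqrt (second_moment (m t \<omega>)))\<^sup>2) \<partial>M) = (\<integral>\<^sup>+\<omega>. (\<integral>\<^sup>+x. ennreal (x\<^sup>2) \<partial>m t \<omega>) \<partial>M)"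
      using second_moment_nn_integral[OF P2] by (intro nn_integral_cong) (simp add: second_moment_nonneg)
    also have "\<dots> = (\<integral>\<^sup>+\<omega>. ennreal ((X t \<omega>)\<^sup>2) \<partial>M)"
      using flow t X[OF t] noise_filtration_subalgebra[of t]
      by (intro cond_law_nn_integral) (auto simp: cond_law_flow_def)
    finally show ?thesis using b[OF t] by simp
  qed
  have "(\<lambda>z. second_moment (m (fst z) (snd z))) \<in> borel_measurable (prod_upto T)"
    by (rule measurable_compose[OF progressive_measurable_prod[OF prog T] measurable_second_moment])
  then show "process_L2 T (\<lambda>t \<omega>. sqrt (second_moment (m t \<omega>)))"
    by (intro process_L2_of_bounded_moments[OF _ bound C]) auto
  show "square_integrable M (\<lambda>\<omega>. sqrt (second_moment (m t \<omega>)))" if t: "t \<in> {0..T}"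
  proof -
    have "m t \<in> M \<rightarrow>\<^sub>M P2_algebra"
      using measurable_F_M[OF progressive_adapted[OF prog t]] t by simp
    from measurable_compose[OF this measurable_second_moment]
    have "(\<lambda>\<omega>. sqrt (second_moment (m t \<omega>))) \<in> borel_measurable M" by measurable
    then show ?thesis
      using bound[OF t] C by (subst square_integrable_iff_nn_integral) (auto intro: order_le_less_trans)
  qed
qed

section \<open>Uniqueness for linear state equations\<close>

lemma process_inner_diff:
  assumes "process_L2 t a" "process_L2 t a'" "process_L2 t c" "process_L2 t c'"
  shows "process_inner t (\<lambda>s \<omega>. a s \<omega> - a' s \<omega>) (\<lambda>s \<omega>. c s \<omega> - c' s \<omega>)
    = process_inner t a c - process_inner t a c' - process_inner t a' c + process_inner t a' c'"
proof -
  have "process_inner t (\<lambda>s \<omega>. a s \<omega> - a' s \<omega>) (\<lambda>s \<omega>. c s \<omega> - c' s \<omega>)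
    = (\<integral>z. a (fst z) (snd z) * c (fst z) (snd z) - a (fst z) (snd z) * c' (fst z) (snd z)
        - a' (fst z) (snd z) * c (fst z) (snd z) + a' (fst z) (snd z) * c' (fst z) (snd z) \<partial>prod_upto t)"
    by (intro Bochner_Integration.integral_cong) (auto simp: algebra_simps)
  then show ?thesis
    using square_integrable_mult[OF assms(1,3)] square_integrable_mult[OF assms(1,4)]
      square_integrable_mult[OF assms(2,3)] square_integrable_mult[OF assms(2,4)] by simp
qed

lemma process_inner_diff_left:
  assumes "process_L2 t a" "process_L2 t a'" "process_L2 t c"
  shows "process_inner t (\<lambda>s \<omega>. a s \<omega> - a' s \<omega>) c = process_inner t a c - process_inner t a' c"
  using square_integrable_mult[OF assms(1,3)] square_integrable_mult[OF assms(2,3)]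
  by (simp add: left_diff_distrib)

text \<open>The square is expanded and the product formula applied to the three products.\<close>

lemma ito_square_diff_expectation:
  assumes Z: "ito_process_L2 Z \<beta> \<gamma> t\<gamma>" and Z': "ito_process_L2 Z' \<beta>' \<gamma>' t\<gamma>'" and t: "t \<in> {0..T}"
  shows "(\<integral>\<omega>. (Z t \<omega> - Z' t \<omega>)\<^sup>2 \<partial>M) = (\<integral>\<omega>. (Z 0 \<omega> - Z' 0 \<omega>)\<^sup>2 \<partial>M)
    + 2 * process_inner t (\<lambda>s \<omega>. \<beta> s \<omega> - \<beta>' s \<omega>) (\<lambda>s \<omega>. Z s \<omega> - Z' s \<omega>)
    + process_inner t (\<lambda>s \<omega>. \<gamma> s \<omega> - \<gamma>' s \<omega>) (\<lambda>s \<omega>. \<gamma> s \<omega> - \<gamma>' s \<omega>)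
    + process_inner t (\<lambda>s \<omega>. t\<gamma> s \<omega> - t\<gamma>' s \<omega>) (\<lambda>s \<omega>. t\<gamma> s \<omega> - t\<gamma>' s \<omega>)"
proof -
  have tT: "t \<le> T" and zero: "0 \<in> {0..T}" using t T_pos by auto
  note L2 = process_L2_mono[OF ito_process_measurable(3) tT] process_L2_mono[OF ito_process_process_L2 tT]
    process_L2_mono[OF ito_process_diffusion_L2(1) tT] process_L2_mono[OF ito_process_diffusion_L2(2) tT]
  note sq = ito_process_square_integrable
  show ?thesis
    unfolding integral_square_diff[OF sq[OF Z t] sq[OF Z' t]] integral_square_diff[OF sq[OF Z zero] sq[OF Z' zero]]
      process_inner_diff[OF L2(1)[OF Z] L2(1)[OF Z'] L2(2)[OF Z] L2(2)[OF Z']]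
      process_inner_diff[OF L2(3)[OF Z] L2(3)[OF Z'] L2(3)[OF Z] L2(3)[OF Z']]
      process_inner_diff[OF L2(4)[OF Z] L2(4)[OF Z'] L2(4)[OF Z] L2(4)[OF Z']]
      ito_product_expectation[OF Z Z t] ito_product_expectation[OF Z Z' t] ito_product_expectation[OF Z' Z' t]
      process_inner_commute[of t Z \<beta>] process_inner_commute[of t Z' \<beta>'] process_inner_commute[of t Z \<beta>']
      process_inner_commute[of t \<gamma>' \<gamma>] process_inner_commute[of t t\<gamma>' t\<gamma>]
    by simp
qed

end

text \<open>
  With \<open>A(t) = \<integral>\<^sub>0\<^sup>t a\<close>, the product rule gives
  \<open>A(t) exp(- K t) = \<integral>\<^sub>0\<^sup>t exp(- K s) (a(s) - K A(s)) ds\<close>, whose integrand is not positive.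
\<close>

lemma gronwall_zero:
  fixes a :: "real \<Rightarrow> real"
  assumes i: "integrable (time_upto T) a" and K: "0 \<le> K" and nonneg: "\<And>t. t \<in> {0..T} \<Longrightarrow> 0 \<le> a t"
    and le: "\<And>t. t \<in> {0..T} \<Longrightarrow> a t \<le> K * (\<integral>s. a s \<partial>time_upto t)"
    and t: "t \<in> {0..T}"
  shows "(\<integral>s. a s \<partial>time_upto t) = 0"
proof -
  define E where "E s = - K * exp (- K * s)" for s :: real
  have E: "(\<integral>s. E s \<partial>time_upto r) = exp (- K * r) - 1" if "0 \<le> r" for r
  proof -
    have "(\<integral>s. E s * indicator {0..r} s \<partial>lborel) = exp (- K * r) - exp (- K * 0)"
      using that unfolding E_def
      by (intro integral_FTC_Icc_real) (auto intro!: derivative_eq_intros continuous_intros)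
    then show ?thesis by (simp add: integral_restrict_space mult.commute)
  qed
  have iE: "integrable (time_upto t) E"
  proof -
    have "set_integrable lborel {0..t} E"
      unfolding E_def by (intro borel_integrable_atLeastAtMost' continuous_intros)
    then show ?thesis by (simp add: integrable_restrict_space set_integrable_def)
  qed
  have ia: "integrable (time_upto t) a"
  proof -
    have "integrable lborel (\<lambda>s. indicator {0..t} s *\<^sub>R (indicator {0..T} s *\<^sub>R a s))"
    proof (rule integrable_mult_indicator)
      show "integrable lborel (\<lambda>s. indicator {0..T} s *\<^sub>R a s)"
        using i by (simp add: integrable_restrict_space)
    qed simp
    moreover have "(\<lambda>s. indicator {0..t} s *\<^sub>R (indicator {0..T} s *\<^sub>R a s)) = (\<lambda>s. indicator {0..t} s *\<^sub>R a s)"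
      using t by (auto simp: indicator_def)
    ultimately show ?thesis by (simp add: integrable_restrict_space)
  qed
  \<comment> \<open>integration by parts against the exponential weight \<open>exp (- K s)\<close>\<close>
  have "(\<integral>s. a s \<partial>time_upto t) * (exp (- K * t) - 1)
      = (\<integral>s. a s * (\<integral>r. E r \<partial>time_upto s) + (\<integral>r. a r \<partial>time_upto s) * E s \<partial>time_upto t)"
    using integral_time_upto_product[OF ia iE] E[of t] t by simp
  also have "\<dots> \<le> (\<integral>s. - a s \<partial>time_upto t)"
  proof (rule integral_mono[OF integrable_time_upto_product[OF ia iE]])
      fix s assume "s \<in> space (time_upto t)"
      then have s: "s \<in> {0..T}" "0 \<le> s" using t by auto
      have "exp (- K * s) * a s \<le> exp (- K * s) * (K * (\<integral>r. a r \<partial>time_upto s))"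
        using le[OF s(1)] by (intro mult_left_mono) auto
      then show "a s * (\<integral>r. E r \<partial>time_upto s) + (\<integral>r. a r \<partial>time_upto s) * E s \<le> - a s"
        unfolding E[OF s(2)] by (simp add: E_def algebra_simps)
  qed (use ia in simp)
  finally have "(\<integral>s. a s \<partial>time_upto t) * exp (- K * t) \<le> 0" by (simp add: algebra_simps)
  then have "(\<integral>s. a s \<partial>time_upto t) \<le> 0" by (simp add: mult_le_0_iff)
  moreover have "0 \<le> (\<integral>s. a s \<partial>time_upto t)"
    using nonneg t by (intro Bochner_Integration.integral_nonneg) auto
  ultimately show ?thesis by simp
qed

section \<open>The stochastic maximum principle\<close>

text \<open>Square-integrability of \<open>sqrt (second_moment (m t))\<close> makes the growth bounds of the coefficients and of the cost integrable.\<close>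

locale mean_field_game =
  common_noise M T W tW \<xi> + mfg_coefficients T L b \<sigma> t\<sigma> f g f0 f1 b0 \<sigma>0 t\<sigma>0 b1 b2 \<sigma>1 \<sigma>2 t\<sigma>1 t\<sigma>2
  for M :: "'a measure" and T :: real and W tW :: "real \<Rightarrow> 'a \<Rightarrow> real" and \<xi> :: "'a \<Rightarrow> real"
    and L :: real and b \<sigma> t\<sigma> f :: coeff and g :: "real \<Rightarrow> real measure \<Rightarrow> real"
    and f0 :: "real \<Rightarrow> real \<Rightarrow> real \<Rightarrow> real" and f1 :: "real \<Rightarrow> real \<Rightarrow> real measure \<Rightarrow> real"
    and b0 \<sigma>0 t\<sigma>0 :: "real \<Rightarrow> real measure \<Rightarrow> real" and b1 b2 \<sigma>1 \<sigma>2 t\<sigma>1 t\<sigma>2 :: "real \<Rightarrow> real" +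
  fixes m :: "real \<Rightarrow> 'a \<Rightarrow> real measure"
  assumes flow_progressive: "progressive T F P2_algebra m"
    and flow_L2: "process_L2 T (\<lambda>t \<omega>. sqrt (second_moment (m t \<omega>)))"
    and flow_terminal_L2: "square_integrable M (\<lambda>\<omega>. sqrt (second_moment (m T \<omega>)))"
begin

lemma T_mem: "T \<in> {0..T}" "0 \<in> {0..T}"
  using T_pos by auto

lemma flow_P2: "t \<in> {0..T} \<Longrightarrow> \<omega> \<in> space M \<Longrightarrow> m t \<omega> \<in> P2"
  using measurable_space[OF progressive_adapted[OF flow_progressive], of t \<omega>] by (simp add: space_P2_algebra)

lemma flow_prod:
  assumes "z \<in> space (prod_upto T)"
  shows "fst z \<in> {0..T}" "m (fst z) (snd z) \<in> P2"
  using space_prod_upto[OF assms] flow_P2 by auto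

lemma progressive_iff:
  "progressive T F N \<alpha> \<longleftrightarrow>
    (\<forall>t\<in>{0..T}. (\<lambda>z. \<alpha> (fst z) (snd z)) \<in> restrict_space borel {0..t} \<Otimes>\<^sub>M F t \<rightarrow>\<^sub>M N)"
  by (simp add: progressive_def split_beta')

lemma progressive_time:
  "t \<in> {0..T} \<Longrightarrow> fst \<in> restrict_space borel {0..t} \<Otimes>\<^sub>M F t \<rightarrow>\<^sub>M time_space T"
  by (rule measurable_compose[OF measurable_fst]) (auto intro!: measurable_restrict_space3)

text \<open>A composition is progressive because the coefficients are jointly measurable in all arguments.\<close>

lemma progressive_coeff:
  assumes "measurable_coeff T \<phi>" "progressive T F borel X" "progressive T F borel u"
  shows "progressive T F borel (\<lambda>t \<omega>. \<phi> t (X t \<omega>) (u t \<omega>) (m t \<omega>))"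
  unfolding progressive_iff
proof
  fix t assume t: "t \<in> {0..T}"
  show "(\<lambda>z. \<phi> (fst z) (X (fst z) (snd z)) (u (fst z) (snd z)) (m (fst z) (snd z)))
      \<in> borel_measurable (restrict_space borel {0..t} \<Otimes>\<^sub>M F t)"
    using assms(2,3) flow_progressive t unfolding progressive_iff
    by (intro measurable_coeff_compose[OF assms(1) progressive_time[OF t]]) auto
qed

lemma progressive_u_hat:
  assumes "progressive T F borel X" "progressive T F borel p" "progressive T F borel q" "progressive T F borel tq"
  shows "progressive T F borel (u_hat_process b \<sigma> t\<sigma> f X p q tq)"
  unfolding progressive_iff u_hat_process_def
proof
  fix t assume t: "t \<in> {0..T}"
  show "(\<lambda>z. u_hat b \<sigma> t\<sigma> f (fst z) (X (fst z) (snd z)) (p (fst z) (snd z)) (q (fst z) (snd z)) (tq (fst z) (snd z)))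
      \<in> borel_measurable (restrict_space borel {0..t} \<Otimes>\<^sub>M F t)"
    using assms t unfolding progressive_iff
    by (intro measurable_u_hat[OF progressive_time[OF t]]) auto
qed

lemma u_hat_L2_prog:
  assumes "X \<in> L2_prog M T F" "p \<in> L2_prog M T F" "q \<in> L2_prog M T F" "tq \<in> L2_prog M T F"
  shows "u_hat_process b \<sigma> t\<sigma> f X p q tq \<in> L2_prog M T F"
proof -
  interpret Q: finite_measure "prod_upto T" by (rule finite_measure_prod_upto)
  obtain K where K: "0 \<le> K"
    "\<And>t x p q tq. t \<in> {0..T} \<Longrightarrow> \<bar>u_hat b \<sigma> t\<sigma> f t x p q tq\<bar> \<le> K * (1 + \<bar>x\<bar> + \<bar>p\<bar> + \<bar>q\<bar> + \<bar>tq\<bar>)"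
    by (rule u_hat_bound) blast
  have prog: "progressive T F borel (u_hat_process b \<sigma> t\<sigma> f X p q tq)"
    using assms by (intro progressive_u_hat) (auto simp: L2_prog_iff)
  have "process_L2 T (\<lambda>t \<omega>. K * (1 + \<bar>X t \<omega>\<bar> + \<bar>p t \<omega>\<bar> + \<bar>q t \<omega>\<bar> + \<bar>tq t \<omega>\<bar>))"
    using assms by (intro square_integrable_cmult square_integrable_add square_integrable_abs Q.square_integrable_const)
      (auto simp: L2_prog_iff)
  then have "process_L2 T (u_hat_process b \<sigma> t\<sigma> f X p q tq)"
  proof (rule square_integrable_bound[OF _ progressive_measurable_prod[OF prog T_mem(1)]])
    show "AE z in prod_upto T. \<bar>u_hat_process b \<sigma> t\<sigma> f X p q tq (fst z) (snd z)\<bar>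
        \<le> \<bar>K * (1 + \<bar>X (fst z) (snd z)\<bar> + \<bar>p (fst z) (snd z)\<bar> + \<bar>q (fst z) (snd z)\<bar> + \<bar>tq (fst z) (snd z)\<bar>)\<bar>"
    proof (rule AE_I2)
      fix z assume "z \<in> space (prod_upto T)"
      from K(2)[OF flow_prod(1)[OF this]]
      show "\<bar>u_hat_process b \<sigma> t\<sigma> f X p q tq (fst z) (snd z)\<bar>
        \<le> \<bar>K * (1 + \<bar>X (fst z) (snd z)\<bar> + \<bar>p (fst z) (snd z)\<bar> + \<bar>q (fst z) (snd z)\<bar> + \<bar>tq (fst z) (snd z)\<bar>)\<bar>"
        unfolding u_hat_process_def by (rule order_trans[OF _ abs_ge_self])
    qed
  qed
  with prog show ?thesis by (simp add: L2_prog_iff)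
qed

lemma flow_growth_L2:
  assumes "process_L2 T X" "process_L2 T u"
  shows "process_L2 T (\<lambda>t \<omega>. L * (1 + \<bar>X t \<omega>\<bar> + \<bar>u t \<omega>\<bar> + sqrt (second_moment (m t \<omega>))))"
proof -
  interpret Q: finite_measure "prod_upto T" by (rule finite_measure_prod_upto)
  show ?thesis
    by (intro square_integrable_cmult square_integrable_add square_integrable_abs Q.square_integrable_const assms flow_L2)
qed

lemma b_growth:
  assumes t: "t \<in> {0..T}" and "\<mu> \<in> P2"
  shows "\<bar>b t x u \<mu>\<bar> \<le> L * (1 + \<bar>x\<bar> + \<bar>u\<bar> + sqrt (second_moment \<mu>))"
proof -
  have "\<bar>b1 t * x\<bar> \<le> L * \<bar>x\<bar>" "\<bar>b2 t * u\<bar> \<le> L * \<bar>u\<bar>"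
    using affine_bounds[OF t] by (auto simp: abs_mult intro: mult_right_mono)
  then show ?thesis
    using affine_bounds(7)[OF assms] unfolding affine_eq(1)[OF assms] by (simp add: algebra_simps)
qed

lemma drift_L2_prog:
  assumes "X \<in> L2_prog M T F" "u \<in> L2_prog M T F"
  shows "(\<lambda>t \<omega>. b t (X t \<omega>) (u t \<omega>) (m t \<omega>)) \<in> L2_prog M T F"
proof -
  have prog: "progressive T F borel (\<lambda>t \<omega>. b t (X t \<omega>) (u t \<omega>) (m t \<omega>))"
    using assms by (intro progressive_coeff[OF measurable_b]) (simp_all add: L2_prog_iff)
  have "process_L2 T (\<lambda>t \<omega>. b t (X t \<omega>) (u t \<omega>) (m t \<omega>))"
  proof (rule square_integrable_bound[OF flow_growth_L2 progressive_measurable_prod[OF prog T_mem(1)]])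
    show "AE z in prod_upto T. \<bar>b (fst z) (X (fst z) (snd z)) (u (fst z) (snd z)) (m (fst z) (snd z))\<bar>
      \<le> \<bar>L * (1 + \<bar>X (fst z) (snd z)\<bar> + \<bar>u (fst z) (snd z)\<bar> + sqrt (second_moment (m (fst z) (snd z))))\<bar>"
      using b_growth[OF flow_prod] by (intro AE_I2 order_trans[OF _ abs_ge_self])
  qed (use assms in \<open>auto simp: L2_prog_iff\<close>)
  with prog show ?thesis by (simp add: L2_prog_iff)
qed

lemma state_solution_ito_process:
  assumes u: "u \<in> L2_prog M T F" and X: "state_solution M T W tW \<xi> b \<sigma> t\<sigma> m u X"
  shows "ito_process_L2 X (\<lambda>t \<omega>. b t (X t \<omega>) (u t \<omega>) (m t \<omega>))
    (\<lambda>t \<omega>. \<sigma> t (X t \<omega>) (u t \<omega>) (m t \<omega>)) (\<lambda>t \<omega>. t\<sigma> t (X t \<omega>) (u t \<omega>) (m t \<omega>))"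
proof -
  have XL: "X \<in> L2_prog M T F" and d: "has_ito_differential M T F W tW X (\<lambda>t \<omega>. b t (X t \<omega>) (u t \<omega>) (m t \<omega>))
       (\<lambda>t \<omega>. \<sigma> t (X t \<omega>) (u t \<omega>) (m t \<omega>)) (\<lambda>t \<omega>. t\<sigma> t (X t \<omega>) (u t \<omega>) (m t \<omega>))"
    and X0: "AE \<omega> in M. X 0 \<omega> = \<xi> \<omega>"
    using X by (auto simp: state_solution_def)
  have "square_integrable M \<xi>"
    using noise_setup by (auto simp: common_noise_setup_def square_integrable_def)
  moreover have "X 0 \<in> borel_measurable M"
    using XL T_mem(2) by (intro measurable_F_M[OF progressive_adapted]) (auto simp: L2_prog_iff)
  ultimately have "square_integrable M (X 0)"
    using X0 by (rule square_integrable_AE_cong)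
  with d drift_L2_prog[OF XL u] show ?thesis by (simp add: ito_process_L2_def)
qed

lemma affine_differences:
  assumes "t \<in> {0..T}" "\<mu> \<in> P2"
  shows "b t x u \<mu> - b t x' u' \<mu> = b1 t * (x - x') + b2 t * (u - u')"
    "\<sigma> t x u \<mu> - \<sigma> t x' u' \<mu> = \<sigma>1 t * (x - x') + \<sigma>2 t * (u - u')"
    "t\<sigma> t x u \<mu> - t\<sigma> t x' u' \<mu> = t\<sigma>1 t * (x - x') + t\<sigma>2 t * (u - u')"
  by (simp_all add: affine_eq[OF assms] algebra_simps)

text \<open>
  The difference of two states solves a linear equation, so by the product formula its second moment is
  bounded by a multiple of its own time integral.
\<close>

lemma state_solution_unique:
  assumes u: "u \<in> L2_prog M T F"
    and X: "state_solution M T W tW \<xi> b \<sigma> t\<sigma> m u X" and Y: "state_solution M T W tW \<xi> b \<sigma> t\<sigma> m u Y"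
  shows "AE z in prod_upto T. X (fst z) (snd z) = Y (fst z) (snd z)" "AE \<omega> in M. X T \<omega> = Y T \<omega>"
proof -
  interpret P: pair_sigma_finite "time_upto T" M by (rule pair_sigma_finite_prod_upto)
  note IX = state_solution_ito_process[OF u X] and IY = state_solution_ito_process[OF u Y]
  define D where "D t \<omega> = X t \<omega> - Y t \<omega>" for t \<omega>
  define a where "a t = (\<integral>\<omega>. (D t \<omega>)\<^sup>2 \<partial>M)" for t
  define K where "K = 2 * L + 2 * L\<^sup>2"
  have DL: "process_L2 T D"
    unfolding D_def using ito_process_process_L2[OF IX] ito_process_process_L2[OF IY] by (rule square_integrable_diff)
  have DT: "square_integrable M (D t)" if "t \<in> {0..T}" for t
    unfolding D_def using ito_process_square_integrable[OF IX that] ito_process_square_integrable[OF IY that]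
    by (rule square_integrable_diff)
  have i: "integrable (prod_upto t) (case_prod (\<lambda>s \<omega>. (D s \<omega>)\<^sup>2))" if "t \<in> {0..T}" for t
    using square_integrable_power2[OF process_L2_mono[OF DL]] that by (simp add: split_beta')
  have a_int: "(\<integral>s. a s \<partial>time_upto t) = (\<integral>z. (D (fst z) (snd z))\<^sup>2 \<partial>prod_upto t)" if t: "t \<in> {0..T}" for t
  proof -
    interpret Pt: pair_sigma_finite "time_upto t" M by (rule pair_sigma_finite_prod_upto)
    show ?thesis using Pt.integral_fst[OF i[OF t]] by (simp add: a_def split_beta')
  qed
  have init: "(\<integral>\<omega>. (X 0 \<omega> - Y 0 \<omega>)\<^sup>2 \<partial>M) = 0"
  proof -
    have "AE \<omega> in M. X 0 \<omega> = \<xi> \<omega>" "AE \<omega> in M. Y 0 \<omega> = \<xi> \<omega>"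
      using X Y by (auto simp: state_solution_def)
    then have "AE \<omega> in M. (X 0 \<omega> - Y 0 \<omega>)\<^sup>2 = 0" by eventually_elim simp
    then show ?thesis by (rule integral_eq_zero_AE)
  qed
  have a_le: "a t \<le> K * (\<integral>s. a s \<partial>time_upto t)" if t: "t \<in> {0..T}" for t
  proof -
    have tT: "t \<le> T" using t by simp
    have pt: "fst z \<in> {0..T}" "m (fst z) (snd z) \<in> P2" if "z \<in> space (prod_upto t)" for z
      using space_prod_upto[OF that] t flow_P2[of "fst z" "snd z"] by auto
    note dI = ito_square_diff_expectation[OF IX IY t]
    let ?b = "\<lambda>s \<omega>. b s (X s \<omega>) (u s \<omega>) (m s \<omega>) - b s (Y s \<omega>) (u s \<omega>) (m s \<omega>)"
    let ?s = "\<lambda>s \<omega>. \<sigma> s (X s \<omega>) (u s \<omega>) (m s \<omega>) - \<sigma> s (Y s \<omega>) (u s \<omega>) (m s \<omega>)"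
    let ?ts = "\<lambda>s \<omega>. t\<sigma> s (X s \<omega>) (u s \<omega>) (m s \<omega>) - t\<sigma> s (Y s \<omega>) (u s \<omega>) (m s \<omega>)"
    have D2: "integrable (prod_upto t) (\<lambda>z. (D (fst z) (snd z))\<^sup>2)"
      by (rule square_integrable_power2[OF process_L2_mono[OF DL tT]])
    have L2: "process_L2 t ?b" "process_L2 t ?s" "process_L2 t ?ts"
      by (intro square_integrable_diff process_L2_mono[OF _ tT] ito_process_measurable(3)[OF IX] ito_process_measurable(3)[OF IY]
          ito_process_diffusion_L2[OF IX] ito_process_diffusion_L2[OF IY])+
    have Dt: "process_L2 t D" by (rule process_L2_mono[OF DL tT])
    have bound: "k * d * d \<le> L * (d * d)" if "\<bar>k\<bar> \<le> L" for k d :: real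
      using mult_right_mono[of k L "d * d"] that by (simp add: mult.assoc)
    define S where "S = (\<integral>z. (D (fst z) (snd z))\<^sup>2 \<partial>prod_upto t)"
    have S: "(\<integral>z. k * (D (fst z) (snd z))\<^sup>2 \<partial>prod_upto t) = k * S" for k
      by (simp add: S_def)
    have 1: "process_inner t ?b D \<le> (\<integral>z. L * (D (fst z) (snd z))\<^sup>2 \<partial>prod_upto t)"
    proof (rule integral_mono)
      fix z assume "z \<in> space (prod_upto t)"
      from affine_differences(1)[OF pt[OF this]] affine_bounds(1)[OF pt(1)[OF this]]
      show "?b (fst z) (snd z) * D (fst z) (snd z) \<le> L * (D (fst z) (snd z))\<^sup>2"
        using bound[of "b1 (fst z)" "D (fst z) (snd z)"] by (simp add: D_def power2_eq_square)
    qed (use D2 square_integrable_mult[OF L2(1) Dt] in auto)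
    have sq: "(k * d)\<^sup>2 \<le> L\<^sup>2 * d\<^sup>2" if "\<bar>k\<bar> \<le> L" for k d :: real
    proof -
      have "\<bar>k\<bar>\<^sup>2 \<le> L\<^sup>2" using that by (intro power_mono) auto
      then show ?thesis by (simp add: power_mult_distrib mult_right_mono)
    qed
    have 2: "process_inner t ?s ?s \<le> (\<integral>z. L\<^sup>2 * (D (fst z) (snd z))\<^sup>2 \<partial>prod_upto t)"
    proof (rule integral_mono)
      fix z assume "z \<in> space (prod_upto t)"
      from affine_differences(2)[OF pt[OF this]] affine_bounds(3)[OF pt(1)[OF this]]
      show "?s (fst z) (snd z) * ?s (fst z) (snd z) \<le> L\<^sup>2 * (D (fst z) (snd z))\<^sup>2"
        using sq[of "\<sigma>1 (fst z)" "D (fst z) (snd z)"] by (simp add: D_def power2_eq_square)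
    qed (use D2 square_integrable_mult[OF L2(2,2)] in auto)
    have 3: "process_inner t ?ts ?ts \<le> (\<integral>z. L\<^sup>2 * (D (fst z) (snd z))\<^sup>2 \<partial>prod_upto t)"
    proof (rule integral_mono)
      fix z assume "z \<in> space (prod_upto t)"
      from affine_differences(3)[OF pt[OF this]] affine_bounds(5)[OF pt(1)[OF this]]
      show "?ts (fst z) (snd z) * ?ts (fst z) (snd z) \<le> L\<^sup>2 * (D (fst z) (snd z))\<^sup>2"
        using sq[of "t\<sigma>1 (fst z)" "D (fst z) (snd z)"] by (simp add: D_def power2_eq_square)
    qed (use D2 square_integrable_mult[OF L2(3,3)] in auto)
    have "a t = 2 * process_inner t ?b D + process_inner t ?s ?s + process_inner t ?ts ?ts"
      using dI by (simp only: a_def D_def init add_0_left)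
    also have "\<dots> \<le> 2 * (L * S) + L\<^sup>2 * S + L\<^sup>2 * S"
      using 1 2 3 unfolding S by linarith
    also have "\<dots> = K * S" by (simp add: K_def algebra_simps)
    finally show ?thesis unfolding a_int[OF t] S_def .
  qed
  have a_zero: "(\<integral>s. a s \<partial>time_upto t) = 0" if "t \<in> {0..T}" for t
  proof (rule gronwall_zero[OF _ _ _ a_le that])
    show "integrable (time_upto T) a"
      using P.integrable_fst[OF i[OF T_mem(1)]] by (simp add: a_def[abs_def])
    show "0 \<le> K" using L_pos by (simp add: K_def)
    show "0 \<le> a t" for t by (simp add: a_def)
  qed
  have "(\<integral>z. (D (fst z) (snd z))\<^sup>2 \<partial>prod_upto T) = 0"
    using a_zero[OF T_mem(1)] a_int[OF T_mem(1)] by simp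
  then have "AE z in prod_upto T. (D (fst z) (snd z))\<^sup>2 = 0"
    using square_integrable_power2[OF DL] by (subst (asm) integral_nonneg_eq_0_iff_AE) auto
  then show "AE z in prod_upto T. X (fst z) (snd z) = Y (fst z) (snd z)"
    by eventually_elim (simp add: D_def)
  have "(\<integral>\<omega>. (D T \<omega>)\<^sup>2 \<partial>M) = 0"
    using a_le[OF T_mem(1)] a_zero[OF T_mem(1)] by (simp add: a_def order.antisym)
  then have "AE \<omega> in M. (D T \<omega>)\<^sup>2 = 0"
    using square_integrable_power2[OF DT[OF T_mem(1)]] by (subst (asm) integral_nonneg_eq_0_iff_AE) auto
  then show "AE \<omega> in M. X T \<omega> = Y T \<omega>"
    by eventually_elim (simp add: D_def)
qed

text \<open>
  Both parts of the cost are integrable by the growth bounds, hence the cost is a genuine integral over the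
  product of time and scenarios.
\<close>

lemma cost_eq:
  assumes u: "u \<in> L2_prog M T F" and X: "state_solution M T W tW \<xi> b \<sigma> t\<sigma> m u X"
  shows "integrable (prod_upto T) (\<lambda>z. f (fst z) (X (fst z) (snd z)) (u (fst z) (snd z)) (m (fst z) (snd z)))"
    and "integrable M (\<lambda>\<omega>. g (X T \<omega>) (m T \<omega>))"
    and "cost M T f g m u X = (\<integral>z. f (fst z) (X (fst z) (snd z)) (u (fst z) (snd z)) (m (fst z) (snd z)) \<partial>prod_upto T)
      + (\<integral>\<omega>. g (X T \<omega>) (m T \<omega>) \<partial>M)"
proof -
  interpret P: pair_sigma_finite "time_upto T" M by (rule pair_sigma_finite_prod_upto)
  interpret Q: finite_measure "prod_upto T" by (rule finite_measure_prod_upto)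
  note IX = state_solution_ito_process[OF u X]
  have XL: "process_L2 T X" and uL: "process_L2 T u" and prog: "progressive T F borel X" "progressive T F borel u"
    using u X by (auto simp: L2_prog_iff state_solution_def)
  define s where "s t \<omega> = sqrt (second_moment (m t \<omega>))" for t \<omega>
  define B where "B t \<omega> = L * (1 + (s t \<omega>)\<^sup>2) + (L * (1 + \<bar>X t \<omega>\<bar> + \<bar>u t \<omega>\<bar> + s t \<omega>)) * (\<bar>X t \<omega>\<bar> + \<bar>u t \<omega>\<bar>)" for t \<omega>
  have "integrable (prod_upto T) (\<lambda>z. L * (1 + (s (fst z) (snd z))\<^sup>2))"
    using square_integrable_power2[OF flow_L2] by (simp add: s_def)
  moreover have "integrable (prod_upto T) (\<lambda>z. (L * (1 + \<bar>X (fst z) (snd z)\<bar> + \<bar>u (fst z) (snd z)\<bar> + s (fst z) (snd z)))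
      * (\<bar>X (fst z) (snd z)\<bar> + \<bar>u (fst z) (snd z)\<bar>))"
    using flow_growth_L2[OF XL uL] unfolding s_def
    by (rule square_integrable_mult) (intro square_integrable_add square_integrable_abs XL uL)
  ultimately have Bi: "integrable (prod_upto T) (\<lambda>z. B (fst z) (snd z))"
    unfolding B_def by (rule Bochner_Integration.integrable_add)
  show fi: "integrable (prod_upto T) (\<lambda>z. f (fst z) (X (fst z) (snd z)) (u (fst z) (snd z)) (m (fst z) (snd z)))"
  proof (rule Bochner_Integration.integrable_bound[OF Bi])
    show "(\<lambda>z. f (fst z) (X (fst z) (snd z)) (u (fst z) (snd z)) (m (fst z) (snd z))) \<in> borel_measurable (prod_upto T)"
      by (rule progressive_measurable_prod[OF progressive_coeff[OF measurable_f prog] T_mem(1)])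
    show "AE z in prod_upto T. norm (f (fst z) (X (fst z) (snd z)) (u (fst z) (snd z)) (m (fst z) (snd z)))
        \<le> norm (B (fst z) (snd z))"
      unfolding B_def s_def real_norm_def
      using f_growth[OF flow_prod] by (intro AE_I2 order_trans[OF _ abs_ge_self])
  qed
  have XT: "square_integrable M (X T)" by (rule ito_process_square_integrable[OF IX T_mem(1)])
  have sT: "square_integrable M (s T)" unfolding s_def by (rule flow_terminal_L2)
  have Ci: "integrable M (\<lambda>\<omega>. L * (1 + (s T \<omega>)\<^sup>2) + (L * (1 + \<bar>X T \<omega>\<bar> + s T \<omega>)) * \<bar>X T \<omega>\<bar>)"
  proof (rule Bochner_Integration.integrable_add)
    show "integrable M (\<lambda>\<omega>. L * (1 + (s T \<omega>)\<^sup>2))"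
      using square_integrable_power2[OF sT] by simp
    show "integrable M (\<lambda>\<omega>. (L * (1 + \<bar>X T \<omega>\<bar> + s T \<omega>)) * \<bar>X T \<omega>\<bar>)"
      by (intro square_integrable_mult square_integrable_cmult square_integrable_add
        square_integrable_abs square_integrable_const XT sT)
  qed
  show gi: "integrable M (\<lambda>\<omega>. g (X T \<omega>) (m T \<omega>))"
  proof (rule Bochner_Integration.integrable_bound[OF Ci])
    have "m T \<in> M \<rightarrow>\<^sub>M P2_algebra"
      using measurable_F_M[OF progressive_adapted[OF flow_progressive T_mem(1)]] by simp
    then have "(\<lambda>\<omega>. (X T \<omega>, m T \<omega>)) \<in> M \<rightarrow>\<^sub>M borel \<Otimes>\<^sub>M P2_algebra"
      using XT by (auto simp: square_integrable_def)
    from measurable_compose[OF this measurable_g] show "(\<lambda>\<omega>. g (X T \<omega>) (m T \<omega>)) \<in> borel_measurable M" by simp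
    show "AE \<omega> in M. norm (g (X T \<omega>) (m T \<omega>))
        \<le> norm (L * (1 + (s T \<omega>)\<^sup>2) + (L * (1 + \<bar>X T \<omega>\<bar> + s T \<omega>)) * \<bar>X T \<omega>\<bar>)"
      unfolding s_def real_norm_def
      using g_growth[OF flow_P2[OF T_mem(1)]] T_pos by (intro AE_I2 order_trans[OF _ abs_ge_self]) auto
  qed
  have fi': "integrable (prod_upto T) (case_prod (\<lambda>t \<omega>. f t (X t \<omega>) (u t \<omega>) (m t \<omega>)))"
    using fi by (simp add: split_beta')
  have "cost M T f g m u X = (\<integral>\<omega>. (\<integral>t. f t (X t \<omega>) (u t \<omega>) (m t \<omega>) \<partial>time_upto T) + g (X T \<omega>) (m T \<omega>) \<partial>M)"
    by (simp add: cost_def integral_restrict_space set_lebesgue_integral_def)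
  also have "\<dots> = (\<integral>\<omega>. (\<integral>t. f t (X t \<omega>) (u t \<omega>) (m t \<omega>) \<partial>time_upto T) \<partial>M) + (\<integral>\<omega>. g (X T \<omega>) (m T \<omega>) \<partial>M)"
    by (rule Bochner_Integration.integral_add[OF P.integrable_snd[OF fi'] gi])
  finally show "cost M T f g m u X = (\<integral>z. f (fst z) (X (fst z) (snd z)) (u (fst z) (snd z)) (m (fst z) (snd z)) \<partial>prod_upto T)
      + (\<integral>\<omega>. g (X T \<omega>) (m T \<omega>) \<partial>M)"
    using P.integral_snd[OF fi'] by (simp add: split_beta')
qed

lemma adjoint_drift_L2_prog:
  assumes "X \<in> L2_prog M T F" "u \<in> L2_prog M T F" "p \<in> L2_prog M T F" "q \<in> L2_prog M T F" "tq \<in> L2_prog M T F"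
  shows "(\<lambda>t \<omega>. - deriv (\<lambda>x. hamiltonian b \<sigma> t\<sigma> f t x (p t \<omega>) (q t \<omega>) (tq t \<omega>) (u t \<omega>) (m t \<omega>)) (X t \<omega>)) \<in> L2_prog M T F"
    (is "?\<alpha> \<in> _")
proof -
  have prog: "progressive T F borel ?\<alpha>"
    unfolding progressive_iff
  proof
    fix t assume t: "t \<in> {0..T}"
    let ?N = "restrict_space borel {0..t} \<Otimes>\<^sub>M F t"
    note [measurable] = measurable_slopes[OF progressive_time[OF t]]
    have [measurable]: "(\<lambda>z. X (fst z) (snd z)) \<in> borel_measurable ?N" "(\<lambda>z. u (fst z) (snd z)) \<in> borel_measurable ?N"
      "(\<lambda>z. p (fst z) (snd z)) \<in> borel_measurable ?N" "(\<lambda>z. q (fst z) (snd z)) \<in> borel_measurable ?N"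
      "(\<lambda>z. tq (fst z) (snd z)) \<in> borel_measurable ?N" and mN: "(\<lambda>z. m (fst z) (snd z)) \<in> ?N \<rightarrow>\<^sub>M P2_algebra"
      using assms flow_progressive t by (auto simp: L2_prog_iff progressive_iff)
    have [measurable]: "(\<lambda>z. fx (fst z) (X (fst z) (snd z)) (u (fst z) (snd z)) (m (fst z) (snd z))) \<in> borel_measurable ?N"
      by (rule measurable_fx[OF progressive_time[OF t] _ _ mN]) measurable
    have "(\<lambda>z. - (b1 (fst z) * p (fst z) (snd z) + \<sigma>1 (fst z) * q (fst z) (snd z) + t\<sigma>1 (fst z) * tq (fst z) (snd z)
        + fx (fst z) (X (fst z) (snd z)) (u (fst z) (snd z)) (m (fst z) (snd z)))) \<in> borel_measurable ?N"
      by measurable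
    then show "(\<lambda>z. ?\<alpha> (fst z) (snd z)) \<in> borel_measurable ?N"
    proof (rule measurable_cong[THEN iffD1, rotated])
      fix z assume z: "z \<in> space ?N"
      show "- (b1 (fst z) * p (fst z) (snd z) + \<sigma>1 (fst z) * q (fst z) (snd z) + t\<sigma>1 (fst z) * tq (fst z) (snd z)
        + fx (fst z) (X (fst z) (snd z)) (u (fst z) (snd z)) (m (fst z) (snd z))) = ?\<alpha> (fst z) (snd z)"
        using hamiltonian_x_deriv[OF time_space_value[OF progressive_time[OF t] z] P2_algebra_value[OF mN z]] by simp
    qed
  qed
  have L2: "process_L2 T X" "process_L2 T u" "process_L2 T p" "process_L2 T q" "process_L2 T tq"
    using assms by (auto simp: L2_prog_iff)
  have "process_L2 T ?\<alpha>"
  proof (rule square_integrable_bound[OF _ progressive_measurable_prod[OF prog T_mem(1)]])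
    show "process_L2 T (\<lambda>t \<omega>. L * (\<bar>p t \<omega>\<bar> + \<bar>q t \<omega>\<bar> + \<bar>tq t \<omega>\<bar>)
        + L * (1 + \<bar>X t \<omega>\<bar> + \<bar>u t \<omega>\<bar> + sqrt (second_moment (m t \<omega>))))"
      by (intro square_integrable_add flow_growth_L2 square_integrable_cmult square_integrable_abs L2)
    show "AE z in prod_upto T. \<bar>?\<alpha> (fst z) (snd z)\<bar> \<le> \<bar>L * (\<bar>p (fst z) (snd z)\<bar> + \<bar>q (fst z) (snd z)\<bar> + \<bar>tq (fst z) (snd z)\<bar>)
        + L * (1 + \<bar>X (fst z) (snd z)\<bar> + \<bar>u (fst z) (snd z)\<bar> + sqrt (second_moment (m (fst z) (snd z))))\<bar>"
    proof (rule AE_I2)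
      fix z assume z: "z \<in> space (prod_upto T)"
      define t where "t = fst z"
      define \<omega> where "\<omega> = snd z"
      have t: "t \<in> {0..T}" and mP: "m t \<omega> \<in> P2" using flow_prod[OF z] by (auto simp: t_def \<omega>_def)
      have slopes: "\<bar>b1 t * p t \<omega>\<bar> \<le> L * \<bar>p t \<omega>\<bar>" "\<bar>\<sigma>1 t * q t \<omega>\<bar> \<le> L * \<bar>q t \<omega>\<bar>"
          "\<bar>t\<sigma>1 t * tq t \<omega>\<bar> \<le> L * \<bar>tq t \<omega>\<bar>"
        using affine_bounds[OF t] by (auto simp: abs_mult intro: mult_right_mono)
      have triangle: "\<bar>- (a + a' + a'' + d)\<bar> \<le> A + A' + A'' + d'"
        if "\<bar>a\<bar> \<le> A" "\<bar>a'\<bar> \<le> A'" "\<bar>a''\<bar> \<le> A''" "\<bar>d\<bar> \<le> d'" for a a' a'' d A A' A'' d' :: real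
        using that by linarith
      have "\<bar>?\<alpha> t \<omega>\<bar> \<le> L * \<bar>p t \<omega>\<bar> + L * \<bar>q t \<omega>\<bar> + L * \<bar>tq t \<omega>\<bar>
        + L * (1 + \<bar>X t \<omega>\<bar> + \<bar>u t \<omega>\<bar> + sqrt (second_moment (m t \<omega>)))"
        unfolding hamiltonian_x_deriv[OF t mP] by (rule triangle[OF slopes partials_bound(1)[OF t mP]])
      also have "\<dots> = L * (\<bar>p t \<omega>\<bar> + \<bar>q t \<omega>\<bar> + \<bar>tq t \<omega>\<bar>)
        + L * (1 + \<bar>X t \<omega>\<bar> + \<bar>u t \<omega>\<bar> + sqrt (second_moment (m t \<omega>)))"
        by (simp only: distrib_left)
      finally show "\<bar>?\<alpha> (fst z) (snd z)\<bar> \<le> \<bar>L * (\<bar>p (fst z) (snd z)\<bar> + \<bar>q (fst z) (snd z)\<bar> + \<bar>tq (fst z) (snd z)\<bar>)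
        + L * (1 + \<bar>X (fst z) (snd z)\<bar> + \<bar>u (fst z) (snd z)\<bar> + sqrt (second_moment (m (fst z) (snd z))))\<bar>"
        unfolding t_def \<omega>_def by (rule order_trans[OF _ abs_ge_self])
    qed
  qed
  with prog show ?thesis by (simp add: L2_prog_iff)
qed

text \<open>
  Let \<open>D = Y - X'\<close> and let \<open>R = f\<^sub>x D + f\<^sub>u (v - u)\<close> be the derivative of the running cost at \<open>(X, u)\<close>.  The
  product formula for \<open>D\<close> and \<open>p\<close> gives \<open>E[D\<^sub>T p\<^sub>T] = - E \<integral> R dt\<close>: the adjoint drift \<open>- \<partial>\<^sub>x H\<close> absorbs all terms with
  \<open>D\<close>, and the first order condition replaces the slope of the Hamiltonian in the control by \<open>- f\<^sub>u\<close>.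
  Convexity bounds the two cost differences from below by \<open>E \<integral> R dt\<close> and \<open>E[D\<^sub>T p\<^sub>T]\<close>, which cancel.
\<close>

theorem maximum_principle:
  fixes X p q tq :: "real \<Rightarrow> 'a \<Rightarrow> real"
  defines "u \<equiv> u_hat_process b \<sigma> t\<sigma> f X p q tq"
  defines "\<alpha> \<equiv> \<lambda>t \<omega>. - deriv (\<lambda>x. hamiltonian b \<sigma> t\<sigma> f t x (p t \<omega>) (q t \<omega>) (tq t \<omega>) (u t \<omega>) (m t \<omega>)) (X t \<omega>)"
  assumes u: "u \<in> L2_prog M T F" and X: "state_solution M T W tW \<xi> b \<sigma> t\<sigma> m u X"
    and p: "ito_process_L2 p \<alpha> q tq" and terminal: "AE \<omega> in M. p T \<omega> = gx (X T \<omega>) (m T \<omega>)"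
    and v: "v \<in> L2_prog M T F"
    and X': "state_solution M T W tW \<xi> b \<sigma> t\<sigma> m u X'" and Y: "state_solution M T W tW \<xi> b \<sigma> t\<sigma> m v Y"
  shows "cost M T f g m u X' \<le> cost M T f g m v Y"
proof -
  note IX = state_solution_ito_process[OF u X'] and IY = state_solution_ito_process[OF v Y]
  note L2p = ito_process_process_L2[OF p] and L2q = ito_process_diffusion_L2[OF p] and L2\<alpha> = ito_process_measurable(3)[OF p]
  note L2X = ito_process_process_L2[OF IX] ito_process_measurable(3)[OF IX] ito_process_diffusion_L2[OF IX]
  note L2Y = ito_process_process_L2[OF IY] ito_process_measurable(3)[OF IY] ito_process_diffusion_L2[OF IY]
  define R where "R z = fx (fst z) (X (fst z) (snd z)) (u (fst z) (snd z)) (m (fst z) (snd z)) * (Y (fst z) (snd z) - X' (fst z) (snd z))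
    + fu (fst z) (X (fst z) (snd z)) (u (fst z) (snd z)) (m (fst z) (snd z)) * (v (fst z) (snd z) - u (fst z) (snd z))" for z
  let ?b = "\<lambda>t \<omega>. b t (Y t \<omega>) (v t \<omega>) (m t \<omega>) - b t (X' t \<omega>) (u t \<omega>) (m t \<omega>)"
  let ?s = "\<lambda>t \<omega>. \<sigma> t (Y t \<omega>) (v t \<omega>) (m t \<omega>) - \<sigma> t (X' t \<omega>) (u t \<omega>) (m t \<omega>)"
  let ?ts = "\<lambda>t \<omega>. t\<sigma> t (Y t \<omega>) (v t \<omega>) (m t \<omega>) - t\<sigma> t (X' t \<omega>) (u t \<omega>) (m t \<omega>)"
  let ?D = "\<lambda>t \<omega>. Y t \<omega> - X' t \<omega>"
  have i: "integrable (prod_upto T) (\<lambda>z. ?b (fst z) (snd z) * p (fst z) (snd z))"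
    "integrable (prod_upto T) (\<lambda>z. ?D (fst z) (snd z) * \<alpha> (fst z) (snd z))"
    "integrable (prod_upto T) (\<lambda>z. ?s (fst z) (snd z) * q (fst z) (snd z))"
    "integrable (prod_upto T) (\<lambda>z. ?ts (fst z) (snd z) * tq (fst z) (snd z))"
    by (intro square_integrable_mult square_integrable_diff L2p L2q L2\<alpha> L2X L2Y)+
  \<comment> \<open>the drift of \<open>p\<close> cancels the terms with \<open>Y - X'\<close>, and the first order condition for \<open>u\<close> turns what remains
    into the derivative of the running cost in direction \<open>(Y - X', v - u)\<close>\<close>
  have R: "- R z = ?b (fst z) (snd z) * p (fst z) (snd z) + ?D (fst z) (snd z) * \<alpha> (fst z) (snd z)
      + ?s (fst z) (snd z) * q (fst z) (snd z) + ?ts (fst z) (snd z) * tq (fst z) (snd z)"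
    if z: "z \<in> space (prod_upto T)" for z
  proof -
    define t where "t = fst z"
    define \<omega> where "\<omega> = snd z"
    have t: "t \<in> {0..T}" and mP: "m t \<omega> \<in> P2" using flow_prod[OF z] by (auto simp: t_def \<omega>_def)
    have foc: "fu t (X t \<omega>) (u t \<omega>) (m t \<omega>) = - control_slope t (p t \<omega>) (q t \<omega>) (tq t \<omega>)"
      using u_hat_first_order[OF t, of "p t \<omega>" "q t \<omega>" "tq t \<omega>" "X t \<omega>"]
      unfolding f_partials(2)[OF t mP] u_def u_hat_process_def by linarith
    show ?thesis
      unfolding R_def \<alpha>_def t_def[symmetric] \<omega>_def[symmetric] affine_differences[OF t mP] hamiltonian_x_deriv[OF t mP] foc
      by (simp add: algebra_simps)
  qed
  have Ri: "integrable (prod_upto T) R"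
  proof -
    have "integrable (prod_upto T) (\<lambda>z. - R z)"
      using i by (subst Bochner_Integration.integrable_cong[OF refl R]) auto
    then show ?thesis by simp
  qed
  have int_R: "- (\<integral>z. R z \<partial>prod_upto T)
      = process_inner T ?b p + process_inner T ?D \<alpha> + process_inner T ?s q + process_inner T ?ts tq"
  proof -
    have "- (\<integral>z. R z \<partial>prod_upto T) = (\<integral>z. - R z \<partial>prod_upto T)" by simp
    also have "\<dots> = (\<integral>z. ?b (fst z) (snd z) * p (fst z) (snd z) + ?D (fst z) (snd z) * \<alpha> (fst z) (snd z)
      + ?s (fst z) (snd z) * q (fst z) (snd z) + ?ts (fst z) (snd z) * tq (fst z) (snd z) \<partial>prod_upto T)"
      by (rule Bochner_Integration.integral_cong[OF refl R])
    also have "\<dots> = process_inner T ?b p + process_inner T ?D \<alpha> + process_inner T ?s q + process_inner T ?ts tq"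
      by (simp only: Bochner_Integration.integral_add Bochner_Integration.integrable_add i)
    finally show ?thesis .
  qed
  have init: "(\<integral>\<omega>. Y 0 \<omega> * p 0 \<omega> \<partial>M) = (\<integral>\<omega>. X' 0 \<omega> * p 0 \<omega> \<partial>M)"
  proof (rule integral_cong_AE)
    have [measurable]: "Y 0 \<in> borel_measurable M" "X' 0 \<in> borel_measurable M" "p 0 \<in> borel_measurable M"
      using ito_process_measurable(7)[OF IY T_mem(2)] ito_process_measurable(7)[OF IX T_mem(2)] ito_process_measurable(7)[OF p T_mem(2)] by auto
    show "(\<lambda>\<omega>. Y 0 \<omega> * p 0 \<omega>) \<in> borel_measurable M" "(\<lambda>\<omega>. X' 0 \<omega> * p 0 \<omega>) \<in> borel_measurable M"
      by measurable
    have "AE \<omega> in M. Y 0 \<omega> = \<xi> \<omega>" "AE \<omega> in M. X' 0 \<omega> = \<xi> \<omega>"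
      using X' Y by (auto simp: state_solution_def)
    then show "AE \<omega> in M. Y 0 \<omega> * p 0 \<omega> = X' 0 \<omega> * p 0 \<omega>" by eventually_elim simp
  qed
  have sqT: "square_integrable M (Y T)" "square_integrable M (X' T)" "square_integrable M (p T)"
    using ito_process_square_integrable[OF IY T_mem(1)] ito_process_square_integrable[OF IX T_mem(1)]
      ito_process_square_integrable[OF p T_mem(1)] by auto
  have dual: "(\<integral>\<omega>. (Y T \<omega> - X' T \<omega>) * p T \<omega> \<partial>M) = - (\<integral>z. R z \<partial>prod_upto T)"
  proof -
    have "(\<integral>\<omega>. (Y T \<omega> - X' T \<omega>) * p T \<omega> \<partial>M) = (\<integral>\<omega>. Y T \<omega> * p T \<omega> \<partial>M) - (\<integral>\<omega>. X' T \<omega> * p T \<omega> \<partial>M)"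
      using square_integrable_mult[OF sqT(1,3)] square_integrable_mult[OF sqT(2,3)] by (simp add: left_diff_distrib)
    then show ?thesis
      unfolding ito_product_expectation[OF IY p T_mem(1)] ito_product_expectation[OF IX p T_mem(1)] int_R init
        process_inner_diff_left[OF L2Y(2) L2X(2) L2p] process_inner_diff_left[OF L2Y(1) L2X(1) L2\<alpha>]
        process_inner_diff_left[OF L2Y(3) L2X(3) L2q(1)] process_inner_diff_left[OF L2Y(4) L2X(4) L2q(2)]
      by simp
  qed
  note cX = cost_eq[OF u X'] and cY = cost_eq[OF v Y]
  have "(\<integral>z. R z \<partial>prod_upto T) \<le> (\<integral>z. f (fst z) (Y (fst z) (snd z)) (v (fst z) (snd z)) (m (fst z) (snd z))
      - f (fst z) (X' (fst z) (snd z)) (u (fst z) (snd z)) (m (fst z) (snd z)) \<partial>prod_upto T)"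
  proof (rule integral_mono_AE[OF Ri Bochner_Integration.integrable_diff[OF cY(1) cX(1)]])
    show "AE z in prod_upto T. R z \<le> f (fst z) (Y (fst z) (snd z)) (v (fst z) (snd z)) (m (fst z) (snd z))
      - f (fst z) (X' (fst z) (snd z)) (u (fst z) (snd z)) (m (fst z) (snd z))"
      using state_solution_unique(1)[OF u X X'] AE_space
    proof eventually_elim
      case (elim z)
      show ?case unfolding R_def elim(1) by (rule f_above_tangent[OF flow_prod[OF elim(2)]])
    qed
  qed
  moreover have "(\<integral>\<omega>. (Y T \<omega> - X' T \<omega>) * p T \<omega> \<partial>M) \<le> (\<integral>\<omega>. g (Y T \<omega>) (m T \<omega>) - g (X' T \<omega>) (m T \<omega>) \<partial>M)"
  proof (rule integral_mono_AE[OF square_integrable_mult[OF square_integrable_diff[OF sqT(1,2)] sqT(3)]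
        Bochner_Integration.integrable_diff[OF cY(2) cX(2)]])
    show "AE \<omega> in M. (Y T \<omega> - X' T \<omega>) * p T \<omega> \<le> g (Y T \<omega>) (m T \<omega>) - g (X' T \<omega>) (m T \<omega>)"
      using terminal state_solution_unique(2)[OF u X X'] AE_space
    proof eventually_elim
      case (elim \<omega>)
      show ?case
        using g_above_tangent[OF flow_P2[OF T_mem(1) elim(3)], of "X' T \<omega>" "Y T \<omega>"]
        unfolding elim(1,2) by (simp add: mult.commute)
    qed
  qed
  ultimately show ?thesis
    unfolding cX(3) cY(3) using dual cX(1,2) cY(1,2) by simp
qed

end

theorem theorem3p3:
  fixes M :: "'a measure" and T L Bu :: real
    and W tW :: "real \<Rightarrow> 'a \<Rightarrow> real" and \<xi> :: "'a \<Rightarrow> real"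
    and b \<sigma> t\<sigma> f :: coeff and g :: "real \<Rightarrow> real measure \<Rightarrow> real"
    and f0 :: "real \<Rightarrow> real \<Rightarrow> real \<Rightarrow> real" and f1 :: "real \<Rightarrow> real \<Rightarrow> real measure \<Rightarrow> real"
    and X p q tq :: "real \<Rightarrow> 'a \<Rightarrow> real" and m :: "real \<Rightarrow> 'a \<Rightarrow> real measure"
  assumes "common_noise_setup M T W tW \<xi>"
    and "measurable_coeff T b" "measurable_coeff T \<sigma>" "measurable_coeff T t\<sigma>" "measurable_coeff T f"
    and "(\<lambda>(x, m). g x m) \<in> borel_measurable (borel \<Otimes>\<^sub>M P2_algebra)"
    and "0 < L"
    and "H1 T L Bu b \<sigma> t\<sigma>" "H2 T L f g" "H3 T L f f0 f1 g" "H4 T f0 f1 g"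
    and "\<xi> \<in> borel_measurable (full_filtration M W tW \<xi> 0)" "integrable M (\<lambda>\<omega>. (\<xi> \<omega>)\<^sup>2)"
    and "fbsde_solution M T W tW \<xi> b \<sigma> t\<sigma> f g X p q tq m"
    and "(\<integral>\<^sup>+\<omega>. (SUP t\<in>{0..T}. ennreal ((norm (X t \<omega>, p t \<omega>))\<^sup>2))
            + (\<integral>\<^sup>+t\<in>{0..T}. ennreal ((norm (q t \<omega>, tq t \<omega>))\<^sup>2) \<partial>lborel) \<partial>M) < \<infinity>"
  shows "u_hat_process b \<sigma> t\<sigma> f X p q tq \<in> L2_prog M T (full_filtration M W tW \<xi>) \<and>
         state_solution M T W tW \<xi> b \<sigma> t\<sigma> m (u_hat_process b \<sigma> t\<sigma> f X p q tq) X \<and>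
         cond_law_flow M T (noise_filtration M tW) X m \<and>
         optimal_control M T W tW \<xi> b \<sigma> t\<sigma> f g m (u_hat_process b \<sigma> t\<sigma> f X p q tq)"
proof -
  interpret common_noise M T W tW \<xi> by unfold_locales (rule assms(1))
  obtain b0 b1 b2 \<sigma>0 \<sigma>1 \<sigma>2 t\<sigma>0 t\<sigma>1 t\<sigma>2 where affine:
    "affine_coeff T L b b0 b1 b2" "affine_coeff T L \<sigma> \<sigma>0 \<sigma>1 \<sigma>2" "affine_coeff T L t\<sigma> t\<sigma>0 t\<sigma>1 t\<sigma>2"
    using assms(8) unfolding H1_def by blast
  define u where "u = u_hat_process b \<sigma> t\<sigma> f X p q tq"
  define \<alpha> where "\<alpha> = (\<lambda>t \<omega>. - deriv (\<lambda>x. hamiltonian b \<sigma> t\<sigma> f t x (p t \<omega>) (q t \<omega>) (tq t \<omega>) (u t \<omega>) (m t \<omega>)) (X t \<omega>))"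
  have flow: "cond_law_flow M T (noise_filtration M tW) X m"
    and dX: "has_ito_differential M T F W tW X (\<lambda>t \<omega>. b t (X t \<omega>) (u t \<omega>) (m t \<omega>))
           (\<lambda>t \<omega>. \<sigma> t (X t \<omega>) (u t \<omega>) (m t \<omega>)) (\<lambda>t \<omega>. t\<sigma> t (X t \<omega>) (u t \<omega>) (m t \<omega>))"
    and dp: "has_ito_differential M T F W tW p \<alpha> q tq"
    and X0: "AE \<omega> in M. X 0 \<omega> = \<xi> \<omega>"
    and terminal: "AE \<omega> in M. p T \<omega> = deriv (\<lambda>x. g x (m T \<omega>)) (X T \<omega>)"
    using assms(14) unfolding fbsde_solution_def Let_def u_def \<alpha>_def by auto
  have T: "T \<in> {0..T}" "0 \<in> {0..T}" using T_pos by auto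
  have prog: "progressive T F borel X" "progressive T F borel p"
    using dX dp by (auto simp: has_ito_differential_def)
  have qL: "q \<in> L2_prog M T F" "tq \<in> L2_prog M T F"
    using dp T unfolding has_ito_differential_def has_ito_integral_def by blast+
  define C where "C = (\<integral>\<^sup>+\<omega>. (SUP t\<in>{0..T}. ennreal ((norm (X t \<omega>, p t \<omega>))\<^sup>2))
            + (\<integral>\<^sup>+t\<in>{0..T}. ennreal ((norm (q t \<omega>, tq t \<omega>))\<^sup>2) \<partial>lborel) \<partial>M)"
  have C: "C < \<infinity>" using assms(15) by (simp add: C_def)
  have moments: "(\<integral>\<^sup>+\<omega>. ennreal ((X t \<omega>)\<^sup>2) \<partial>M) \<le> C" "(\<integral>\<^sup>+\<omega>. ennreal ((p t \<omega>)\<^sup>2) \<partial>M) \<le> C"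
    if t: "t \<in> {0..T}" for t
  proof -
    have sup: "ennreal ((X t \<omega>)\<^sup>2 + (p t \<omega>)\<^sup>2) \<le> (SUP t\<in>{0..T}. ennreal ((norm (X t \<omega>, p t \<omega>))\<^sup>2))" for \<omega>
      using SUP_upper[OF t, of "\<lambda>t. ennreal ((norm (X t \<omega>, p t \<omega>))\<^sup>2)"] by (simp add: norm_Pair)
    have "ennreal ((X t \<omega>)\<^sup>2) \<le> ennreal ((X t \<omega>)\<^sup>2 + (p t \<omega>)\<^sup>2)" "ennreal ((p t \<omega>)\<^sup>2) \<le> ennreal ((X t \<omega>)\<^sup>2 + (p t \<omega>)\<^sup>2)" for \<omega>
      by (auto intro!: ennreal_leI)
    then show "(\<integral>\<^sup>+\<omega>. ennreal ((X t \<omega>)\<^sup>2) \<partial>M) \<le> C" "(\<integral>\<^sup>+\<omega>. ennreal ((p t \<omega>)\<^sup>2) \<partial>M) \<le> C"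
      unfolding C_def by (intro nn_integral_mono add_increasing2 order_trans[OF _ sup]; simp)+
  qed
  have XL: "X \<in> L2_prog M T F" and pL: "p \<in> L2_prog M T F"
    using prog process_L2_of_bounded_moments[OF progressive_measurable_prod[OF prog(1) T(1)] moments(1) C]
      process_L2_of_bounded_moments[OF progressive_measurable_prod[OF prog(2) T(1)] moments(2) C]
    by (auto simp: L2_prog_iff)
  have Xm: "X t \<in> borel_measurable M" if "t \<in> {0..T}" for t
    using measurable_F_M[OF progressive_adapted[OF prog(1) that]] that by simp
  have flow_L2: "progressive T F P2_algebra m" "process_L2 T (\<lambda>t \<omega>. sqrt (second_moment (m t \<omega>)))"
    "square_integrable M (\<lambda>\<omega>. sqrt (second_moment (m T \<omega>)))"
    using cond_law_flow_L2[OF flow Xm moments(1) C] T(1) by blast+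
  interpret mean_field_game M T W tW \<xi> L b \<sigma> t\<sigma> f g f0 f1 b0 \<sigma>0 t\<sigma>0 b1 b2 \<sigma>1 \<sigma>2 t\<sigma>1 t\<sigma>2 m
    using assms(2,5-7,9-11) affine flow_L2 by unfold_locales
  have uL: "u \<in> L2_prog M T F"
    unfolding u_def by (rule u_hat_L2_prog[OF XL pL qL])
  have state: "state_solution M T W tW \<xi> b \<sigma> t\<sigma> m u X"
    unfolding state_solution_def using XL dX X0 by blast
  have p0: "square_integrable M (p 0)"
  proof -
    have m: "p 0 \<in> borel_measurable M"
      using measurable_F_M[OF progressive_adapted[OF prog(2) T(2)]] T_pos by simp
    then show ?thesis
      using order_le_less_trans[OF moments(2)[OF T(2)] C] by (simp add: square_integrable_iff_nn_integral)
  qed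
  have adjoint: "ito_process_L2 p \<alpha> q tq"
    unfolding ito_process_L2_def using dp adjoint_drift_L2_prog[OF XL uL pL qL] p0 by (simp add: \<alpha>_def)
  have "cost M T f g m u X' \<le> cost M T f g m v Y"
    if "v \<in> L2_prog M T F" "state_solution M T W tW \<xi> b \<sigma> t\<sigma> m u X'" "state_solution M T W tW \<xi> b \<sigma> t\<sigma> m v Y" for v X' Y
    using maximum_principle[OF uL[unfolded u_def] state[unfolded u_def] adjoint[unfolded \<alpha>_def u_def] terminal that(1)
        that(2)[unfolded u_def] that(3)]
    by (simp add: u_def)
  then have "optimal_control M T W tW \<xi> b \<sigma> t\<sigma> f g m u"
    unfolding optimal_control_def using uL state by blast
  with uL state flow show ?thesis unfolding u_def by blast
qed

end
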